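(* For any intermediate logic $\mathsf L$ the following are equivalent: (i) $\mathsf L$ has hereditary unitary unification; (ii) $\mathsf L(\mathbf H_{un})\subseteq\mathsf L$; (iii) $\mathsf L$ omits the frames $\mathfrak R_2+$, $\mathfrak G_3+$ and $\mathfrak F_2$; (iv) $\chi(\mathfrak G_3+),\chi(\mathfrak R_2+),\chi(\mathfrak F_2)\in\mathsf L$.
   Context: An intermediate logic is a set of intuitionistic propositional formulas containing $\mathsf{INT}$, closed under modus ponens and substitution. A frame is a finite poset with least element; $\mathsf L(\mathbf F)$ is the set of formulas valid in all Kripke models over frames of $\mathbf F$; $\mathsf L$ omits $\mathfrak F$ if $\mathsf L\not\subseteq\mathsf L(\mathfrak F)$. $\chi(\mathfrak F)$ is Jankov's characteristic formula: for any intermediate logic $\mathsf L$, $\chi(\mathfrak F)\in\mathsf L$ iff $\mathsf L$ omits $\mathfrak F$. Frames: $\mathfrak L_d$ the $d$-element chain; $\mathfrak F_n$ ($n\ge2$) root with $n$ incomparable maximal elements, $\mathfrak F_0=\mathfrak L_1$, $\mathfrak F_1=\mathfrak L_2$; for disjoint frames, $\mathfrak F+\mathfrak G$ is the union with every element of $\mathfrak F$ below every element of $\mathfrak G$ (rooted at the root of $\mathfrak F$); $\mathfrak F+$ is $\mathfrak F$ with a top added; $\mathfrak R_n=\mathfrak F_n+$; $\mathfrak G_3$ has elements $r,a,b,c$ with $r<a$, $r<b<c$ and no other relations beyond transitivity. $\mathbf H_{un}=\{\mathfrak L_d+\mathfrak R_m: d,m\ge0\}$ with $\mathfrak L_0+\mathfrak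 R_m=\mathfrak R_m$ and $\mathfrak R_0=\mathfrak L_1$. Unification in $\mathsf L$ is unitary if every $\mathsf L$-unifiable formula $A$ has an $\mathsf L$-unifier $\varepsilon$ ($\varepsilon(A)\in\mathsf L$) such that for every $\mathsf L$-unifier $\mu$ of $A$, $\alpha\circ\varepsilon=_{\mathsf L}\mu$ for some substitution $\alpha$. $\mathsf L$ has hereditary unitary unification if every intermediate logic extending $\mathsf L$ (including $\mathsf L$) has unitary unification. *)

theory Defs
  imports Main "HOL-Library.Nat_Bijection"
begin

section \<open>Formulas, substitutions, intermediate logics\<close>

datatype form =
    Var nat
  | Bot ("\<^bold>\<bottom>")
  | Conj form form (infixr "\<^bold>\<and>" 35)
  | Disj form form (infixr "\<^bold>\<or>" 30)
  | Imp form form (infixr "\<^bold>\<longrightarrow>" 25)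

abbreviation Iff :: "form \<Rightarrow> form \<Rightarrow> form" (infix "\<^bold>\<longleftrightarrow>" 25) where
  "A \<^bold>\<longleftrightarrow> B \<equiv> (A \<^bold>\<longrightarrow> B) \<^bold>\<and> (B \<^bold>\<longrightarrow> A)"

type_synonym substitution = "nat \<Rightarrow> form"

primrec subst :: "substitution \<Rightarrow> form \<Rightarrow> form" where
  "subst \<sigma> (Var x) = \<sigma> x"
| "subst \<sigma> \<^bold>\<bottom> = \<^bold>\<bottom>"
| "subst \<sigma> (A \<^bold>\<and> B) = (subst \<sigma> A \<^bold>\<and> subst \<sigma> B)"
| "subst \<sigma> (A \<^bold>\<or> B) = (subst \<sigma> A \<^bold>\<or> subst \<sigma> B)"
| "subst \<sigma> (A \<^bold>\<longrightarrow> B) = (subst \<sigma> A \<^bold>\<longrightarrow> subst \<sigma> B)"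

definition subst_comp :: "substitution \<Rightarrow> substitution \<Rightarrow> substitution" (infixl "\<circ>\<^sub>s" 55) where
  "(\<alpha> \<circ>\<^sub>s \<epsilon>) = (\<lambda>x. subst \<alpha> (\<epsilon> x))"

inductive_set IPC :: "form set" where
  IPC_K: "(A \<^bold>\<longrightarrow> B \<^bold>\<longrightarrow> A) \<in> IPC"
| IPC_S: "((A \<^bold>\<longrightarrow> B \<^bold>\<longrightarrow> C) \<^bold>\<longrightarrow> (A \<^bold>\<longrightarrow> B) \<^bold>\<longrightarrow> A \<^bold>\<longrightarrow> C) \<in> IPC"
| IPC_conjE1: "(A \<^bold>\<and> B \<^bold>\<longrightarrow> A) \<in> IPC"
| IPC_conjE2: "(A \<^bold>\<and> B \<^bold>\<longrightarrow> B) \<in> IPC"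
| IPC_conjI: "(A \<^bold>\<longrightarrow> B \<^bold>\<longrightarrow> A \<^bold>\<and> B) \<in> IPC"
| IPC_disjI1: "(A \<^bold>\<longrightarrow> A \<^bold>\<or> B) \<in> IPC"
| IPC_disjI2: "(B \<^bold>\<longrightarrow> A \<^bold>\<or> B) \<in> IPC"
| IPC_disjE: "((A \<^bold>\<longrightarrow> C) \<^bold>\<longrightarrow> (B \<^bold>\<longrightarrow> C) \<^bold>\<longrightarrow> A \<^bold>\<or> B \<^bold>\<longrightarrow> C) \<in> IPC"
| IPC_botE: "(\<^bold>\<bottom> \<^bold>\<longrightarrow> A) \<in> IPC"
| IPC_MP: "(A \<^bold>\<longrightarrow> B) \<in> IPC \<Longrightarrow> A \<in> IPC \<Longrightarrow> B \<in> IPC"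

text \<open>The inconsistent logic (all formulas) counts as an intermediate logic.\<close>

definition intermediate_logic :: "form set \<Rightarrow> bool" where
  "intermediate_logic L \<longleftrightarrow>
     IPC \<subseteq> L \<and>
     (\<forall>A B. (A \<^bold>\<longrightarrow> B) \<in> L \<longrightarrow> A \<in> L \<longrightarrow> B \<in> L) \<and>
     (\<forall>\<sigma> A. A \<in> L \<longrightarrow> subst \<sigma> A \<in> L)"

section \<open>Unification\<close>

definition unifier :: "form set \<Rightarrow> substitution \<Rightarrow> form \<Rightarrow> bool" where
  "unifier L \<epsilon> A \<longleftrightarrow> subst \<epsilon> A \<in> L"

definition subst_eq :: "form set \<Rightarrow> substitution \<Rightarrow> substitution \<Rightarrow> bool" where
  "subst_eq L \<sigma> \<tau> \<longleftrightarrow> (\<forall>x. (\<sigma> x \<^bold>\<longleftrightarrow> \<tau> x) \<in> L)"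

definition unitary_unification :: "form set \<Rightarrow> bool" where
  "unitary_unification L \<longleftrightarrow>
     (\<forall>A. (\<exists>\<sigma>. unifier L \<sigma> A) \<longrightarrow>
        (\<exists>\<epsilon>. unifier L \<epsilon> A \<and>
             (\<forall>\<mu>. unifier L \<mu> A \<longrightarrow> (\<exists>\<alpha>. subst_eq L (\<alpha> \<circ>\<^sub>s \<epsilon>) \<mu>))))"

definition hereditary_unitary_unification :: "form set \<Rightarrow> bool" where
  "hereditary_unitary_unification L \<longleftrightarrow>
     (\<forall>L'. intermediate_logic L' \<longrightarrow> L \<subseteq> L' \<longrightarrow> unitary_unification L')"

section \<open>Frames and validity\<close>

text \<open>A frame is given by its (reflexive) order relation; its set of points is the field of
  that relation.  As frames are finite, points are taken to be natural numbers.\<close>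

type_synonym frame = "nat rel"

definition is_frame :: "frame \<Rightarrow> bool" where
  "is_frame F \<longleftrightarrow> finite (Field F) \<and> Partial_order F \<and>
     (\<exists>r\<in>Field F. \<forall>w\<in>Field F. (r, w) \<in> F)"

definition persistent :: "frame \<Rightarrow> (nat \<Rightarrow> nat \<Rightarrow> bool) \<Rightarrow> bool" where
  "persistent F V \<longleftrightarrow> (\<forall>w v x. (w, v) \<in> F \<longrightarrow> V w x \<longrightarrow> V v x)"

primrec forces :: "frame \<Rightarrow> (nat \<Rightarrow> nat \<Rightarrow> bool) \<Rightarrow> nat \<Rightarrow> form \<Rightarrow> bool" where
  "forces F V w (Var x) \<longleftrightarrow> V w x"
| "forces F V w \<^bold>\<bottom> \<longleftrightarrow> False"
| "forces F V w (A \<^bold>\<and> B) \<longleftrightarrow> forces F V w A \<and> forces F V w B"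
| "forces F V w (A \<^bold>\<or> B) \<longleftrightarrow> forces F V w A \<or> forces F V w B"
| "forces F V w (A \<^bold>\<longrightarrow> B) \<longleftrightarrow>
     (\<forall>v. (w, v) \<in> F \<longrightarrow> forces F V v A \<longrightarrow> forces F V v B)"

definition valid :: "frame \<Rightarrow> form \<Rightarrow> bool" where
  "valid F A \<longleftrightarrow> (\<forall>V. persistent F V \<longrightarrow> (\<forall>w\<in>Field F. forces F V w A))"

definition logic_of :: "frame set \<Rightarrow> form set" where
  "logic_of \<F> = {A. \<forall>F\<in>\<F>. valid F A}"

definition omits :: "form set \<Rightarrow> frame \<Rightarrow> bool" where
  "omits L F \<longleftrightarrow> \<not> L \<subseteq> logic_of {F}"

section \<open>The frames\<close>

text \<open>The ordered sum; the points of the two summands are first made disjoint by the injections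
  \<open>x \<mapsto> 2 x\<close> and \<open>x \<mapsto> 2 x + 1\<close>.\<close>

definition frame_sum :: "frame \<Rightarrow> frame \<Rightarrow> frame" where
  "frame_sum F G =
     {(2 * x, 2 * y) | x y. (x, y) \<in> F} \<union>
     {(2 * x + 1, 2 * y + 1) | x y. (x, y) \<in> G} \<union>
     {(2 * x, 2 * y + 1) | x y. x \<in> Field F \<and> y \<in> Field G}"

definition chain_frame :: "nat \<Rightarrow> frame" where
  "chain_frame d = {(i, j). i \<le> j \<and> j < d}"

definition add_top :: "frame \<Rightarrow> frame" where
  "add_top F = frame_sum F (chain_frame 1)"

definition fork_frame :: "nat \<Rightarrow> frame" where
  "fork_frame n = {(i, j). j \<le> n \<and> (i = 0 \<or> i = j)}"

definition rfork_frame :: "nat \<Rightarrow> frame" where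
  "rfork_frame m = (if m = 0 then chain_frame 1 else add_top (fork_frame m))"

text \<open>\<open>G3_frame\<close> has the points \<open>r, a, b, c\<close> numbered \<open>0, 1, 2, 3\<close>.\<close>

definition G3_frame :: frame where
  "G3_frame = Id_on {0, 1, 2, 3} \<union> {(0, 1), (0, 2), (0, 3), (2, 3)}"

definition H_un :: "frame set" where
  "H_un = {(if d = 0 then rfork_frame m else frame_sum (chain_frame d) (rfork_frame m)) | d m. True}"

section \<open>Jankov's characteristic formula\<close>

text \<open>Jankov's formula of the Heyting algebra of upsets of \<open>F\<close>: it says that if the diagram of
  the algebra holds, where the variable \<open>up_var U\<close> stands for the upset \<open>U\<close>, then so does the
  second largest upset, which consists of all points but the root.\<close>

definition upset :: "frame \<Rightarrow> nat set \<Rightarrow> bool" where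
  "upset F U \<longleftrightarrow> U \<subseteq> Field F \<and> (\<forall>w v. w \<in> U \<longrightarrow> (w, v) \<in> F \<longrightarrow> v \<in> U)"

definition upset_imp :: "frame \<Rightarrow> nat set \<Rightarrow> nat set \<Rightarrow> nat set" where
  "upset_imp F U V = {w \<in> Field F. \<forall>v. (w, v) \<in> F \<longrightarrow> v \<in> U \<longrightarrow> v \<in> V}"

definition frame_root :: "frame \<Rightarrow> nat" where
  "frame_root F = (THE r. r \<in> Field F \<and> (\<forall>w\<in>Field F. (r, w) \<in> F))"

definition up_var :: "nat set \<Rightarrow> form" where
  "up_var U = Var (set_encode U)"

definition upset_list :: "frame \<Rightarrow> nat set list" where
  "upset_list F = map set_decode (sorted_list_of_set (set_encode ` {U. upset F U}))"

definition big_conj :: "form list \<Rightarrow> form" where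
  "big_conj As = foldr Conj As (\<^bold>\<bottom> \<^bold>\<longrightarrow> \<^bold>\<bottom>)"

definition diagram :: "frame \<Rightarrow> form" where
  "diagram F =
     ((up_var {} \<^bold>\<longleftrightarrow> \<^bold>\<bottom>) \<^bold>\<and>
     big_conj [
       (up_var (U \<inter> V) \<^bold>\<longleftrightarrow> (up_var U \<^bold>\<and> up_var V)) \<^bold>\<and>
       (up_var (U \<union> V) \<^bold>\<longleftrightarrow> (up_var U \<^bold>\<or> up_var V)) \<^bold>\<and>
       (up_var (upset_imp F U V) \<^bold>\<longleftrightarrow> (up_var U \<^bold>\<longrightarrow> up_var V)).
       U \<leftarrow> upset_list F, V \<leftarrow> upset_list F])"

definition jankov :: "frame \<Rightarrow> form" where
  "jankov F = (diagram F \<^bold>\<longrightarrow> up_var (Field F - {frame_root F}))"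

section \<open>Basic facts\<close>

lemma Field_chain_frame: "Field (chain_frame d) = {..<d}"
  by (force simp: chain_frame_def Field_def)

lemma Field_fork_frame: "Field (fork_frame n) = {..n}"
  by (force simp: fork_frame_def Field_def)

lemma fork_frame_0: "fork_frame 0 = chain_frame 1"
  and fork_frame_1: "fork_frame 1 = chain_frame 2"
  by (auto simp: fork_frame_def chain_frame_def)

lemma frame_sum_iff [simp]:
  "(2 * x, 2 * y) \<in> frame_sum F G \<longleftrightarrow> (x, y) \<in> F"
  "(Suc (2 * x), Suc (2 * y)) \<in> frame_sum F G \<longleftrightarrow> (x, y) \<in> G"
  "(2 * x, Suc (2 * y)) \<in> frame_sum F G \<longleftrightarrow> x \<in> Field F \<and> y \<in> Field G"
  "(Suc (2 * x), 2 * y) \<notin> frame_sum F G"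
  by (auto simp: frame_sum_def; presburger)+

lemma Field_frame_sum:
  "Field (frame_sum F G) = (\<lambda>x. 2 * x) ` Field F \<union> (\<lambda>x. 2 * x + 1) ` Field G"
proof
  show "Field (frame_sum F G) \<subseteq> (\<lambda>x. 2 * x) ` Field F \<union> (\<lambda>x. 2 * x + 1) ` Field G"
    unfolding frame_sum_def by (auto simp: Field_def)
  have "2 * x \<in> Field (frame_sum F G)" if "x \<in> Field F" for x
    using that frame_sum_iff(1) unfolding Field_def by blast
  moreover have "Suc (2 * x) \<in> Field (frame_sum F G)" if "x \<in> Field G" for x
    using that frame_sum_iff(2) unfolding Field_def by blast
  ultimately show "(\<lambda>x. 2 * x) ` Field F \<union> (\<lambda>x. 2 * x + 1) ` Field G \<subseteq> Field (frame_sum F G)"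
    by auto
qed

lemma is_frame_chain: "d \<ge> 1 \<Longrightarrow> is_frame (chain_frame d)"
  unfolding is_frame_def Field_chain_frame
  by (auto simp: partial_order_on_def preorder_on_def refl_on_def trans_def antisym_def chain_frame_def Field_def)

lemma is_frame_fork: "is_frame (fork_frame n)"
  unfolding is_frame_def Field_fork_frame
  by (auto simp: partial_order_on_def preorder_on_def refl_on_def trans_def antisym_def fork_frame_def Field_def)

lemma is_frame_G3: "is_frame G3_frame"
proof -
  have G: "G3_frame = {(0,0), (1,1), (2,2), (3,3), (0,1), (0,2), (0,3), (2,3)}"
    by (simp add: G3_frame_def Id_on_def insert_commute)
  have F: "Field G3_frame = {0, 1, 2, 3}"
    by (simp add: G insert_commute)
  have "\<forall>p\<in>G3_frame. \<forall>q\<in>G3_frame. snd p = fst q \<longrightarrow> (fst p, snd q) \<in> G3_frame"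
    by (simp add: G)
  then have "trans G3_frame"
    by (force intro: transI)
  moreover have "\<forall>p\<in>G3_frame. \<forall>q\<in>G3_frame. p = prod.swap q \<longrightarrow> fst p = snd p"
    by (simp add: G)
  then have "antisym G3_frame"
    by (force intro: antisymI)
  moreover have "refl_on (Field G3_frame) G3_frame"
    by (simp add: refl_on_def F) (simp add: G)
  moreover have "G3_frame \<subseteq> Field G3_frame \<times> Field G3_frame"
    by (simp add: F) (simp add: G)
  moreover have "\<forall>w\<in>Field G3_frame. (0, w) \<in> G3_frame" "finite (Field G3_frame)" "0 \<in> Field G3_frame"
    by (simp_all add: F) (simp add: G)
  ultimately show ?thesis
    unfolding is_frame_def partial_order_on_def preorder_on_def by blast
qed

lemma is_frame_sum:
  assumes "is_frame F" and "is_frame G"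
  shows "is_frame (frame_sum F G)"
proof -
  let ?S = "frame_sum F G"
  have F: "refl_on (Field F) F" "trans F" "antisym F" "finite (Field F)"
    and G: "refl_on (Field G) G" "trans G" "antisym G" "finite (Field G)"
    using assms by (auto simp: is_frame_def partial_order_on_def preorder_on_def)
  obtain r where r: "r \<in> Field F" "\<forall>w\<in>Field F. (r, w) \<in> F"
    using assms(1) by (auto simp: is_frame_def)
  have split: "\<exists>k. n = 2 * k \<or> n = Suc (2 * k)" for n :: nat
    by presburger
  have "refl_on (Field ?S) ?S"
    using F(1) G(1) unfolding Field_frame_sum by (auto simp: refl_on_def)
  moreover have "trans ?S"
  proof (rule transI)
    fix x y z assume *: "(x, y) \<in> ?S" "(y, z) \<in> ?S"
    obtain i j k where "x = 2 * i \<or> x = Suc (2 * i)" "y = 2 * j \<or> y = Suc (2 * j)"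
      "z = 2 * k \<or> z = Suc (2 * k)"
      using split by meson
    with * show "(x, z) \<in> ?S"
      by - (elim disjE; clarsimp; metis F(2) G(2) transD FieldI1 FieldI2)
  qed
  moreover have "antisym ?S"
  proof (rule antisymI)
    fix x y assume *: "(x, y) \<in> ?S" "(y, x) \<in> ?S"
    obtain i j where "x = 2 * i \<or> x = Suc (2 * i)" "y = 2 * j \<or> y = Suc (2 * j)"
      using split by meson
    with * show "x = y"
      by - (elim disjE; clarsimp; metis F(3) G(3) antisymD)
  qed
  moreover have "finite (Field ?S)"
    using F(4) G(4) by (simp add: Field_frame_sum)
  moreover have "2 * r \<in> Field ?S"
    using r(1) by (simp add: Field_frame_sum)
  moreover have "\<forall>w\<in>Field ?S. (2 * r, w) \<in> ?S"
    using r unfolding Field_frame_sum by auto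
  moreover have "?S \<subseteq> Field ?S \<times> Field ?S"
    by (simp add: Field_def subset_iff Domain.intros Range.intros)
  ultimately show ?thesis
    unfolding is_frame_def partial_order_on_def preorder_on_def by blast
qed

lemma is_frame_add_top: "is_frame F \<Longrightarrow> is_frame (add_top F)"
  by (simp add: add_top_def is_frame_sum is_frame_chain)

lemma is_frame_rfork: "is_frame (rfork_frame m)"
  by (simp add: rfork_frame_def is_frame_add_top is_frame_fork is_frame_chain)

lemma is_frame_H_un: "F \<in> H_un \<Longrightarrow> is_frame F"
  by (auto simp: H_un_def is_frame_sum is_frame_rfork is_frame_chain)

end

theory Submission
  imports Defs
begin

text \<open>All arguments take place in the canonical model of \<open>L\<close>, whose points are the prime theories
  containing \<open>L\<close>.  A p-morphism from the cone of a point onto a finite frame, if it is definable by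
  formulas, refutes that \<open>L\<close> omits the frame.  Hence, if the three frames are omitted, every cone has
  a greatest element and of two incomparable points both are coatoms, so that each cone consists of
  a chain, an antichain of coatoms and a top.  This yields the finite model property
  with respect to \<open>H_un\<close>.

  It also yields unitary unification.  Given a unifier \<open>\<mu>\<close> of \<open>A\<close>, a new variable \<open>y\<close> may mark the points at
  which the variables of \<open>\<mu>\<close> have their final values; once the valuation at the top and the
  set of valuations at the coatoms outside \<open>y\<close> are prescribed, the formula becomes projective.  There are finitely
  many prescriptions, and as \<open>\<not> q \<or> \<not> \<not> q\<close> holds in \<open>L\<close>, their projective unifiers can be
  glued into one by means of further variables \<open>q\<close>.

  Conversely, over each of the three frames there are unifiers of a disjunction without a common
  generalisation: models of suitable instances can be glued to one at whose root both disjuncts fail.\<close>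

section \<open>Forcing over arbitrary relations\<close>

text \<open>The canonical model is infinite and sets of its points need not be definable. Hence the
  shape of a cone has to be read off from formulas that separate single points, and the
  prescriptions speak of a variable \<open>y\<close> rather than of coatoms. A formula is projective
  once every point whose proper successors already have fitting values can be given one as well.
  Along a chain nothing goes wrong, as a point may copy its successors. The obstacle is a point
  directly below an antichain: a unifiable A may forbid some coatom values to meet above one root.
  Values that a single unifier \<mu> realises over one top can always meet: some substitution s
  makes the instance of \<mu> by s take exactly these values at the coatoms, and this instance still
  unifies A at the root. This is why sets S of values taken from unifiers are the right
  prescriptions.\<close>

primrec vars :: "form \<Rightarrow> nat set" where
  "vars (Var x) = {x}"
| "vars \<^bold>\<bottom> = {}"
| "vars (A \<^bold>\<and> B) = vars A \<union> vars B"
| "vars (A \<^bold>\<or> B) = vars A \<union> vars B"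
| "vars (A \<^bold>\<longrightarrow> B) = vars A \<union> vars B"

lemma finite_vars [simp]: "finite (vars A)"
  by (induction A) auto

abbreviation Neg :: "form \<Rightarrow> form" ("\<^bold>\<not> _" [40] 40) where
  "\<^bold>\<not> A \<equiv> (A \<^bold>\<longrightarrow> \<^bold>\<bottom>)"

abbreviation Top :: form ("\<^bold>\<top>") where
  "\<^bold>\<top> \<equiv> (\<^bold>\<bottom> \<^bold>\<longrightarrow> \<^bold>\<bottom>)"

lemma subst_Var [simp]: "subst Var A = A"
  by (induction A) auto

lemma subst_subst: "subst \<sigma> (subst \<tau> A) = subst (\<lambda>x. subst \<sigma> (\<tau> x)) A"
  by (induction A) auto

lemma subst_cong_vars: "(\<And>x. x \<in> vars A \<Longrightarrow> \<sigma> x = \<tau> x) \<Longrightarrow> subst \<sigma> A = subst \<tau> A"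
  by (induction A) auto

text \<open>Carrier and relation are arbitrary, so that finite frames and the canonical model share
  one notion of truth and can be compared by bisimulations.\<close>

primrec sat :: "('a \<Rightarrow> 'a \<Rightarrow> bool) \<Rightarrow> ('a \<Rightarrow> nat \<Rightarrow> bool) \<Rightarrow> 'a \<Rightarrow> form \<Rightarrow> bool" where
  "sat R V w (Var x) \<longleftrightarrow> V w x"
| "sat R V w \<^bold>\<bottom> \<longleftrightarrow> False"
| "sat R V w (A \<^bold>\<and> B) \<longleftrightarrow> sat R V w A \<and> sat R V w B"
| "sat R V w (A \<^bold>\<or> B) \<longleftrightarrow> sat R V w A \<or> sat R V w B"
| "sat R V w (A \<^bold>\<longrightarrow> B) \<longleftrightarrow> (\<forall>v. R w v \<longrightarrow> sat R V v A \<longrightarrow> sat R V v B)"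

lemma forces_eq_sat: "forces F V w A \<longleftrightarrow> sat (\<lambda>a b. (a, b) \<in> F) V w A"
  by (induction A arbitrary: w) auto

text \<open>Atoms have to agree on the variables of \<open>C\<close> only. This is what makes it
  possible to identify infinitely many points that have the same value on finitely many
  variables.\<close>

lemma sat_bisim:
  assumes atom: "\<And>a b x. Z a b \<Longrightarrow> x \<in> vars C \<Longrightarrow> V a x = V' b x"
    and fwd: "\<And>a b a'. Z a b \<Longrightarrow> R a a' \<Longrightarrow> \<exists>b'. R' b b' \<and> Z a' b'"
    and bwd: "\<And>a b b'. Z a b \<Longrightarrow> R' b b' \<Longrightarrow> \<exists>a'. R a a' \<and> Z a' b'"
    and "Z a b"
  shows "sat R V a C \<longleftrightarrow> sat R' V' b C"
  using \<open>Z a b\<close> atom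
proof (induction C arbitrary: a b)
  case (Imp C D)
  have C: "sat R V a C \<longleftrightarrow> sat R' V' b C" and D: "sat R V a D \<longleftrightarrow> sat R' V' b D" if "Z a b" for a b
    using Imp that by auto
  show ?case
    using fwd[OF Imp.prems(1)] bwd[OF Imp.prems(1)] C D by (simp, meson)
qed auto

lemma forces_subst: "forces F V w (subst \<sigma> A) \<longleftrightarrow> forces F (\<lambda>w x. forces F V w (\<sigma> x)) w A"
  by (induction A arbitrary: w) auto

lemma forces_mono:
  assumes "trans F" "persistent F V" "(w, v) \<in> F" "forces F V w A"
  shows "forces F V v A"
  using assms(3,4)
proof (induction A arbitrary: w v)
  case (Var x)
  then show ?case using assms(2) by (auto simp: persistent_def)
next
  case (Imp A B)
  then show ?case using assms(1) by (auto dest: transD)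
qed auto

section \<open>The canonical model\<close>

definition theory_of :: "form set \<Rightarrow> form set \<Rightarrow> bool" where
  "theory_of L T \<longleftrightarrow> L \<subseteq> T \<and> (\<forall>A B. (A \<^bold>\<longrightarrow> B) \<in> T \<longrightarrow> A \<in> T \<longrightarrow> B \<in> T)"

definition point :: "form set \<Rightarrow> form set \<Rightarrow> bool" where
  "point L w \<longleftrightarrow> theory_of L w \<and> \<^bold>\<bottom> \<notin> w \<and>
     (\<forall>A B. (A \<^bold>\<or> B) \<in> w \<longrightarrow> A \<in> w \<or> B \<in> w)"

locale logic =
  fixes L :: "form set"
  assumes intermediate: "intermediate_logic L"
begin

lemma IPC_L: "A \<in> IPC \<Longrightarrow> A \<in> L"
  using intermediate by (auto simp: intermediate_logic_def)

lemma subst_L: "A \<in> L \<Longrightarrow> subst \<sigma> A \<in> L"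
  using intermediate by (auto simp: intermediate_logic_def)

lemma theory_L: "theory_of L L"
  using intermediate by (auto simp: intermediate_logic_def theory_of_def)

lemma theory_mp: "theory_of L T \<Longrightarrow> (A \<^bold>\<longrightarrow> B) \<in> T \<Longrightarrow> A \<in> T \<Longrightarrow> B \<in> T"
  unfolding theory_of_def by blast

lemma theory_IPC: "theory_of L T \<Longrightarrow> A \<in> IPC \<Longrightarrow> A \<in> T"
  using IPC_L by (auto simp: theory_of_def)

lemma theory_K: "theory_of L T \<Longrightarrow> B \<in> T \<Longrightarrow> (A \<^bold>\<longrightarrow> B) \<in> T"
  by (meson IPC_K theory_IPC theory_mp)

lemma theory_refl: "theory_of L T \<Longrightarrow> (A \<^bold>\<longrightarrow> A) \<in> T"
  by (meson IPC_K IPC_S theory_IPC theory_mp)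

text \<open>By the deduction theorem this set is the theory generated by \<open>T\<close> and
  \<open>A\<close>, so that no derivability from assumptions has to be introduced.\<close>

lemma theory_add:
  fixes A
  assumes T: "theory_of L T"
  defines "T' \<equiv> {B. (A \<^bold>\<longrightarrow> B) \<in> T}"
  shows "theory_of L T'" "T \<subseteq> T'" "A \<in> T'"
proof -
  show "T \<subseteq> T'" "A \<in> T'"
    using theory_K[OF T] theory_refl[OF T] by (auto simp: T'_def)
  have "C \<in> T'" if "(B \<^bold>\<longrightarrow> C) \<in> T'" "B \<in> T'" for B C
    using that theory_mp[OF T] theory_IPC[OF T IPC_S] unfolding T'_def by blast
  then show "theory_of L T'"
    using \<open>T \<subseteq> T'\<close> T unfolding theory_of_def by blast
qed

lemma theory_Union:
  assumes "\<C> \<noteq> {}" "\<And>T. T \<in> \<C> \<Longrightarrow> theory_of L T" "\<And>S T. S \<in> \<C> \<Longrightarrow> T \<in> \<C> \<Longrightarrow> S \<subseteq> T \<or> T \<subseteq> S"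
  shows "theory_of L (\<Union>\<C>)"
proof -
  have "L \<subseteq> \<Union>\<C>"
    using assms(1,2) unfolding theory_of_def by blast
  moreover have "B \<in> \<Union>\<C>" if AB: "(A \<^bold>\<longrightarrow> B) \<in> \<Union>\<C>" "A \<in> \<Union>\<C>" for A B
  proof -
    obtain S T where ST: "S \<in> \<C>" "T \<in> \<C>" "(A \<^bold>\<longrightarrow> B) \<in> S" "A \<in> T"
      using AB by blast
    then consider "S \<subseteq> T" | "T \<subseteq> S"
      using assms(3) by blast
    then show ?thesis
      using ST assms(2) theory_mp by cases blast+
  qed
  ultimately show ?thesis
    unfolding theory_of_def by blast
qed

lemma point_Union:
  assumes "\<C> \<noteq> {}" "\<And>T. T \<in> \<C> \<Longrightarrow> point L T" "\<And>S T. S \<in> \<C> \<Longrightarrow> T \<in> \<C> \<Longrightarrow> S \<subseteq> T \<or> T \<subseteq> S"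
  shows "point L (\<Union>\<C>)"
  using theory_Union[OF assms(1) _ assms(3)] assms(2) unfolding point_def by blast

text \<open>Zorn's lemma is applied to all theories without \<open>D\<close>; maximality then forces
  primeness. The last clause is kept because maximal points at which a formula fails are needed
  later.\<close>

lemma extend_maximal:
  assumes T: "theory_of L T" and D: "D \<notin> T"
  shows "\<exists>w. point L w \<and> T \<subseteq> w \<and> D \<notin> w \<and> (\<forall>v. point L v \<longrightarrow> w \<subset> v \<longrightarrow> D \<in> v)"
proof -
  let ?\<A> = "{S. theory_of L S \<and> T \<subseteq> S \<and> D \<notin> S}"
  have "\<exists>M\<in>?\<A>. \<forall>X\<in>?\<A>. M \<subseteq> X \<longrightarrow> X = M"
  proof (rule subset_Zorn_nonempty)
    show "?\<A> \<noteq> {}" using T D by blast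
    fix \<C> assume "\<C> \<noteq> {}" "subset.chain ?\<A> \<C>"
    then show "\<Union>\<C> \<in> ?\<A>"
      using theory_Union[of \<C>] unfolding subset.chain_def by blast
  qed
  then obtain M where M: "theory_of L M" "T \<subseteq> M" "D \<notin> M"
    and max: "\<And>X. theory_of L X \<Longrightarrow> M \<subseteq> X \<Longrightarrow> D \<notin> X \<Longrightarrow> X = M"
    by (smt (verit, ccfv_SIG) mem_Collect_eq order_trans)
  have imp: "(A \<^bold>\<longrightarrow> D) \<in> M" if "A \<notin> M" for A
    using theory_add[OF M(1), of A] max[of "{B. (A \<^bold>\<longrightarrow> B) \<in> M}"] that by blast
  have "A \<in> M \<or> B \<in> M" if AB: "(A \<^bold>\<or> B) \<in> M" for A B
  proof (rule ccontr)
    assume "\<not> (A \<in> M \<or> B \<in> M)"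
    then have "(A \<^bold>\<longrightarrow> D) \<in> M" "(B \<^bold>\<longrightarrow> D) \<in> M"
      using imp by auto
    then have "D \<in> M"
      using AB theory_mp[OF M(1)] theory_IPC[OF M(1) IPC_disjE] by blast
    then show False using M by blast
  qed
  moreover have "\<^bold>\<bottom> \<notin> M"
    using M(3) theory_mp[OF M(1)] theory_IPC[OF M(1) IPC_botE] by blast
  ultimately have "point L M"
    using M by (auto simp: point_def)
  moreover have "D \<in> v" if "point L v" "M \<subset> v" for v
    using max[of v] that by (auto simp: point_def)
  ultimately show ?thesis
    using M by blast
qed

lemma L_iff_points: "A \<in> L \<longleftrightarrow> (\<forall>w. point L w \<longrightarrow> A \<in> w)"
proof
  assume "A \<in> L"
  then show "\<forall>w. point L w \<longrightarrow> A \<in> w"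
    unfolding point_def theory_of_def by blast
next
  assume "\<forall>w. point L w \<longrightarrow> A \<in> w"
  then show "A \<in> L"
    using extend_maximal[OF theory_L, of A] by metis
qed

lemma L_point: "A \<in> L \<Longrightarrow> point L w \<Longrightarrow> A \<in> w"
  by (simp add: L_iff_points)

lemma mem_Bot [simp]: "point L w \<Longrightarrow> \<^bold>\<bottom> \<notin> w"
  by (simp add: point_def)

lemma point_theory: "point L w \<Longrightarrow> theory_of L w"
  by (simp add: point_def)

lemma point_IPC_mp: "point L w \<Longrightarrow> (A \<^bold>\<longrightarrow> B) \<in> IPC \<Longrightarrow> A \<in> w \<Longrightarrow> B \<in> w"
  by (rule theory_mp[OF point_theory theory_IPC[OF point_theory]])

lemma mem_Conj [simp]:
  assumes w: "point L w"
  shows "(A \<^bold>\<and> B) \<in> w \<longleftrightarrow> A \<in> w \<and> B \<in> w"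
proof (intro iffI conjI; (elim conjE)?)
  assume "(A \<^bold>\<and> B) \<in> w"
  then show "A \<in> w" "B \<in> w"
    by (rule point_IPC_mp[OF w IPC_conjE1], rule point_IPC_mp[OF w IPC_conjE2])
next
  assume "A \<in> w" "B \<in> w"
  then show "(A \<^bold>\<and> B) \<in> w"
    using theory_mp[OF point_theory[OF w] point_IPC_mp[OF w IPC_conjI]] by metis
qed

lemma mem_Disj [simp]:
  assumes w: "point L w"
  shows "(A \<^bold>\<or> B) \<in> w \<longleftrightarrow> A \<in> w \<or> B \<in> w"
proof
  assume "(A \<^bold>\<or> B) \<in> w"
  then show "A \<in> w \<or> B \<in> w"
    using w by (simp add: point_def)
next
  assume "A \<in> w \<or> B \<in> w"
  then show "(A \<^bold>\<or> B) \<in> w"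
    by (elim disjE) (erule point_IPC_mp[OF w IPC_disjI1], erule point_IPC_mp[OF w IPC_disjI2])
qed

lemma mem_Imp:
  assumes w: "point L w"
  shows "(A \<^bold>\<longrightarrow> B) \<in> w \<longleftrightarrow> (\<forall>v. point L v \<longrightarrow> w \<subseteq> v \<longrightarrow> A \<in> v \<longrightarrow> B \<in> v)"
proof (intro iffI allI impI)
  fix v assume "(A \<^bold>\<longrightarrow> B) \<in> w" "point L v" "w \<subseteq> v" "A \<in> v"
  then show "B \<in> v"
    using theory_mp[OF point_theory[of v], of A B] by simp blast
next
  assume *: "\<forall>v. point L v \<longrightarrow> w \<subseteq> v \<longrightarrow> A \<in> v \<longrightarrow> B \<in> v"
  show "(A \<^bold>\<longrightarrow> B) \<in> w"
  proof (rule ccontr)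
    note add = theory_add[OF point_theory[OF w], of A]
    assume "(A \<^bold>\<longrightarrow> B) \<notin> w"
    then have B: "B \<notin> {B. (A \<^bold>\<longrightarrow> B) \<in> w}" by simp
    obtain v where v: "point L v" "{B. (A \<^bold>\<longrightarrow> B) \<in> w} \<subseteq> v" "B \<notin> v"
      using extend_maximal[OF add(1) B] by (elim exE conjE)
    have "w \<subseteq> v"
      by (rule order_trans[OF add(2) v(2)])
    moreover have "A \<in> v"
      by (rule subsetD[OF v(2) add(3)])
    ultimately have "B \<in> v"
      using * v(1) by simp
    with v(3) show False ..
  qed
qed

lemma mem_mp: "point L w \<Longrightarrow> (A \<^bold>\<longrightarrow> B) \<in> w \<Longrightarrow> A \<in> w \<Longrightarrow> B \<in> w"
  by (rule theory_mp[OF point_theory])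

lemma mem_Top [simp]: "point L w \<Longrightarrow> \<^bold>\<top> \<in> w"
  by (simp add: mem_Imp)

lemma mem_Neg: "point L w \<Longrightarrow> (\<^bold>\<not> A) \<in> w \<longleftrightarrow> (\<forall>v. point L v \<longrightarrow> w \<subseteq> v \<longrightarrow> A \<notin> v)"
  by (simp add: mem_Imp)

lemma Imp_notin:
  assumes "point L w" "(A \<^bold>\<longrightarrow> B) \<notin> w"
  obtains v where "point L v" "w \<subseteq> v" "A \<in> v" "B \<notin> v"
  using assms(2) unfolding mem_Imp[OF assms(1)] by blast

lemma point_maximal:
  assumes "point L w" "D \<notin> w"
  obtains v where "point L v" "w \<subseteq> v" "D \<notin> v" "\<And>u. point L u \<Longrightarrow> v \<subset> u \<Longrightarrow> D \<in> u"
  using extend_maximal[OF point_theory[OF assms(1)] assms(2)] by metis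

text \<open>The truth lemma for all substitutions at once: each substitution is a valuation on the
  canonical frame.\<close>

lemma mem_subst_iff_sat:
  "point L w \<Longrightarrow> subst \<sigma> A \<in> w \<longleftrightarrow> sat (\<lambda>w v. point L v \<and> w \<subseteq> v) (\<lambda>w x. \<sigma> x \<in> w) w A"
proof (induction A arbitrary: w)
  case (Imp A B)
  then show ?case by (auto simp: mem_Imp)
qed auto

text \<open>The two sides may use different substitutions. Hence a unifier can be carried from one
  part of the canonical model to another.\<close>

lemma mem_bisim:
  assumes pts: "\<And>a b. Z a b \<Longrightarrow> point L a \<and> point L b"
    and atom: "\<And>a b x. Z a b \<Longrightarrow> x \<in> vars C \<Longrightarrow> \<sigma> x \<in> a \<longleftrightarrow> \<tau> x \<in> b"
    and fwd: "\<And>a b a'. Z a b \<Longrightarrow> point L a' \<Longrightarrow> a \<subseteq> a' \<Longrightarrow> \<exists>b'. b \<subseteq> b' \<and> Z a' b'"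
    and bwd: "\<And>a b b'. Z a b \<Longrightarrow> point L b' \<Longrightarrow> b \<subseteq> b' \<Longrightarrow> \<exists>a'. a \<subseteq> a' \<and> Z a' b'"
    and Z: "Z a b"
  shows "subst \<sigma> C \<in> a \<longleftrightarrow> subst \<tau> C \<in> b"
proof -
  have "sat (\<lambda>w v. point L v \<and> w \<subseteq> v) (\<lambda>w x. \<sigma> x \<in> w) a C \<longleftrightarrow>
        sat (\<lambda>w v. point L v \<and> w \<subseteq> v) (\<lambda>w x. \<tau> x \<in> w) b C"
  proof (rule sat_bisim[where Z = Z])
    fix a b a' assume "Z a b" "point L a' \<and> a \<subseteq> a'"
    then obtain b' where "b \<subseteq> b'" "Z a' b'"
      using fwd by metis
    then show "\<exists>b'. (point L b' \<and> b \<subseteq> b') \<and> Z a' b'"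
      using pts by metis
  next
    fix a b b' assume "Z a b" "point L b' \<and> b \<subseteq> b'"
    then obtain a' where "a \<subseteq> a'" "Z a' b'"
      using bwd by metis
    then show "\<exists>a'. (point L a' \<and> a \<subseteq> a') \<and> Z a' b'"
      using pts by metis
  qed (use atom Z in auto)
  then show ?thesis
    using pts[OF Z] by (simp add: mem_subst_iff_sat)
qed

lemma mem_subst_cong:
  assumes "point L w" "\<And>v x. point L v \<Longrightarrow> w \<subseteq> v \<Longrightarrow> x \<in> vars C \<Longrightarrow> \<sigma> x \<in> v \<longleftrightarrow> \<tau> x \<in> v"
  shows "subst \<sigma> C \<in> w \<longleftrightarrow> subst \<tau> C \<in> w"
  by (rule mem_bisim[where Z = "\<lambda>a b. a = b \<and> point L a \<and> w \<subseteq> a"]) (use assms in auto)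

end

section \<open>Conjunctions and disjunctions of finite sets of formulas\<close>

definition conjs :: "form set \<Rightarrow> form" where
  "conjs \<A> = foldr Conj (SOME As. set As = \<A>) \<^bold>\<top>"

definition disjs :: "form set \<Rightarrow> form" where
  "disjs \<A> = foldr Disj (SOME As. set As = \<A>) \<^bold>\<bottom>"

lemma some_list: "finite \<A> \<Longrightarrow> set (SOME As. set As = \<A>) = \<A>"
  by (rule someI_ex) (rule finite_list)

lemma sat_conjs [simp]: "finite \<A> \<Longrightarrow> sat R V w (conjs \<A>) \<longleftrightarrow> (\<forall>A\<in>\<A>. sat R V w A)"
proof -
  have "sat R V w (foldr Conj As \<^bold>\<top>) \<longleftrightarrow> (\<forall>A\<in>set As. sat R V w A)" for As
    by (induction As) auto
  then show "finite \<A> \<Longrightarrow> ?thesis"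
    by (simp add: conjs_def some_list)
qed

lemma sat_disjs [simp]: "finite \<A> \<Longrightarrow> sat R V w (disjs \<A>) \<longleftrightarrow> (\<exists>A\<in>\<A>. sat R V w A)"
proof -
  have "sat R V w (foldr Disj As \<^bold>\<bottom>) \<longleftrightarrow> (\<exists>A\<in>set As. sat R V w A)" for As
    by (induction As) auto
  then show "finite \<A> \<Longrightarrow> ?thesis"
    by (simp add: disjs_def some_list)
qed

lemma forces_conjs [simp]: "finite \<A> \<Longrightarrow> forces F V w (conjs \<A>) \<longleftrightarrow> (\<forall>A\<in>\<A>. forces F V w A)"
  by (simp add: forces_eq_sat)

lemma vars_conjs [simp]: "finite \<A> \<Longrightarrow> vars (conjs \<A>) = \<Union>(vars ` \<A>)"
proof -
  have "vars (foldr Conj As \<^bold>\<top>) = \<Union>(vars ` set As)" for As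
    by (induction As) auto
  then show "finite \<A> \<Longrightarrow> ?thesis"
    by (simp add: conjs_def some_list)
qed

lemma vars_disjs [simp]: "finite \<A> \<Longrightarrow> vars (disjs \<A>) = \<Union>(vars ` \<A>)"
proof -
  have "vars (foldr Disj As \<^bold>\<bottom>) = \<Union>(vars ` set As)" for As
    by (induction As) auto
  then show "finite \<A> \<Longrightarrow> ?thesis"
    by (simp add: disjs_def some_list)
qed

context logic
begin

lemma mem_foldr_Conj: "point L w \<Longrightarrow> foldr Conj As \<^bold>\<top> \<in> w \<longleftrightarrow> (\<forall>A\<in>set As. A \<in> w)"
  by (induction As) auto

lemma mem_conjs [simp]: "point L w \<Longrightarrow> finite \<A> \<Longrightarrow> conjs \<A> \<in> w \<longleftrightarrow> (\<forall>A\<in>\<A>. A \<in> w)"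
  by (simp add: conjs_def some_list mem_foldr_Conj)

lemma mem_disjs [simp]: "point L w \<Longrightarrow> finite \<A> \<Longrightarrow> disjs \<A> \<in> w \<longleftrightarrow> (\<exists>A\<in>\<A>. A \<in> w)"
proof -
  have "point L w \<Longrightarrow> foldr Disj As \<^bold>\<bottom> \<in> w \<longleftrightarrow> (\<exists>A\<in>set As. A \<in> w)" for As
    by (induction As) auto
  then show "point L w \<Longrightarrow> finite \<A> \<Longrightarrow> ?thesis"
    by (simp add: disjs_def some_list)
qed

lemma mem_subst_conjs [simp]:
  "point L w \<Longrightarrow> finite \<A> \<Longrightarrow> subst \<sigma> (conjs \<A>) \<in> w \<longleftrightarrow> (\<forall>A\<in>\<A>. subst \<sigma> A \<in> w)"
  by (simp add: mem_subst_iff_sat)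

lemma mem_subst_disjs [simp]:
  "point L w \<Longrightarrow> finite \<A> \<Longrightarrow> subst \<sigma> (disjs \<A>) \<in> w \<longleftrightarrow> (\<exists>A\<in>\<A>. subst \<sigma> A \<in> w)"
  by (simp add: mem_subst_iff_sat)

end

section \<open>Jankov's theorem\<close>

lemma is_frameD:
  assumes "is_frame F"
  shows "finite (Field F)" "trans F" "antisym F" "\<And>w. w \<in> Field F \<Longrightarrow> (w, w) \<in> F"
    "frame_root F \<in> Field F" "\<And>w. w \<in> Field F \<Longrightarrow> (frame_root F, w) \<in> F"
proof -
  show F: "finite (Field F)" "trans F" "antisym F" "\<And>w. w \<in> Field F \<Longrightarrow> (w, w) \<in> F"
    using assms by (auto simp: is_frame_def partial_order_on_def preorder_on_def refl_on_def)
  obtain r where r: "r \<in> Field F \<and> (\<forall>w\<in>Field F. (r, w) \<in> F)"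
    using assms by (auto simp: is_frame_def)
  have "\<exists>!r. r \<in> Field F \<and> (\<forall>w\<in>Field F. (r, w) \<in> F)"
    using r F(3) by (blast dest: antisymD)
  from theI'[OF this] show "frame_root F \<in> Field F" "\<And>w. w \<in> Field F \<Longrightarrow> (frame_root F, w) \<in> F"
    by (auto simp: frame_root_def)
qed

lemma set_upset_list:
  assumes "is_frame F"
  shows "set (upset_list F) = {U. upset F U}"
proof -
  have fin: "finite U" if "upset F U" for U
    using that is_frameD(1)[OF assms] finite_subset by (auto simp: upset_def)
  have "finite {U. upset F U}"
    by (rule finite_subset[of _ "Pow (Field F)"]) (auto simp: upset_def is_frameD(1)[OF assms])
  then have "set (upset_list F) = (set_decode \<circ> set_encode) ` {U. upset F U}"
    by (simp add: upset_list_def image_image)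
  also have "\<dots> = {U. upset F U}"
    using fin by (auto simp: image_iff)
  finally show ?thesis .
qed

definition diagram_set :: "frame \<Rightarrow> form set" where
  "diagram_set F = {up_var {} \<^bold>\<longleftrightarrow> \<^bold>\<bottom>} \<union>
    (\<Union>U\<in>{U. upset F U}. \<Union>V\<in>{V. upset F V}.
      {up_var (U \<inter> V) \<^bold>\<longleftrightarrow> (up_var U \<^bold>\<and> up_var V), up_var (U \<union> V) \<^bold>\<longleftrightarrow> (up_var U \<^bold>\<or> up_var V),
       up_var (upset_imp F U V) \<^bold>\<longleftrightarrow> (up_var U \<^bold>\<longrightarrow> up_var V)})"

lemma forces_diagram:
  assumes "is_frame F"
  shows "forces F V w (diagram F) \<longleftrightarrow> (\<forall>A\<in>diagram_set F. forces F V w A)"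
proof -
  have "forces F V w (big_conj As) \<longleftrightarrow> (\<forall>A\<in>set As. forces F V w A)" for As
    by (induction As) (auto simp: big_conj_def)
  then show ?thesis
    by (simp add: diagram_def set_upset_list[OF assms] diagram_set_def ball_Un del: forces.simps(5))
qed

lemma (in logic) mem_diagram:
  assumes "is_frame F" "point L w"
  shows "diagram F \<in> w \<longleftrightarrow> (\<forall>A\<in>diagram_set F. A \<in> w)"
  using assms(2)
  by (simp add: diagram_def big_conj_def mem_foldr_Conj set_upset_list[OF assms(1)] diagram_set_def ball_Un)

lemma upset_forces:
  assumes "is_frame F" "persistent F V"
  shows "upset F {v \<in> Field F. forces F V v A}"
  using forces_mono[OF is_frameD(2)[OF assms(1)] assms(2)] by (auto simp: upset_def Field_def)

text \<open>If some A in L is refuted on F, replace each variable by the variable of its truth set.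
  At points containing the diagram the instance of A then amounts to the variable of the truth set
  of A, which misses the root; as the instance lies in L, the conclusion of the Jankov formula
  cannot fail there.\<close>

lemma (in logic) jankov_if_omits:
  assumes F: "is_frame F" and "omits L F"
  shows "jankov F \<in> L"
proof (rule ccontr)
  obtain A V k where A: "A \<in> L" and V: "persistent F V" and k: "k \<in> Field F" "\<not> forces F V k A"
    using assms(2) by (auto simp: omits_def logic_of_def valid_def)
  let ?r = "frame_root F"
  let ?E = "\<lambda>A. {v \<in> Field F. forces F V v A}"
  define \<sigma> where "\<sigma> x = up_var (?E (Var x))" for x
  have up: "upset F (?E A)" for A
    by (rule upset_forces[OF F V])
  assume "jankov F \<notin> L"
  then obtain u where "point L u" "jankov F \<notin> u"
    using L_iff_points by blast
  then obtain w where w: "point L w" "diagram F \<in> w" "up_var (Field F - {?r}) \<notin> w"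
    unfolding jankov_def using Imp_notin by metis
  have diag: "A \<in> v" if "A \<in> diagram_set F" "point L v" "w \<subseteq> v" for A v
    using that w(2) unfolding mem_diagram[OF F w(1)] by blast
  have rules:
    "up_var {} \<notin> v"
    "upset F U \<Longrightarrow> upset F V \<Longrightarrow> up_var (U \<inter> V) \<in> v \<longleftrightarrow> up_var U \<in> v \<and> up_var V \<in> v"
    "upset F U \<Longrightarrow> upset F V \<Longrightarrow> up_var (U \<union> V) \<in> v \<longleftrightarrow> up_var U \<in> v \<or> up_var V \<in> v"
    "upset F U \<Longrightarrow> upset F V \<Longrightarrow> up_var (upset_imp F U V) \<in> v \<longleftrightarrow> (up_var U \<^bold>\<longrightarrow> up_var V) \<in> v"
    if v: "point L v" "w \<subseteq> v" for U V v
  proof -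
    have iff: "A \<in> v \<longleftrightarrow> B \<in> v" if "(A \<^bold>\<longleftrightarrow> B) \<in> v" for A B
      using that mem_mp[OF v(1), of A B] mem_mp[OF v(1), of B A] v(1) by auto
    show "up_var {} \<notin> v"
      using diag[OF _ v, of "up_var {} \<^bold>\<longleftrightarrow> \<^bold>\<bottom>"] v(1) mem_mp[OF v(1), of "up_var {}" "\<^bold>\<bottom>"]
      by (auto simp: diagram_set_def)
    assume UV: "upset F U" "upset F V"
    have "(up_var (U \<inter> V) \<^bold>\<longleftrightarrow> (up_var U \<^bold>\<and> up_var V)) \<in> v"
      by (rule diag[OF _ v]) (use UV in \<open>auto simp: diagram_set_def\<close>)
    from iff[OF this] show "up_var (U \<inter> V) \<in> v \<longleftrightarrow> up_var U \<in> v \<and> up_var V \<in> v"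
      using v(1) by simp
    have "(up_var (U \<union> V) \<^bold>\<longleftrightarrow> (up_var U \<^bold>\<or> up_var V)) \<in> v"
      by (rule diag[OF _ v]) (use UV in \<open>auto simp: diagram_set_def\<close>)
    from iff[OF this] show "up_var (U \<union> V) \<in> v \<longleftrightarrow> up_var U \<in> v \<or> up_var V \<in> v"
      using v(1) by simp
    have "(up_var (upset_imp F U V) \<^bold>\<longleftrightarrow> (up_var U \<^bold>\<longrightarrow> up_var V)) \<in> v"
      by (rule diag[OF _ v]) (use UV in \<open>auto simp: diagram_set_def\<close>)
    from iff[OF this] show "up_var (upset_imp F U V) \<in> v \<longleftrightarrow> (up_var U \<^bold>\<longrightarrow> up_var V) \<in> v"
      .
  qed
  have truth: "subst \<sigma> C \<in> v \<longleftrightarrow> up_var (?E C) \<in> v" if "point L v" "w \<subseteq> v" for C v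
    using that
  proof (induction C arbitrary: v)
    case (Var x)
    then show ?case by (simp add: \<sigma>_def)
  next
    case Bot
    then show ?case using rules(1) by simp
  next
    case (Conj C D)
    have "?E (C \<^bold>\<and> D) = ?E C \<inter> ?E D" by auto
    with Conj show ?case using rules(2)[OF _ _ up up] by simp
  next
    case (Disj C D)
    have "?E (C \<^bold>\<or> D) = ?E C \<union> ?E D" by auto
    with Disj show ?case using rules(3)[OF _ _ up up] by simp
  next
    case (Imp C D)
    have "?E (C \<^bold>\<longrightarrow> D) = upset_imp F (?E C) (?E D)"
      by (auto simp: upset_imp_def Field_def)
    with Imp show ?case using rules(4)[OF _ _ up up] by (simp add: mem_Imp)
  qed
  have "subst \<sigma> A \<in> w"
    by (rule L_point[OF subst_L[OF A] w(1)])
  then have "up_var (?E A) \<in> w"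
    using truth w(1) by blast
  moreover have "?r \<notin> ?E A"
    using k forces_mono[OF is_frameD(2)[OF F] V is_frameD(6)[OF F]] by blast
  \<comment> \<open>Together with the diagram's clause for intersections this inclusion acts as
    monotonicity.\<close>
  then have "?E A \<inter> (Field F - {?r}) = ?E A"
    by auto
  moreover have "upset F (Field F - {?r})"
    using is_frameD(3,6)[OF F] by (auto simp: upset_def Field_def dest: antisymD)
  ultimately have "up_var (Field F - {?r}) \<in> w"
    using rules(2)[OF w(1) _ up] by (metis subset_refl)
  with w(3) show False ..
qed

lemma omits_if_jankov:
  assumes F: "is_frame F" and "jankov F \<in> L"
  shows "omits L F"
proof -
  let ?r = "frame_root F"
  \<comment> \<open>Numbers that do not code an upset are made false everywhere, which keeps the
    valuation persistent.\<close>
  define V where "V w x \<longleftrightarrow> upset F (set_decode x) \<and> w \<in> set_decode x" for w x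
  have V: "persistent F V"
    unfolding persistent_def V_def upset_def by blast
  have fin: "finite U" if "upset F U" for U
    using that is_frameD(1)[OF F] finite_subset by (auto simp: upset_def)
  have forces_up: "forces F V w (up_var U) \<longleftrightarrow> w \<in> U" if "upset F U" for w U
    using that fin[OF that] by (simp add: up_var_def V_def)
  have empty: "upset F {}"
    by (simp add: upset_def)
  have ups: "upset F (U \<inter> W)" "upset F (U \<union> W)" "upset F (upset_imp F U W)"
    if "upset F U" "upset F W" for U W
    using that is_frameD(2)[OF F] by (auto simp: upset_def upset_imp_def Field_def dest: transD)
  have top: "upset F (Field F - {?r})"
    using is_frameD(3,6)[OF F] by (auto simp: upset_def Field_def dest: antisymD)
  have imp: "w \<in> upset_imp F U W \<longleftrightarrow> (\<forall>v. (w, v) \<in> F \<longrightarrow> v \<in> U \<longrightarrow> v \<in> W)"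
    if "(u, w) \<in> F" for u w U W
    using that by (auto simp: upset_imp_def Field_def)
  have "forces F V ?r A" if A: "A \<in> diagram_set F" for A
  proof -
    consider "A = (up_var {} \<^bold>\<longleftrightarrow> \<^bold>\<bottom>)"
      | U W where "upset F U" "upset F W" "A = (up_var (U \<inter> W) \<^bold>\<longleftrightarrow> (up_var U \<^bold>\<and> up_var W))"
      | U W where "upset F U" "upset F W" "A = (up_var (U \<union> W) \<^bold>\<longleftrightarrow> (up_var U \<^bold>\<or> up_var W))"
      | U W where "upset F U" "upset F W" "A = (up_var (upset_imp F U W) \<^bold>\<longleftrightarrow> (up_var U \<^bold>\<longrightarrow> up_var W))"
      using A unfolding diagram_set_def by blast
    then show ?thesis
    proof cases
      case 1
      then show ?thesis by (simp add: forces_up[OF empty])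
    next
      case 2
      then show ?thesis by (simp add: forces_up ups)
    next
      case 3
      then show ?thesis by (simp add: forces_up ups)
    next
      case 4
      then show ?thesis by (simp add: forces_up ups imp)
    qed
  qed
  then have "\<not> forces F V ?r (jankov F)"
    using forces_up[OF top] is_frameD(4,5)[OF F] by (auto simp: jankov_def forces_diagram[OF F])
  then have "\<not> valid F (jankov F)"
    using V is_frameD(5)[OF F] by (auto simp: valid_def)
  with assms(2) show ?thesis
    by (auto simp: omits_def logic_of_def)
qed

section \<open>The shape of the canonical model\<close>

text \<open>A valuation on F is pulled back along f: \<phi> k defines the preimage of the cone of k,
  so a disjunction of such formulas defines the preimage of any upset. Definability also yields that
  f is monotone.\<close>

lemma (in logic) definable_p_morphism:
  assumes w: "point L w"
    and field: "\<And>v. point L v \<Longrightarrow> w \<subseteq> v \<Longrightarrow> f v \<in> Field F"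
    and onto: "\<And>k. k \<in> Field F \<Longrightarrow> (f w, k) \<in> F"
    and definable: "\<And>v k. point L v \<Longrightarrow> w \<subseteq> v \<Longrightarrow> k \<in> Field F \<Longrightarrow> \<phi> k \<in> v \<longleftrightarrow> (k, f v) \<in> F"
    and lift: "\<And>v k. point L v \<Longrightarrow> w \<subseteq> v \<Longrightarrow> (f v, k) \<in> F \<Longrightarrow> \<exists>u. point L u \<and> v \<subseteq> u \<and> f u = k"
    and F: "finite (Field F)" "refl_on (Field F) F"
  shows "\<not> omits L F"
proof -
  have refl: "\<And>k. k \<in> Field F \<Longrightarrow> (k, k) \<in> F"
    using F by (auto simp: refl_on_def)
  have "forces F V k A" if A: "A \<in> L" and V: "persistent F V" and k: "k \<in> Field F" for A V k
  proof -
    define \<sigma> where "\<sigma> x = disjs (\<phi> ` {k \<in> Field F. V k x})" for x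
    have truth: "subst \<sigma> C \<in> v \<longleftrightarrow> sat (\<lambda>a b. (a, b) \<in> F) V (f v) C" if "point L v" "w \<subseteq> v" for C v
    proof -
      have "sat (\<lambda>w v. point L v \<and> w \<subseteq> v) (\<lambda>w x. \<sigma> x \<in> w) v C \<longleftrightarrow> sat (\<lambda>a b. (a, b) \<in> F) V (f v) C"
      proof (rule sat_bisim[where Z = "\<lambda>v k. point L v \<and> w \<subseteq> v \<and> k = f v"])
        fix v k x assume *: "point L v \<and> w \<subseteq> v \<and> k = f v"
        then have "\<sigma> x \<in> v \<longleftrightarrow> (\<exists>k\<in>Field F. V k x \<and> (k, f v) \<in> F)"
          using definable[of v] F(1) by (auto simp: \<sigma>_def)
        then show "\<sigma> x \<in> v \<longleftrightarrow> V k x"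
          using * V refl[OF field[of v]] field[of v] unfolding persistent_def by metis
      next
        fix v k v' assume *: "point L v \<and> w \<subseteq> v \<and> k = f v" "point L v' \<and> v \<subseteq> v'"
        have k: "f v \<in> Field F" "\<phi> (f v) \<in> v"
          using * field[of v] definable[of v "f v"] refl by simp_all
        then have "(f v, f v') \<in> F"
          using * definable[of v' "f v"] by (metis subset_iff)
        then show "\<exists>k'. (k, k') \<in> F \<and> point L v' \<and> w \<subseteq> v' \<and> k' = f v'"
          using * by auto
      next
        fix v k k' assume *: "point L v \<and> w \<subseteq> v \<and> k = f v" "(k, k') \<in> F"
        then show "\<exists>v'. (point L v' \<and> v \<subseteq> v') \<and> point L v' \<and> w \<subseteq> v' \<and> k' = f v'"
          using lift[of v k'] by (metis order_trans)
      qed (use that in auto)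
      then show ?thesis
        by (simp add: mem_subst_iff_sat that(1))
    qed
    obtain u where u: "point L u" "w \<subseteq> u" "f u = k"
      using lift[OF w _ onto[OF k]] by auto
    have "subst \<sigma> A \<in> u"
      by (rule L_point[OF subst_L[OF A] u(1)])
    then show ?thesis
      using truth[OF u(1,2)] u(3) by (simp add: forces_eq_sat)
  qed
  then show ?thesis
    by (auto simp: omits_def logic_of_def valid_def)
qed

section \<open>The three frames and formulas that define maps onto them\<close>

lemma fork2: "fork_frame 2 = {(0,0),(0,1),(0,2),(1,1),(2,2)}"
  and Field_fork2: "Field (fork_frame 2) = {0,1,2}"
  by (auto simp: fork_frame_def Field_def)

lemma add_top_eq:
  "add_top F = map_prod ((*) 2) ((*) 2) ` F \<union> {(1, 1)} \<union> (\<lambda>x. (2 * x, 1)) ` Field F"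
  by (auto simp: add_top_def frame_sum_def Field_chain_frame) (auto simp: chain_frame_def)

lemma Field_add_top: "Field (add_top F) = (*) 2 ` Field F \<union> {1}"
  by (auto simp: add_top_def Field_frame_sum Field_chain_frame)

text \<open>The points of \<open>R_2+\<close> are the root 0, the middle points 4 and 8, and the chain 2, 1 at the top;
  those of \<open>G_3+\<close> are the root 0, the points 2 and 4, 6, and the top 1.\<close>

lemma R2p: "add_top (rfork_frame 2) =
   {(0,0),(0,4),(0,8),(0,2),(0,1),(4,4),(4,2),(4,1),(8,8),(8,2),(8,1),(2,2),(2,1),(1,1)}"
  and Field_R2p: "Field (add_top (rfork_frame 2)) = {0,4,8,2,1}"
proof -
  have R2: "add_top (fork_frame 2) = {(0,0),(0,2),(0,4),(0,1),(2,2),(2,1),(4,4),(4,1),(1,1)}"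
    unfolding add_top_eq Field_fork2 fork2 by (simp only: image_Un image_insert image_empty map_prod_simp) auto
  have Field_R2: "Field (add_top (fork_frame 2)) = {0,2,4,1}"
    unfolding Field_add_top Field_fork2 by (simp add: insert_commute)
  have rf: "rfork_frame 2 = add_top (fork_frame 2)"
    by (simp add: rfork_frame_def)
  show "add_top (rfork_frame 2) =
   {(0,0),(0,4),(0,8),(0,2),(0,1),(4,4),(4,2),(4,1),(8,8),(8,2),(8,1),(2,2),(2,1),(1,1)}"
    unfolding rf by (subst add_top_eq, unfold Field_R2 R2) (simp, blast)
  show "Field (add_top (rfork_frame 2)) = {0,4,8,2,1}"
    unfolding rf by (subst Field_add_top, unfold Field_R2) (simp add: insert_commute)
qed

lemma G3p: "add_top G3_frame =
   {(0,0),(0,2),(0,4),(0,6),(0,1),(2,2),(2,1),(4,4),(4,6),(4,1),(6,6),(6,1),(1,1)}"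
  and Field_G3p: "Field (add_top G3_frame) = {0,2,4,6,1}"
proof -
  have G3: "G3_frame = {(0,0),(1,1),(2,2),(3,3),(0,1),(0,2),(0,3),(2,3)}"
    by (simp add: G3_frame_def Id_on_def insert_commute)
  have Field_G3: "Field G3_frame = {0,1,2,3}"
    unfolding G3 by (simp add: insert_commute)
  show "add_top G3_frame =
   {(0,0),(0,2),(0,4),(0,6),(0,1),(2,2),(2,1),(4,4),(4,6),(4,1),(6,6),(6,1),(1,1)}"
    by (subst add_top_eq, unfold Field_G3 G3) (simp, blast)
  show "Field (add_top G3_frame) = {0,2,4,6,1}"
    by (subst Field_add_top, unfold Field_G3) (simp add: insert_commute)
qed

locale un_logic = logic +
  assumes omits_R2p: "omits L (add_top (rfork_frame 2))"
    and omits_G3p: "omits L (add_top G3_frame)"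
    and omits_F2: "omits L (fork_frame 2)"
begin

text \<open>The formulas \<open>e\<close>, \<open>g\<close>, \<open>a\<close>, \<open>b\<close> are
  to define the preimages of the cones of 1, 2, 4, 8, and all remaining points go to the root. The
  existence hypotheses are the lifting conditions of this map.\<close>

lemma no_R2p:
  assumes w: "point L w"
    and eg: "\<And>v. point L v \<Longrightarrow> w \<subseteq> v \<Longrightarrow> e \<in> v \<Longrightarrow> g \<in> v"
    and gab: "\<And>v. point L v \<Longrightarrow> w \<subseteq> v \<Longrightarrow> g \<in> v \<longleftrightarrow> a \<in> v \<and> b \<in> v"
    and dense: "\<And>v. point L v \<Longrightarrow> w \<subseteq> v \<Longrightarrow> \<exists>u. point L u \<and> v \<subseteq> u \<and> e \<in> u"
    and below: "\<And>v. point L v \<Longrightarrow> w \<subseteq> v \<Longrightarrow> e \<notin> v \<Longrightarrow> \<exists>u. point L u \<and> v \<subseteq> u \<and> g \<in> u \<and> e \<notin> u"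
    and root_a: "\<And>v. point L v \<Longrightarrow> w \<subseteq> v \<Longrightarrow> a \<notin> v \<Longrightarrow> b \<notin> v \<Longrightarrow>
        \<exists>u. point L u \<and> v \<subseteq> u \<and> a \<in> u \<and> b \<notin> u"
    and root_b: "\<And>v. point L v \<Longrightarrow> w \<subseteq> v \<Longrightarrow> a \<notin> v \<Longrightarrow> b \<notin> v \<Longrightarrow>
        \<exists>u. point L u \<and> v \<subseteq> u \<and> b \<in> u \<and> a \<notin> u"
    and ab: "a \<notin> w" "b \<notin> w"
  shows False
proof -
  define f where "f v = (if e \<in> v then 1 else if g \<in> v then 2 else if a \<in> v then 4 else if b \<in> v then 8 else 0 :: nat)"
    for v :: "form set"
  define \<phi> where "\<phi> k = (if k = 1 then e else if k = 2 then g else if k = 4 then a else if k = 8 then b else \<^bold>\<top>)"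
    for k :: nat
  have refl: "refl_on (Field (add_top (rfork_frame 2))) (add_top (rfork_frame 2))"
    unfolding Field_R2p R2p refl_on_def by simp
  have fin: "finite (Field (add_top (rfork_frame 2)))"
    unfolding Field_R2p by simp
  have "\<not> omits L (add_top (rfork_frame 2))"
  proof (rule definable_p_morphism[OF w, of f _ \<phi>, OF _ _ _ _ fin refl], goal_cases)
    case (1 v)
    then show ?case by (simp add: Field_R2p f_def)
  next
    case (2 k)
    have "f w = 0" using ab eg[OF w] gab[OF w] by (auto simp: f_def)
    with 2 show ?case unfolding R2p Field_R2p by auto
  next
    case (3 v k)
    then show ?case
      using eg[of v] gab[of v] unfolding R2p Field_R2p by (auto simp: f_def \<phi>_def)
  next
    case (4 v k)
    have f1: "\<exists>u. point L u \<and> v \<subseteq> u \<and> f u = 1" if "point L v" "w \<subseteq> v" for v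
      using dense[OF that] by (auto simp: f_def)
    have f2: "\<exists>u. point L u \<and> v \<subseteq> u \<and> f u = 2" if "point L v" "w \<subseteq> v" "e \<notin> v" for v
      using below[OF that] by (auto simp: f_def)
    have f4: "\<exists>u. point L u \<and> v \<subseteq> u \<and> f u = 4" if v: "point L v" "w \<subseteq> v" "a \<notin> v" "b \<notin> v" for v
    proof -
      obtain u where u: "point L u" "v \<subseteq> u" "a \<in> u" "b \<notin> u"
        using root_a[OF v] by auto
      then have "f u = 4"
        using gab[of u] eg[of u] v(2) by (auto simp: f_def)
      with u show ?thesis by auto
    qed
    have f8: "\<exists>u. point L u \<and> v \<subseteq> u \<and> f u = 8" if v: "point L v" "w \<subseteq> v" "a \<notin> v" "b \<notin> v" for v
    proof -
      obtain u where u: "point L u" "v \<subseteq> u" "b \<in> u" "a \<notin> u"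
        using root_b[OF v] by auto
      then have "f u = 8"
        using gab[of u] eg[of u] v(2) by (auto simp: f_def)
      with u show ?thesis by auto
    qed
    have "f v = k \<or> k = 1 \<or> (k = 2 \<and> e \<notin> v) \<or> (k = 4 \<and> a \<notin> v \<and> b \<notin> v) \<or> (k = 8 \<and> a \<notin> v \<and> b \<notin> v)"
      using 4 unfolding R2p by (auto simp: f_def split: if_splits)
    then show ?case
      using f1[of v] f2[of v] f4[of v] f8[of v] 4(1,2) by (elim disjE) auto
  qed
  then show False using omits_R2p by simp
qed

text \<open>Same scheme as \<open>no_R2p\<close>: \<open>e\<close>, \<open>c\<close>,
  \<open>b\<close> define the cones of the chain 1, 6, 4 from the top down, and \<open>a\<close>
  defines that of the coatom 2 beside it.\<close>

lemma no_G3p: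
  assumes w: "point L w"
    and ec: "\<And>v. point L v \<Longrightarrow> w \<subseteq> v \<Longrightarrow> e \<in> v \<Longrightarrow> c \<in> v"
    and cb: "\<And>v. point L v \<Longrightarrow> w \<subseteq> v \<Longrightarrow> c \<in> v \<Longrightarrow> b \<in> v"
    and eab: "\<And>v. point L v \<Longrightarrow> w \<subseteq> v \<Longrightarrow> e \<in> v \<longleftrightarrow> a \<in> v \<and> b \<in> v"
    and dense: "\<And>v. point L v \<Longrightarrow> w \<subseteq> v \<Longrightarrow> \<exists>u. point L u \<and> v \<subseteq> u \<and> e \<in> u"
    and below: "\<And>v. point L v \<Longrightarrow> w \<subseteq> v \<Longrightarrow> a \<notin> v \<Longrightarrow> c \<notin> v \<Longrightarrow> \<exists>u. point L u \<and> v \<subseteq> u \<and> c \<in> u \<and> e \<notin> u"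
    and root_a: "\<And>v. point L v \<Longrightarrow> w \<subseteq> v \<Longrightarrow> a \<notin> v \<Longrightarrow> b \<notin> v \<Longrightarrow>
        \<exists>u. point L u \<and> v \<subseteq> u \<and> a \<in> u \<and> e \<notin> u"
    and root_b: "\<And>v. point L v \<Longrightarrow> w \<subseteq> v \<Longrightarrow> a \<notin> v \<Longrightarrow> b \<notin> v \<Longrightarrow>
        \<exists>u. point L u \<and> v \<subseteq> u \<and> b \<in> u \<and> c \<notin> u"
    and ab: "a \<notin> w" "b \<notin> w"
  shows False
proof -
  define f where "f v = (if e \<in> v then 1 else if c \<in> v then 6 else if a \<in> v then 2 else if b \<in> v then 4 else 0 :: nat)"
    for v :: "form set"
  define \<phi> where "\<phi> k = (if k = 1 then e else if k = 6 then c else if k = 2 then a else if k = 4 then b else \<^bold>\<top>)"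
    for k :: nat
  have refl: "refl_on (Field (add_top G3_frame)) (add_top G3_frame)"
    unfolding Field_G3p G3p refl_on_def by simp
  have fin: "finite (Field (add_top G3_frame))"
    unfolding Field_G3p by simp
  have "\<not> omits L (add_top G3_frame)"
  proof (rule definable_p_morphism[OF w, of f _ \<phi>, OF _ _ _ _ fin refl], goal_cases)
    case (1 v)
    then show ?case by (simp add: Field_G3p f_def)
  next
    case (2 k)
    have "f w = 0" using ab ec[OF w] eab[OF w] cb[OF w] by (auto simp: f_def)
    with 2 show ?case unfolding G3p Field_G3p by auto
  next
    case (3 v k)
    then show ?case
      using ec[of v] cb[of v] eab[of v] unfolding G3p Field_G3p by (auto simp: f_def \<phi>_def)
  next
    case (4 v k)
    have f1: "\<exists>u. point L u \<and> v \<subseteq> u \<and> f u = 1" if "point L v" "w \<subseteq> v" for v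
      using dense[OF that] by (auto simp: f_def)
    have f6: "\<exists>u. point L u \<and> v \<subseteq> u \<and> f u = 6" if "point L v" "w \<subseteq> v" "a \<notin> v" "c \<notin> v" for v
      using below[OF that] by (auto simp: f_def)
    have f2: "\<exists>u. point L u \<and> v \<subseteq> u \<and> f u = 2" if v: "point L v" "w \<subseteq> v" "a \<notin> v" "b \<notin> v" for v
    proof -
      obtain u where u: "point L u" "v \<subseteq> u" "a \<in> u" "e \<notin> u"
        using root_a[OF v] by auto
      then have "f u = 2"
        using eab[of u] cb[of u] v(2) by (auto simp: f_def)
      with u show ?thesis by auto
    qed
    have f4: "\<exists>u. point L u \<and> v \<subseteq> u \<and> f u = 4" if v: "point L v" "w \<subseteq> v" "a \<notin> v" "b \<notin> v" for v
    proof -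
      obtain u where u: "point L u" "v \<subseteq> u" "b \<in> u" "c \<notin> u"
        using root_b[OF v] by auto
      then have "f u = 4"
        using eab[of u] ec[of u] v(2) by (auto simp: f_def)
      with u show ?thesis by auto
    qed
    have "f v = k \<or> k = 1 \<or> (k = 6 \<and> a \<notin> v \<and> c \<notin> v) \<or> (k = 2 \<and> a \<notin> v \<and> b \<notin> v) \<or> (k = 4 \<and> a \<notin> v \<and> b \<notin> v)"
      using 4 eab[of v] cb[of v] unfolding G3p by (auto simp: f_def split: if_splits)
    then show ?case
      using f1[of v] f2[of v] f4[of v] f6[of v] 4(1,2) by (elim disjE) auto
  qed
  then show False using omits_G3p by simp
qed

text \<open>If both disjuncts failed, they would define the two maximal points of
  \<open>F_2\<close>, because a point lacking one of them sees a point with the other.\<close>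

lemma weak_excluded_middle:
  assumes w: "point L w"
  shows "(\<^bold>\<not> e) \<in> w \<or> (\<^bold>\<not> \<^bold>\<not> e) \<in> w"
proof (rule ccontr)
  assume e: "\<not> ((\<^bold>\<not> e) \<in> w \<or> (\<^bold>\<not> \<^bold>\<not> e) \<in> w)"
  define f where "f v = (if (\<^bold>\<not> e) \<in> v then 1 else if (\<^bold>\<not> \<^bold>\<not> e) \<in> v then 2 else 0 :: nat)" for v
  define \<phi> where "\<phi> k = (if k = 1 then \<^bold>\<not> e else if k = 2 then \<^bold>\<not> \<^bold>\<not> e else \<^bold>\<top>)" for k :: nat
  have refl: "refl_on (Field (fork_frame 2)) (fork_frame 2)"
    unfolding Field_fork2 fork2 refl_on_def by simp
  have fin: "finite (Field (fork_frame 2))"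
    unfolding Field_fork2 by simp
  have excl: "\<not> ((\<^bold>\<not> e) \<in> v \<and> (\<^bold>\<not> \<^bold>\<not> e) \<in> v)" if "point L v" for v
    using mem_mp[OF that, of "\<^bold>\<not> e" "\<^bold>\<bottom>"] that by auto
  have "\<not> omits L (fork_frame 2)"
  proof (rule definable_p_morphism[OF w, of f _ \<phi>, OF _ _ _ _ fin refl], goal_cases)
    case (1 v)
    then show ?case by (simp add: Field_fork2 f_def)
  next
    case (2 k)
    with e show ?case unfolding fork2 Field_fork2 by (auto simp: f_def)
  next
    case (3 v k)
    then show ?case
      using excl[of v] unfolding fork2 Field_fork2 by (auto simp: f_def \<phi>_def)
  next
    case (4 v k)
    have f1: "\<exists>u. point L u \<and> v \<subseteq> u \<and> f u = 1" if "(\<^bold>\<not> \<^bold>\<not> e) \<notin> v"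
      using Imp_notin[OF 4(1) that] by (metis f_def)
    have f2: "\<exists>u. point L u \<and> v \<subseteq> u \<and> f u = 2" if ne: "(\<^bold>\<not> e) \<notin> v"
    proof -
      obtain u where u: "point L u" "v \<subseteq> u" "e \<in> u"
        using Imp_notin[OF 4(1) ne] by auto
      have "(\<^bold>\<not> e) \<notin> x" if "point L x" "u \<subseteq> x" for x
        using mem_mp[OF that(1), of e "\<^bold>\<bottom>"] that u(3) by auto
      then have "(\<^bold>\<not> \<^bold>\<not> e) \<in> u"
        unfolding mem_Neg[OF u(1), of "\<^bold>\<not> e"] by simp
      then have "f u = 2"
        using excl[OF u(1)] by (auto simp: f_def)
      with u show ?thesis by auto
    qed
    have "f v = k \<or> (k = 1 \<and> (\<^bold>\<not> \<^bold>\<not> e) \<notin> v) \<or> (k = 2 \<and> (\<^bold>\<not> e) \<notin> v)"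
      using 4 unfolding fork2 by (auto simp: f_def split: if_splits)
    then show ?case
      using f1 f2 4(1,2) by (elim disjE) auto
  qed
  then show False using omits_F2 by simp
qed

section \<open>The greatest point of a cone\<close>

definition tp :: "form set \<Rightarrow> form set" where
  "tp w = {A. (\<^bold>\<not> \<^bold>\<not> A) \<in> w}"

lemma subset_tp: "point L v \<Longrightarrow> w \<subseteq> v \<Longrightarrow> point L w \<Longrightarrow> v \<subseteq> tp w"
proof
  fix A assume *: "point L v" "w \<subseteq> v" "point L w" "A \<in> v"
  then have "(\<^bold>\<not> A) \<notin> w"
    unfolding mem_Neg[OF *(3)] by auto
  then show "A \<in> tp w"
    using weak_excluded_middle[OF *(3), of A] by (auto simp: tp_def)
qed

text \<open>A maximal point above w contains every A whose double negation is in w, and weak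
  excluded middle gives the converse. So \<open>tp w\<close> is the only maximal point of the
  cone.\<close>

lemma point_tp:
  assumes w: "point L w"
  shows "point L (tp w)"
proof -
  obtain v where v: "point L v" "w \<subseteq> v" "\<And>u. point L u \<Longrightarrow> v \<subset> u \<Longrightarrow> \<^bold>\<bottom> \<in> u"
    using point_maximal[OF w, of "\<^bold>\<bottom>"] w by auto
  have "A \<in> v" if "A \<in> tp w" for A
  proof -
    have "(\<^bold>\<not> A) \<notin> v"
      using that v(1,2) mem_mp[OF v(1), of "\<^bold>\<not> A" "\<^bold>\<bottom>"] by (auto simp: tp_def)
    then obtain u where u: "point L u" "v \<subseteq> u" "A \<in> u"
      using Imp_notin[OF v(1)] by metis
    then have "u = v"
      using v(3)[of u] by auto
    with u show ?thesis by simp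
  qed
  with subset_tp[OF v(1,2) w] have "tp w = v" by auto
  with v show ?thesis by simp
qed

lemma subset_tp_self: "point L w \<Longrightarrow> w \<subseteq> tp w"
  by (rule subset_tp[OF _ subset_refl])

lemma tp_mono:
  assumes "point L v" "point L w" "w \<subseteq> v"
  shows "tp v = tp w"
proof
  show "tp v \<subseteq> tp w"
    by (rule subset_tp[OF point_tp[OF assms(1)] order_trans[OF assms(3) subset_tp_self[OF assms(1)]] assms(2)])
  show "tp w \<subseteq> tp v"
    by (rule subset_tp[OF point_tp[OF assms(2)] subset_tp[OF assms(1,3,2)] assms(1)])
qed

lemma tp_tp [simp]: "point L w \<Longrightarrow> tp (tp w) = tp w"
  by (rule tp_mono[OF point_tp _ subset_tp_self])

lemma tp_subset:
  assumes "point L v" "point L w" "tp w \<subseteq> v"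
  shows "v = tp w"
  using subset_tp[OF assms(1,3) point_tp[OF assms(2)]] assms(2,3) by simp

lemma dense_tp:
  assumes "point L w" "e \<in> tp w" "point L v" "w \<subseteq> v"
  shows "\<exists>u. point L u \<and> v \<subseteq> u \<and> e \<in> u"
  using assms(2) subset_tp[OF assms(3,4,1)] point_tp[OF assms(1)] by auto

text \<open>A point at which both disjuncts fail sees points of the kinds \<open>a\<close> and \<open>b\<close> of \<open>G_3+\<close>, where
  \<open>e\<close> and \<open>s\<close> define the top and the two topmost points.  If it sees no point
  at which \<open>\<beta> \<longrightarrow> s\<close> holds and \<open>\<beta>\<close> fails, then it generates \<open>G_3+\<close>; otherwise merging \<open>a\<close> with the
  top gives \<open>R_2+\<close>.\<close>

lemma double_negation_dichotomy:
  assumes w: "point L w" and e: "e \<in> tp w"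
    and es: "\<And>v. point L v \<Longrightarrow> w \<subseteq> v \<Longrightarrow> e \<in> v \<Longrightarrow> s \<in> v"
  defines "\<beta> \<equiv> (s \<^bold>\<longrightarrow> e) \<^bold>\<longrightarrow> e"
  shows "\<beta> \<in> w \<or> (\<beta> \<^bold>\<longrightarrow> s) \<in> w"
proof (rule ccontr)
  assume w': "\<not> (\<beta> \<in> w \<or> (\<beta> \<^bold>\<longrightarrow> s) \<in> w)"
  let ?a = "s \<^bold>\<longrightarrow> e"
  note dense = dense_tp[OF w e]
  have mp: "e \<in> v" if "point L v" "s \<in> v" "?a \<in> v" for v
    using mem_mp[OF that(1,3,2)] .
  have \<beta>mp: "e \<in> v" if "point L v" "\<beta> \<in> v" "?a \<in> v" for v
    using mem_mp[of v ?a e] that by (simp add: \<beta>_def)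
  have ea: "?a \<in> v" if "point L v" "e \<in> v" for v
    unfolding mem_Imp[OF that(1), of s e] using that(2) by auto
  have s\<beta>: "\<beta> \<in> v" if v: "point L v" "s \<in> v" for v
    unfolding \<beta>_def mem_Imp[OF v(1), of ?a e] using v(2) mp by (meson subsetD)
  have not_a: "\<exists>u. point L u \<and> v \<subseteq> u \<and> s \<in> u \<and> e \<notin> u" if "point L v" "?a \<notin> v" for v
    using Imp_notin[OF that] by metis
  have not_\<beta>: "\<exists>u. point L u \<and> v \<subseteq> u \<and> ?a \<in> u \<and> e \<notin> u" if "point L v" "\<beta> \<notin> v" for v
    using Imp_notin[OF that(1)] that(2) unfolding \<beta>_def by metis
  have not_x: "\<exists>u. point L u \<and> v \<subseteq> u \<and> \<beta> \<in> u \<and> s \<notin> u" if "point L v" "(\<beta> \<^bold>\<longrightarrow> s) \<notin> v" for v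
    using Imp_notin[OF that] by metis
  show False
  proof (cases "\<exists>v. point L v \<and> w \<subseteq> v \<and> \<beta> \<notin> v \<and> ?a \<notin> v \<and>
      (\<forall>u. point L u \<longrightarrow> v \<subseteq> u \<longrightarrow> (\<beta> \<^bold>\<longrightarrow> s) \<in> u \<longrightarrow> \<beta> \<in> u \<or> ?a \<in> u)")
    case True
    then obtain v where v: "point L v" "w \<subseteq> v" "\<beta> \<notin> v" "?a \<notin> v"
      and no_x: "\<And>u. point L u \<Longrightarrow> v \<subseteq> u \<Longrightarrow> (\<beta> \<^bold>\<longrightarrow> s) \<in> u \<Longrightarrow> \<beta> \<in> u \<or> ?a \<in> u"
      by metis
    show False
    proof (rule no_G3p[OF v(1), of e s \<beta> ?a], goal_cases)
      case (1 u)
      show ?case by (rule es[OF 1(1) _ 1(3)]) (use 1 v(2) in simp)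
    next
      case (2 u)
      then show ?case using s\<beta> by simp
    next
      case (3 u)
      have "w \<subseteq> u" using 3(2) v(2) by simp
      then show ?case
        using \<beta>mp[OF 3(1)] ea[OF 3(1)] s\<beta>[OF 3(1)] es[OF 3(1)] by iprover
    next
      case (4 u)
      show ?case by (rule dense[OF 4(1)]) (use 4 v(2) in simp)
    next
      case (5 u)
      then show ?case using not_a[of u] by simp
    next
      case (6 u)
      then show ?case using not_\<beta>[of u] by simp
    next
      case (7 u)
      then show ?case using not_x[of u] no_x[of u] by metis
    qed (use v in auto)
  next
    case False
    have x: "\<exists>u. point L u \<and> v \<subseteq> u \<and> (\<beta> \<^bold>\<longrightarrow> s) \<in> u \<and> \<beta> \<notin> u \<and> ?a \<notin> u"
      if "point L v" "w \<subseteq> v" "\<beta> \<notin> v" "?a \<notin> v" for v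
      using False that by metis
    have a_not_x: "(\<beta> \<^bold>\<longrightarrow> s) \<in> v" if v: "point L v" "w \<subseteq> v" "?a \<in> v" for v
      unfolding mem_Imp[OF v(1), of \<beta> s]
    proof (intro allI impI)
      fix u assume u: "point L u" "v \<subseteq> u" "\<beta> \<in> u"
      have "e \<in> u"
        by (rule \<beta>mp[OF u(1,3)]) (use v u in auto)
      then show "s \<in> u"
        by (rule es[OF u(1), rotated]) (use v u in simp)
    qed
    have s_x: "(\<beta> \<^bold>\<longrightarrow> s) \<in> v" if v: "point L v" "s \<in> v" for v
      unfolding mem_Imp[OF v(1), of \<beta> s] using v(2) by auto
    \<comment> \<open>The role of the top passes to \<open>s \<longrightarrow> e\<close>, which also
      holds at the points of kind a. The two branches are given by \<beta>, weakened by the new top,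
      and by \<beta> \<longrightarrow> s.\<close>
    show False
    proof (rule no_R2p[OF w, of ?a "s \<^bold>\<or> ?a" "\<beta> \<^bold>\<or> ?a" "\<beta> \<^bold>\<longrightarrow> s"], goal_cases)
      case (1 v)
      then show ?case by simp
    next
      case (2 v)
      then show ?case
        using s_x[OF 2(1)] a_not_x[OF 2] s\<beta>[OF 2(1)] mem_mp[OF 2(1), of \<beta> s]
        unfolding mem_Disj[OF 2(1)] by iprover
    next
      case (3 v)
      then obtain u where "point L u" "v \<subseteq> u" "e \<in> u"
        using dense[OF 3] by auto
      with ea[of u] show ?case by auto
    next
      case (4 v)
      obtain u where u: "point L u" "v \<subseteq> u" "s \<in> u" "e \<notin> u"
        using not_a[OF 4(1,3)] by auto
      then have "?a \<notin> u" using mp[OF u(1,3)] by iprover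
      with u show ?case by (auto intro!: exI[of _ u])
    next
      case (5 v)
      obtain u where u: "point L u" "v \<subseteq> u" "\<beta> \<in> u" "s \<notin> u"
        using not_x[OF 5(1,4)] by auto
      then have "(\<beta> \<^bold>\<longrightarrow> s) \<notin> u" using mem_mp[OF u(1), of \<beta> s] by iprover
      with u show ?case by (auto intro!: exI[of _ u])
    next
      case (6 v)
      then have "\<beta> \<notin> v" "?a \<notin> v" by simp_all
      then obtain u where "point L u" "v \<subseteq> u" "(\<beta> \<^bold>\<longrightarrow> s) \<in> u" "\<beta> \<notin> u" "?a \<notin> u"
        using x[OF 6(1,2)] by auto
      then show ?case by (auto intro!: exI[of _ u])
    next
      case 7
      show ?case using w' a_not_x[OF w] unfolding mem_Disj[OF w] by auto
    next
      case 8
      then show ?case using w' by auto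
    qed
  qed
qed

text \<open>If \<open>s \<longrightarrow> e\<close> held at v, then v would refute the first
  disjunct of \<open>double_negation_dichotomy\<close> and u the second one, for the variants
  \<open>?S\<close> and \<open>?e\<close> of s and e.\<close>

lemma no_lower_incomparable:
  assumes w: "point L w" and u: "point L u" "w \<subseteq> u" and v: "point L v" "w \<subseteq> v"
    and p: "p \<in> u" "p \<notin> v"
    and s: "s \<notin> u" "(s \<^bold>\<longrightarrow> e) \<notin> u" and e: "e \<in> tp w"
  shows "(s \<^bold>\<longrightarrow> e) \<notin> v"
proof
  assume sv: "(s \<^bold>\<longrightarrow> e) \<in> v"
  let ?s1 = "s \<^bold>\<and> p"
  \<comment> \<open>The conjunct p makes \<open>?e\<close> fail at v and costs nothing at u; as a
    disjunct of \<open>?S\<close>, the formula \<open>?e\<close> entails it, which the dichotomy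
    requires.\<close>
  let ?e = "(?s1 \<^bold>\<longrightarrow> e) \<^bold>\<and> p"
  let ?S = "?s1 \<^bold>\<or> ?e"
  have s1v: "(?s1 \<^bold>\<longrightarrow> e) \<in> v"
    unfolding mem_Imp[OF v(1)] using mem_mp[of _ s e] sv by auto
  have s1u: "(?s1 \<^bold>\<longrightarrow> e) \<notin> u"
  proof
    assume *: "(?s1 \<^bold>\<longrightarrow> e) \<in> u"
    have "(s \<^bold>\<longrightarrow> e) \<in> u"
      unfolding mem_Imp[OF u(1)] using mem_mp[of _ ?s1 e] * p(1) by auto
    with s(2) show False by simp
  qed
  have "?e \<in> tp w"
  proof -
    have "(?s1 \<^bold>\<longrightarrow> e) \<in> tp w"
      unfolding mem_Imp[OF point_tp[OF w]] using e by auto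
    moreover have "p \<in> tp w"
      using subset_tp[OF u w] p by auto
    ultimately show ?thesis
      using point_tp[OF w] by simp
  qed
  then have "((?S \<^bold>\<longrightarrow> ?e) \<^bold>\<longrightarrow> ?e) \<in> w \<or> (((?S \<^bold>\<longrightarrow> ?e) \<^bold>\<longrightarrow> ?e) \<^bold>\<longrightarrow> ?S) \<in> w"
    by (rule double_negation_dichotomy[OF w]) simp
  moreover have "((?S \<^bold>\<longrightarrow> ?e) \<^bold>\<longrightarrow> ?e) \<notin> w"
  proof
    assume "((?S \<^bold>\<longrightarrow> ?e) \<^bold>\<longrightarrow> ?e) \<in> w"
    then have "((?S \<^bold>\<longrightarrow> ?e) \<^bold>\<longrightarrow> ?e) \<in> v" using v(2) by auto
    moreover have "(?S \<^bold>\<longrightarrow> ?e) \<in> v"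
      unfolding mem_Imp[OF v(1)] using s1v by auto
    ultimately have "?e \<in> v" by (rule mem_mp[OF v(1)])
    then show False using p(2) v(1) by simp
  qed
  moreover have "(((?S \<^bold>\<longrightarrow> ?e) \<^bold>\<longrightarrow> ?e) \<^bold>\<longrightarrow> ?S) \<notin> w"
  proof
    assume "(((?S \<^bold>\<longrightarrow> ?e) \<^bold>\<longrightarrow> ?e) \<^bold>\<longrightarrow> ?S) \<in> w"
    then have "(((?S \<^bold>\<longrightarrow> ?e) \<^bold>\<longrightarrow> ?e) \<^bold>\<longrightarrow> ?S) \<in> u" using u(2) by auto
    moreover have "((?S \<^bold>\<longrightarrow> ?e) \<^bold>\<longrightarrow> ?e) \<in> u"
    proof -
      have "?e \<in> x" if x: "point L x" "u \<subseteq> x" "(?S \<^bold>\<longrightarrow> ?e) \<in> x" for x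
      proof -
        have "e \<in> y" if y: "point L y" "x \<subseteq> y" "?s1 \<in> y" for y
        proof -
          have "?e \<in> y"
            by (rule mem_mp[OF y(1), of ?S]) (use x y in auto)
          then show ?thesis
            using mem_mp[OF y(1), of ?s1 e] y by simp
        qed
        then have "(?s1 \<^bold>\<longrightarrow> e) \<in> x"
          unfolding mem_Imp[OF x(1)] by simp
        then show ?thesis using x p(1) by auto
      qed
      then show ?thesis unfolding mem_Imp[OF u(1)] by simp
    qed
    ultimately have "?S \<in> u" by (rule mem_mp[OF u(1)])
    then show False using s(1) s1u u(1) by simp
  qed
  ultimately show False by simp
qed

text \<open>If u' is not the top, an implication fails at u. Its failure is carried over to v and
  back by \<open>no_lower_incomparable\<close>, so that u and v both see points with
  \<open>?s\<close> but without \<open>?e\<close>. These are mapped to the point 2 below the top of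
  \<open>R_2+\<close>, and u and v give its two branches.\<close>

theorem incomparable_coatom:
  assumes w: "point L w" and u: "point L u" "w \<subseteq> u" and v: "point L v" "w \<subseteq> v"
    and uv: "\<not> u \<subseteq> v" "\<not> v \<subseteq> u" and u': "point L u'" "u \<subset> u'"
  shows "u' = tp w"
proof (rule ccontr)
  assume "u' \<noteq> tp w"
  moreover have "u' \<subseteq> tp w"
    using subset_tp[OF u'(1) _ w] u(2) u'(2) by auto
  ultimately obtain e where e: "e \<in> tp w" "e \<notin> u'" by auto
  obtain s where s: "s \<in> u'" "s \<notin> u" using u'(2) by auto
  obtain p q where p: "p \<in> u" "p \<notin> v" and q: "q \<in> v" "q \<notin> u" using uv by auto
  have se: "(s \<^bold>\<longrightarrow> e) \<notin> u"
    unfolding mem_Imp[OF u(1)] using u' s e by auto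
  have and_u: "(x \<^bold>\<and> p \<^bold>\<longrightarrow> e) \<notin> u" if "(x \<^bold>\<longrightarrow> e) \<notin> u" for x
    using that p(1) mem_mp[of _ "x \<^bold>\<and> p" e] unfolding mem_Imp[OF u(1)] by auto
  have and_v: "(x \<^bold>\<and> q \<^bold>\<longrightarrow> e) \<notin> v" if "(x \<^bold>\<longrightarrow> e) \<notin> v" for x
    using that q(1) mem_mp[of _ "x \<^bold>\<and> q" e] unfolding mem_Imp[OF v(1)] by auto
  let ?s = "(s \<^bold>\<and> p) \<^bold>\<and> q"
  let ?e = "?s \<^bold>\<longrightarrow> e"
  \<comment> \<open>Each separating formula joins the antecedent on its own side, where it holds
    anyway, before the failure crosses to the other side.\<close>
  have "(s \<^bold>\<and> p \<^bold>\<longrightarrow> e) \<notin> v"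
    by (rule no_lower_incomparable[OF w u v p _ and_u[OF se] e(1)]) (use s u in auto)
  then have ev: "?e \<notin> v"
    by (rule and_v)
  have eu: "?e \<notin> u"
    by (rule no_lower_incomparable[OF w v u q _ ev e(1)]) (use p v in auto)
  let ?\<alpha> = "p \<^bold>\<or> ?e" and ?\<beta> = "q \<^bold>\<or> ?e"
  \<comment> \<open>Taking implications makes the branching conditions automatic: where \<alpha>
    \<longrightarrow> \<beta> fails, a later point has \<alpha> without \<beta>, and hence exactly
    one of the two implications.\<close>
  let ?a = "?\<beta> \<^bold>\<longrightarrow> ?\<alpha>" and ?b = "?\<alpha> \<^bold>\<longrightarrow> ?\<beta>"
  have \<alpha>a: "?a \<in> x" if "point L x" "?\<alpha> \<in> x" for x
    unfolding mem_Imp[OF that(1), of ?\<beta> ?\<alpha>] using that(2) by (meson subsetD)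
  have \<beta>b: "?b \<in> x" if "point L x" "?\<beta> \<in> x" for x
    unfolding mem_Imp[OF that(1), of ?\<alpha> ?\<beta>] using that(2) by (meson subsetD)
  have e\<alpha>: "?\<alpha> \<in> x" "?\<beta> \<in> x" if "point L x" "?e \<in> x" for x
    using that by auto
  have sees: "\<exists>y. point L y \<and> x \<subseteq> y \<and> ?s \<in> y \<and> ?e \<notin> y" if x: "point L x" "?e \<notin> x" for x
  proof -
    obtain y where y: "point L y" "x \<subseteq> y" "?s \<in> y" "e \<notin> y"
      using Imp_notin[OF x] by metis
    then have "?e \<notin> y"
      using mem_mp[OF y(1), of ?s e] by auto
    with y show ?thesis by metis
  qed
  show False
  proof (rule no_R2p[OF w, of ?e "?a \<^bold>\<and> ?b" ?a ?b], goal_cases)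
    case (1 x)
    then show ?case using \<alpha>a[OF 1(1)] \<beta>b[OF 1(1)] e\<alpha>[OF 1(1,3)] by (simp only: mem_Conj)
  next
    case (2 x)
    then show ?case by (simp only: mem_Conj)
  next
    case (3 x)
    obtain y where y: "point L y" "x \<subseteq> y" "e \<in> y"
      using dense_tp[OF w e(1) 3] by metis
    then have "?e \<in> y"
      unfolding mem_Imp[OF y(1), of ?s] by auto
    with y show ?case by metis
  next
    case (4 x)
    obtain y where y: "point L y" "x \<subseteq> y" "?s \<in> y" "?e \<notin> y"
      using sees[OF 4(1,3)] by metis
    then have "?\<alpha> \<in> y" "?\<beta> \<in> y" by simp_all
    then have "?a \<in> y" "?b \<in> y"
      using \<alpha>a \<beta>b y(1) by metis+
    then show ?case using y by (metis mem_Conj)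
  next
    case (5 x)
    obtain y where y: "point L y" "x \<subseteq> y" "?\<alpha> \<in> y" "?\<beta> \<notin> y"
      using Imp_notin[OF 5(1,4)] by metis
    have "?b \<notin> y"
      using mem_mp[OF y(1) _ y(3), of ?\<beta>] y(4) by metis
    with y \<alpha>a[OF y(1,3)] show ?case by metis
  next
    case (6 x)
    obtain y where y: "point L y" "x \<subseteq> y" "?\<beta> \<in> y" "?\<alpha> \<notin> y"
      using Imp_notin[OF 6(1,3)] by metis
    have "?a \<notin> y"
      using mem_mp[OF y(1) _ y(3), of ?\<alpha>] y(4) by metis
    with y \<beta>b[OF y(1,3)] show ?case by metis
  next
    case 7
    have "?\<beta> \<in> v" "?\<alpha> \<notin> v" using q p ev v(1) by auto
    then have "?a \<notin> v" using mem_mp[OF v(1), of ?\<beta> ?\<alpha>] by metis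
    then show ?case using v(2) by auto
  next
    case 8
    have "?\<alpha> \<in> u" "?\<beta> \<notin> u" using q p eu u(1) by auto
    then have "?b \<notin> u" using mem_mp[OF u(1), of ?\<alpha> ?\<beta>] by metis
    then show ?case using u(2) by auto
  qed
qed

section \<open>The logic of \<open>H_un\<close>\<close>

definition coatom :: "form set \<Rightarrow> bool" where
  "coatom v \<longleftrightarrow> point L v \<and> v \<noteq> tp v \<and> (\<forall>u. point L u \<longrightarrow> v \<subset> u \<longrightarrow> u = tp v)"

lemma comparable:
  assumes w: "point L w" and v: "point L v" "w \<subseteq> v" "\<not> coatom v" and u: "point L u" "w \<subseteq> u"
  shows "v \<subseteq> u \<or> u \<subseteq> v"
proof (rule ccontr)
  assume *: "\<not> (v \<subseteq> u \<or> u \<subseteq> v)"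
  have "v \<noteq> tp v"
    using * subset_tp[OF u w] tp_mono[OF v(1) w v(2)] by auto
  then obtain v' where "point L v'" "v \<subset> v'" "v' \<noteq> tp v"
    using v(1,3) by (auto simp: coatom_def)
  then show False
    using incomparable_coatom[OF w v(1,2) u, of v'] * tp_mono[OF v(1) w v(2)] by auto
qed

lemma below_coatom:
  assumes w: "point L w" and v: "point L v" "w \<subseteq> v" "\<not> coatom v" "v \<noteq> tp w" and u: "coatom u" "w \<subseteq> u"
  shows "v \<subseteq> u"
proof -
  have "point L u" using u by (simp add: coatom_def)
  then have "\<not> u \<subset> v"
    using u v tp_mono[OF _ w u(2)] by (auto simp: coatom_def)
  moreover have "v \<subseteq> u \<or> u \<subseteq> v"
    using comparable[OF w v(1-3) \<open>point L u\<close> u(2)] .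
  ultimately show ?thesis by auto
qed

text \<open>The top and a coatom count as one-point chains, so that w always belongs to its own
  chain part.\<close>

definition chain_part :: "form set \<Rightarrow> form set set" where
  "chain_part w = (if w = tp w \<or> coatom w then {w}
     else {v. point L v \<and> w \<subseteq> v \<and> \<not> coatom v \<and> v \<noteq> tp w})"

definition antichain_part :: "form set \<Rightarrow> form set set" where
  "antichain_part w = (if w = tp w \<or> coatom w then {} else {v. coatom v \<and> w \<subseteq> v})"

lemma cone_parts:
  assumes w: "point L w"
  shows "w \<in> chain_part w"
    and "\<And>v. v \<in> chain_part w \<union> antichain_part w \<Longrightarrow> point L v \<and> w \<subseteq> v"
    and "\<And>v. point L v \<Longrightarrow> w \<subseteq> v \<Longrightarrow> v \<in> chain_part w \<or> v \<in> antichain_part w \<or> v = tp w"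
    and "\<And>u v. u \<in> chain_part w \<Longrightarrow> v \<in> chain_part w \<Longrightarrow> u \<subseteq> v \<or> v \<subseteq> u"
    and "\<And>u v. u \<in> chain_part w \<Longrightarrow> v \<in> antichain_part w \<Longrightarrow> u \<subseteq> v"
    and "\<And>u v. u \<in> antichain_part w \<Longrightarrow> point L v \<Longrightarrow> u \<subseteq> v \<Longrightarrow> v = u \<or> v = tp w"
proof (goal_cases)
  case (3 v)
  then show ?case
    using tp_subset[OF 3(1) w]
    by (auto simp: chain_part_def antichain_part_def coatom_def)
next
  case (4 u v)
  then show ?case using comparable[OF w, of u v] by (auto simp: chain_part_def split: if_splits)
next
  case (5 u v)
  then show ?case using below_coatom[OF w, of u v]
    by (auto simp: chain_part_def antichain_part_def split: if_splits)
next
  case (6 u v)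
  then show ?case using tp_mono[OF _ w, of u]
    by (auto simp: antichain_part_def coatom_def split: if_splits)
qed (use w in \<open>auto simp: chain_part_def antichain_part_def coatom_def split: if_splits\<close>)

end

text \<open>In this numbering the chain consists of the points 2i, the fork has the root 1 and the
  tips 4j + 1 with j > 0, and the top is 3. For m = 0 the second summand would be a single
  point.\<close>

lemma H_un_frame_eq:
  assumes "m \<ge> 1"
  shows "frame_sum (chain_frame N) (rfork_frame m) =
    {(2 * i, 2 * i') | i i'. i \<le> i' \<and> i' < N} \<union> {(2 * i, 4 * j + 1) | i j. i < N \<and> j \<le> m} \<union>
    {(2 * i, 3) | i. i < N} \<union> {(1, 4 * j + 1) | j. j \<le> m} \<union> {(4 * j + 1, 4 * j + 1) | j. j \<le> m} \<union>
    {(4 * j + 1, 3) | j. j \<le> m} \<union> {(3, 3)}" (is "_ = ?R")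
proof -
  have G: "rfork_frame m = {(2 * i, 2 * j) | i j. (i = 0 \<or> i = j) \<and> j \<le> m} \<union> {(1, 1)} \<union> {(2 * i, 1) | i. i \<le> m}"
    using assms by (auto simp: rfork_frame_def add_top_eq Field_fork_frame) (auto simp: fork_frame_def image_iff)
  have FG: "Field (rfork_frame m) = {2 * i | i. i \<le> m} \<union> {1}"
    using assms by (auto simp: rfork_frame_def Field_add_top Field_fork_frame)
  show ?thesis
  proof (intro equalityI subrelI)
    fix x y assume "(x, y) \<in> frame_sum (chain_frame N) (rfork_frame m)"
    then consider i j where "x = 2 * i" "y = 2 * j" "i \<le> j" "j < N"
      | i j where "x = 2 * i + 1" "y = 2 * j + 1" "(i, j) \<in> rfork_frame m"
      | i j where "x = 2 * i" "y = 2 * j + 1" "i < N" "j \<in> Field (rfork_frame m)"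
      unfolding frame_sum_def Field_chain_frame by (auto simp: chain_frame_def)
    then show "(x, y) \<in> ?R"
    proof cases
      case 1
      then show ?thesis by blast
    next
      case 2
      then show ?thesis unfolding G by force
    next
      case 3
      then show ?thesis unfolding FG by force
    qed
  next
    fix x y assume xy: "(x, y) \<in> ?R"
    have I1: "(2 * i, 2 * j) \<in> frame_sum (chain_frame N) (rfork_frame m)" if "i \<le> j" "j < N" for i j
      using that by (simp add: chain_frame_def)
    have I2: "(2 * i + 1, 2 * j + 1) \<in> frame_sum (chain_frame N) (rfork_frame m)" if "(i, j) \<in> rfork_frame m" for i j
      using that by simp
    have I3: "(2 * i, 2 * j + 1) \<in> frame_sum (chain_frame N) (rfork_frame m)"
      if "i < N" "j \<in> Field (rfork_frame m)" for i j
      using that by (simp add: Field_chain_frame)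
    consider i j where "x = 2 * i" "y = 2 * j" "i \<le> j" "j < N"
      | i j where "x = 2 * i" "y = 2 * (2 * j) + 1" "i < N" "j \<le> m"
      | i where "x = 2 * i" "y = 2 * 1 + 1" "i < N"
      | j where "x = 2 * (2 * 0) + 1" "y = 2 * (2 * j) + 1" "j \<le> m"
      | j where "x = 2 * (2 * j) + 1" "y = 2 * (2 * j) + 1" "j \<le> m"
      | j where "x = 2 * (2 * j) + 1" "y = 2 * 1 + 1" "j \<le> m"
      | "x = 2 * 1 + 1" "y = 2 * 1 + 1"
      using xy by (elim UnE CollectE exE conjE) (auto simp del: One_nat_def)
    then show "(x, y) \<in> frame_sum (chain_frame N) (rfork_frame m)"
    proof cases
      case 1 then show ?thesis using I1 by blast
    next
      case 2 show ?thesis unfolding 2(1,2) by (rule I3) (use 2 in \<open>auto simp: FG\<close>)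
    next
      case 3 show ?thesis unfolding 3(1,2) by (rule I3) (use 3 in \<open>auto simp: FG\<close>)
    next
      case 4 show ?thesis unfolding 4(1,2) by (rule I2) (use 4 in \<open>auto simp: G\<close>)
    next
      case 5 show ?thesis unfolding 5(1,2) by (rule I2) (use 5 in \<open>auto simp: G\<close>)
    next
      case 6 show ?thesis unfolding 6(1,2) by (rule I2) (use 6 in \<open>auto simp: G\<close>)
    next
      case 7 show ?thesis unfolding 7 by (rule I2) (auto simp: G)
    qed
  qed
qed

context un_logic
begin

text \<open>Only the values of the variables of \<open>A\<close> matter on the cone of a point \<open>w\<close>, so the part
  of the cone that forms a chain may be indexed by the number of variables that hold.\<close>

theorem logic_H_un_subset: "logic_of H_un \<subseteq> L"
proof (rule subsetI, rule ccontr)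
  fix A assume A: "A \<in> logic_of H_un" "A \<notin> L"
  then obtain w where w: "point L w" "A \<notin> w"
    using L_iff_points[of A] by auto
  define Ch where "Ch = chain_part w"
  define Co where "Co = antichain_part w"
  note wCh = cone_parts(1)[OF w(1), folded Ch_def]
    and cone = cone_parts(2)[OF w(1), folded Ch_def Co_def]
    and cases = cone_parts(3)[OF w(1), folded Ch_def Co_def]
    and lin = cone_parts(4)[OF w(1), folded Ch_def]
    and ChCo = cone_parts(5)[OF w(1), folded Ch_def Co_def]
    and Co = cone_parts(6)[OF w(1), folded Co_def]
  let ?X = "vars A" and ?t = "tp w"
  define val where "val v = {x \<in> ?X. Var x \<in> v}" for v
  have val_mono: "val u \<subseteq> val v" if "u \<subseteq> v" for u v
    using that by (auto simp: val_def)
  have val_X: "val v \<subseteq> ?X" "finite (val v)" "card (val v) \<le> card ?X" for v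
  proof -
    show "val v \<subseteq> ?X" by (auto simp: val_def)
    then show "finite (val v)" "card (val v) \<le> card ?X"
      using finite_subset[OF _ finite_vars] card_mono[OF finite_vars] by simp_all
  qed
  have finval: "finite (val ` S)" for S
    by (rule finite_subset[of _ "Pow ?X"]) (use val_X in auto)
  let ?CV = "val ` Ch"
  have CV_lin: "c \<subseteq> c' \<or> c' \<subseteq> c" if "c \<in> ?CV" "c' \<in> ?CV" for c c'
    using that lin val_mono by (metis imageE)
  have Union_CV: "\<Union>S \<in> S" if "S \<subseteq> ?CV" "S \<noteq> {}" for S
  proof (rule Union_in_chain[OF finite_subset[OF that(1) finval] that(2)])
    show "subset.chain ?CV S"
      unfolding subset_chain_def using that(1) CV_lin by (meson subsetD)
  qed
  have wCV: "val w \<in> ?CV" "\<And>c. c \<in> ?CV \<Longrightarrow> val w \<subseteq> c"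
  proof -
    show "val w \<in> ?CV" using wCh by simp
    fix c assume "c \<in> ?CV"
    then obtain v where "v \<in> Ch" "c = val v" by auto
    then show "val w \<subseteq> c" using cone[of v] val_mono[of w v] by simp
  qed
  \<comment> \<open>The largest value of size at most i on the chain. The value of w, which is the
    least one, serves as default when no value is that small.\<close>
  define cv where "cv i = \<Union>(insert (val w) {c \<in> ?CV. card c \<le> i})" for i
  have cv_in: "cv i \<in> ?CV" for i
  proof -
    have "cv i \<in> insert (val w) {c \<in> ?CV. card c \<le> i}"
      unfolding cv_def by (rule Union_CV) (use wCV in auto)
    then show ?thesis using wCV by auto
  qed
  have cv_mono: "cv i \<subseteq> cv j" if "i \<le> j" for i j
    unfolding cv_def by (rule Union_mono) (use that in auto)
  have cv_upper: "c \<subseteq> cv i" if "c \<in> ?CV" "card c \<le> i" for c i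
    unfolding cv_def using that by blast
  have cv_card: "cv (card c) = c" if c: "c \<in> ?CV" for c
  proof
    show "c \<subseteq> cv (card c)" using cv_upper c by simp
    have "c' \<subseteq> c" if c': "c' \<in> ?CV" "card c' \<le> card c" for c'
    proof (rule ccontr)
      assume "\<not> c' \<subseteq> c"
      then have "c \<subset> c'" using CV_lin[OF c c'(1)] by auto
      moreover have "finite c'" using c'(1) val_X by auto
      ultimately have "card c < card c'" by (rule psubset_card_mono[rotated])
      then show False using c'(2) by simp
    qed
    then show "cv (card c) \<subseteq> c"
      using wCV(2)[OF c] unfolding cv_def by auto
  qed
  have up: "\<exists>v'. point L v' \<and> v \<subseteq> v' \<and> v' \<in> Ch \<and> val v' = c"
    if v: "v \<in> Ch" and c: "c \<in> ?CV" "val v \<subseteq> c" for v c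
  proof -
    obtain v' where v': "v' \<in> Ch" "val v' = c" using c by auto
    show ?thesis
    proof (cases "v \<subseteq> v'")
      case True
      then show ?thesis using v' cone by auto
    next
      case False
      then have "v' \<subseteq> v" using lin[OF v v'(1)] by auto
      then have "val v = c" using val_mono[of v' v] v'(2) c(2) by auto
      then show ?thesis using v cone by auto
    qed
  qed
  \<comment> \<open>Coatoms of equal value share a tip. Adding the value of the top guarantees a
    tip, and is harmless since that tip may stand for the top itself.\<close>
  let ?E = "insert (val ?t) (val ` Co)"
  define m where "m = card ?E"
  have "m \<ge> 1" using finval[of Co] by (auto simp: m_def card_gt_0_iff Suc_le_eq)
  obtain e where e: "bij_betw e {1..m} ?E"
    using ex_bij_betw_nat_finite_1[of ?E] finval[of Co] by (auto simp: m_def)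
  \<comment> \<open>Sizes of values range from 0 to \<open>card ?X\<close>, hence the
    successor.\<close>
  define N where "N = Suc (card ?X)"
  define F where "F = frame_sum (chain_frame N) (rfork_frame m)"
  have F_eq: "F = {(2 * i, 2 * i') | i i'. i \<le> i' \<and> i' < N} \<union> {(2 * i, 4 * j + 1) | i j. i < N \<and> j \<le> m} \<union>
    {(2 * i, 3) | i. i < N} \<union> {(1, 4 * j + 1) | j. j \<le> m} \<union> {(4 * j + 1, 4 * j + 1) | j. j \<le> m} \<union>
    {(4 * j + 1, 3) | j. j \<le> m} \<union> {(3, 3)}"
    unfolding F_def by (rule H_un_frame_eq[OF \<open>m \<ge> 1\<close>])
  define nv where "nv n = (if even n then cv (n div 2) else if n = 1 then cv (card ?X) else
      if n = 3 then val ?t else e (n div 4))" for n :: nat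
  \<comment> \<open>A bisimulation, but no function: the foot 1 of the fork repeats the largest
    value of the chain, and an index 2i at which \<open>cv\<close> does not grow repeats the value
    before it.\<close>
  define Z where "Z n v \<longleftrightarrow> val v = nv n \<and>
      (if even n then n div 2 < N \<and> v \<in> Ch else if n = 1 then v \<in> Ch else
       if n = 3 then v = ?t else (\<exists>j\<in>{1..m}. n = 4 * j + 1) \<and> (v \<in> Co \<or> v = ?t))" for n :: nat and v
  have Z2: "Z (2 * i) v \<longleftrightarrow> i < N \<and> v \<in> Ch \<and> val v = cv i" for i v
    by (auto simp: Z_def nv_def)
  have Z1: "Z 1 v \<longleftrightarrow> v \<in> Ch \<and> val v = cv (card ?X)" for v
    by (auto simp: Z_def nv_def)
  have Z3: "Z 3 v \<longleftrightarrow> v = ?t" for v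
    by (auto simp: Z_def nv_def)
  have Z4: "Z (4 * j + 1) v \<longleftrightarrow> (v \<in> Co \<or> v = ?t) \<and> val v = e j" if "j \<in> {1..m}" for j v
  proof -
    have "odd (4 * j + 1)" "4 * j + 1 \<noteq> 1" "4 * j + 1 \<noteq> 3" "(4 * j + 1) div 4 = j"
      using that by auto
    then show ?thesis using that unfolding Z_def nv_def by auto
  qed
  have Z_cases: thesis if "Z n v" "\<And>i. n = 2 * i \<Longrightarrow> i < N \<Longrightarrow> thesis" "n = 1 \<Longrightarrow> thesis" "n = 3 \<Longrightarrow> thesis"
    "\<And>j. j \<in> {1..m} \<Longrightarrow> n = 4 * j + 1 \<Longrightarrow> thesis" for n v thesis
    using that unfolding Z_def by (metis dvd_mult_div_cancel)
  have t: "point L ?t" "w \<subseteq> ?t"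
    using point_tp subset_tp_self w by auto
  have below_t: "v \<subseteq> ?t" if "point L v" "w \<subseteq> v" for v
    using subset_tp[OF that w(1)] .
  have Zpt: "point L v" "w \<subseteq> v" if "Z n v" for n v
    using that cone[of v] t unfolding Z_def by (auto split: if_splits)
  have co_val: "\<exists>j\<in>{1..m}. e j = val v" if "v \<in> Co \<or> v = ?t" for v
    using that bij_betw_imp_surj_on[OF e] by (metis image_iff insert_iff)
  have val_co: "\<exists>v. (v \<in> Co \<or> v = ?t) \<and> val v = e j" if "j \<in> {1..m}" for j
    using that bij_betw_apply[OF e, of j] by auto
  have cmax: "val v \<subseteq> cv (card ?X)" if "v \<in> Ch" for v
    using cv_upper that val_X by auto
  have to_co: "\<exists>v'. point L v' \<and> v \<subseteq> v' \<and> Z (4 * j + 1) v'" if "v \<in> Ch" "j \<le> m" for v j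
  proof (cases "j = 0")
    case True
    then show ?thesis using up[OF that(1) cv_in cmax[OF that(1)]] Z1 by auto
  next
    case False
    then have j: "j \<in> {1..m}" using that by auto
    obtain v' where v': "v' \<in> Co \<or> v' = ?t" "val v' = e j"
      using val_co[OF j] by auto
    moreover have "v \<subseteq> v'" "point L v'"
      using v'(1) ChCo[OF that(1)] cone t below_t[of v] that(1) by auto
    ultimately show ?thesis using Z4[OF j] by auto
  qed
  have to_t: "\<exists>v'. point L v' \<and> v \<subseteq> v' \<and> Z 3 v'" if "Z n v" for n v
    using Zpt[OF that] below_t t Z3 by auto
  have fwd: "\<exists>v'. point L v' \<and> v \<subseteq> v' \<and> Z n' v'" if Z: "Z n v" and n': "(n, n') \<in> F" for n v n'
  proof -
    consider i i' where "n = 2 * i" "n' = 2 * i'" "i \<le> i'" "i' < N"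
      | i j where "n = 2 * i" "n' = 4 * j + 1" "j \<le> m"
      | j where "n = 1" "n' = 4 * j + 1" "j \<le> m"
      | "n' = n" | "n' = 3"
      using n' unfolding F_eq by blast
    then show ?thesis
    proof cases
      case 1
      then have "v \<in> Ch" "val v \<subseteq> cv i'" using Z Z2 cv_mono by auto
      then show ?thesis using up[OF _ cv_in] Z2 1 by auto
    next
      case 2
      then show ?thesis using to_co Z Z2 by auto
    next
      case 3
      then show ?thesis using to_co Z Z1 by auto
    next
      case 4
      then show ?thesis using Z Zpt by auto
    next
      case 5
      then show ?thesis using to_t Z by auto
    qed
  qed
  have bwd: "\<exists>n'. (n, n') \<in> F \<and> Z n' v'" if Z: "Z n v" and v': "point L v'" "v \<subseteq> v'" for n v v'
  proof -
    from Z consider i where "n = 2 * i" "i < N" | "n = 1" | "n = 3"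
      | j where "j \<in> {1..m}" "n = 4 * j + 1"
      by (rule Z_cases)
    then show ?thesis
    proof cases
    case 1
    then have v: "v \<in> Ch" "val v = cv i" using Z Z2 by auto
    have "w \<subseteq> v'" using Zpt[OF Z] v' by auto
    from cases[OF v'(1) this] show ?thesis
    proof (elim disjE)
      assume "v' \<in> Ch"
      show ?thesis
      proof (cases "val v' = cv i")
        case True
        then have "(n, n) \<in> F" "Z n v'" using 1 \<open>v' \<in> Ch\<close> Z2 unfolding F_eq by auto
        then show ?thesis by auto
      next
        case False
        let ?i = "card (val v')"
        have "cv i \<subseteq> val v'" using val_mono[OF v'(2)] v by auto
        then have "i \<le> ?i" using False cv_upper[of "val v'" i] \<open>v' \<in> Ch\<close> by (cases "?i \<le> i") auto
        moreover have "?i < N" using val_X(3)[of v'] by (simp add: N_def)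
        ultimately have "(n, 2 * ?i) \<in> F" using 1 unfolding F_eq by blast
        moreover have "Z (2 * ?i) v'"
          using Z2 \<open>?i < N\<close> \<open>v' \<in> Ch\<close> cv_card by auto
        ultimately show ?thesis by auto
      qed
    next
      assume "v' \<in> Co"
      then obtain j where j: "j \<in> {1..m}" "e j = val v'" using co_val[of v'] by auto
      then have "(n, 4 * j + 1) \<in> F" using 1 unfolding F_eq by auto
      moreover have "Z (4 * j + 1) v'" using Z4 j \<open>v' \<in> Co\<close> by auto
      ultimately show ?thesis by blast
    next
      assume "v' = ?t"
      moreover have "(n, 3) \<in> F" using 1 unfolding F_eq by auto
      ultimately show ?thesis using Z3 by auto
    qed
  next
    case 2
    then have v: "v \<in> Ch" "val v = cv (card ?X)" using Z Z1 by auto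
    have "w \<subseteq> v'" using Zpt[OF Z] v' by auto
    from cases[OF v'(1) this] show ?thesis
    proof (elim disjE)
      assume "v' \<in> Ch"
      then have "val v' = cv (card ?X)" using cmax val_mono[OF v'(2)] v by auto
      moreover have "(1, 4 * 0 + 1) \<in> F" unfolding F_eq by blast
      ultimately show ?thesis using 2 Z1 \<open>v' \<in> Ch\<close> by auto
    next
      assume "v' \<in> Co"
      then obtain j where j: "j \<in> {1..m}" "e j = val v'" using co_val[of v'] by auto
      then have "(n, 4 * j + 1) \<in> F" using 2 unfolding F_eq by auto
      moreover have "Z (4 * j + 1) v'" using Z4 j \<open>v' \<in> Co\<close> by auto
      ultimately show ?thesis by blast
    next
      assume "v' = ?t"
      moreover have "(4 * 0 + 1, 3) \<in> F" unfolding F_eq by blast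
      ultimately show ?thesis using Z3 2 by auto
    qed
  next
    case 3
    then have "v' = ?t" using Z Z3 tp_subset[OF v'(1) w(1)] v' by auto
    moreover have "(3, 3) \<in> F" unfolding F_eq by blast
    ultimately show ?thesis using Z3 3 by auto
  next
    case 4
    then have v: "v \<in> Co \<or> v = ?t" using Z Z4 by auto
    then have "v' = v \<or> v' = ?t"
      using Co[of v v'] v' tp_subset[OF v'(1) w(1)] by auto
    moreover have "(n, n) \<in> F" "(n, 3) \<in> F" using 4 unfolding F_eq by auto
    ultimately show ?thesis using Z Z3 by auto
    qed
  qed
  define V where "V n x \<longleftrightarrow> (\<exists>v. Z n v) \<and> x \<in> nv n" for n x
  have "persistent F V"
    unfolding persistent_def
  proof (intro allI impI)
    fix n n' x assume *: "(n, n') \<in> F" "V n x"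
    then obtain v where "Z n v" by (auto simp: V_def)
    then obtain v' where "v \<subseteq> v'" "Z n' v'" using fwd[OF _ *(1)] by metis
    with \<open>Z n v\<close> have "nv n \<subseteq> nv n'" "\<exists>v. Z n' v"
      using val_mono[of v v'] by (auto simp: Z_def)
    then show "V n' x" using *(2) by (auto simp: V_def)
  qed
  have "card (val w) < N" using val_X(3)[of w] by (simp add: N_def)
  then have Zw: "Z (2 * card (val w)) w"
    using Z2 wCh cv_card[OF wCV(1)] by auto
  have "sat (\<lambda>a b. (a, b) \<in> F) V (2 * card (val w)) A \<longleftrightarrow>
    sat (\<lambda>w v. point L v \<and> w \<subseteq> v) (\<lambda>w x. Var x \<in> w) w A"
  proof (rule sat_bisim[where Z = Z])
    fix n v x assume "Z n v" "x \<in> vars A"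
    moreover from this have "val v = nv n" unfolding Z_def by iprover
    ultimately show "V n x = (Var x \<in> v)"
      unfolding V_def by (auto simp: val_def)
  next
    fix n v n' assume "Z n v" "(n, n') \<in> F"
    from fwd[OF this] show "\<exists>v'. (point L v' \<and> v \<subseteq> v') \<and> Z n' v'" by simp
  next
    fix n v v' assume "Z n v" "point L v' \<and> v \<subseteq> v'"
    then show "\<exists>n'. (n, n') \<in> F \<and> Z n' v'" using bwd[of n v v'] by iprover
  qed (rule Zw)
  then have "\<not> forces F V (2 * card (val w)) A"
    using w(2) mem_subst_iff_sat[OF w(1), of Var A] unfolding forces_eq_sat subst_Var by iprover
  moreover have "2 * card (val w) \<in> Field F"
    using \<open>card (val w) < N\<close> unfolding F_def Field_frame_sum Field_chain_frame by auto
  ultimately have "\<not> valid F A"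
    using \<open>persistent F V\<close> by (auto simp: valid_def)
  moreover have "F \<in> H_un"
    unfolding H_un_def F_def by (rule CollectI, rule exI[of _ N], rule exI[of _ m]) (simp add: N_def)
  ultimately show False
    using A(1) by (auto simp: logic_of_def)
qed

end

section \<open>Formulas valid on \<open>H_un\<close> that fail on the three frames\<close>

definition top_and_coatoms :: "frame \<Rightarrow> bool" where
  "top_and_coatoms F \<longleftrightarrow> (\<exists>t\<in>Field F. (\<forall>x\<in>Field F. (x, t) \<in> F) \<and>
     (\<forall>u v u'. u \<in> Field F \<longrightarrow> v \<in> Field F \<longrightarrow> (u, v) \<notin> F \<longrightarrow> (v, u) \<notin> F \<longrightarrow>
        (u, u') \<in> F \<longrightarrow> u \<noteq> u' \<longrightarrow> u' = t))"

lemma top_and_coatoms_rfork: "top_and_coatoms (rfork_frame m)"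
proof (cases "m = 0")
  case True
  then have "rfork_frame m = {(0, 0)}"
    by (auto simp: rfork_frame_def chain_frame_def)
  then show ?thesis
    by (auto simp: top_and_coatoms_def)
next
  case False
  then have G: "(x, y) \<in> rfork_frame m \<longleftrightarrow> (\<exists>i j. x = 2 * i \<and> y = 2 * j \<and> (i = 0 \<or> i = j) \<and> j \<le> m) \<or>
      (x = 1 \<and> y = 1) \<or> (\<exists>i\<le>m. x = 2 * i \<and> y = 1)" for x y
    by (auto simp: rfork_frame_def add_top_eq Field_fork_frame) (auto simp: fork_frame_def image_iff)
  have FG: "Field (rfork_frame m) = {2 * i | i. i \<le> m} \<union> {1}"
    using False by (auto simp: rfork_frame_def Field_add_top Field_fork_frame)
  show ?thesis
    unfolding top_and_coatoms_def FG
    by (rule bexI[of _ 1]) (auto simp: G)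
qed

lemma top_and_coatoms_sum:
  assumes "top_and_coatoms G"
  shows "top_and_coatoms (frame_sum (chain_frame d) G)"
proof -
  obtain t where t: "t \<in> Field G" "\<And>x. x \<in> Field G \<Longrightarrow> (x, t) \<in> G"
    and co: "\<And>u v u'. u \<in> Field G \<Longrightarrow> v \<in> Field G \<Longrightarrow> (u, v) \<notin> G \<Longrightarrow> (v, u) \<notin> G \<Longrightarrow>
        (u, u') \<in> G \<Longrightarrow> u \<noteq> u' \<Longrightarrow> u' = t"
    using assms unfolding top_and_coatoms_def by metis
  let ?S = "frame_sum (chain_frame d) G"
  have S: "(x, y) \<in> ?S \<longleftrightarrow> (\<exists>i j. x = 2 * i \<and> y = 2 * j \<and> i \<le> j \<and> j < d) \<or>
      (\<exists>i j. x = 2 * i + 1 \<and> y = 2 * j + 1 \<and> (i, j) \<in> G) \<or>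
      (\<exists>i j. x = 2 * i \<and> y = 2 * j + 1 \<and> i < d \<and> j \<in> Field G)" for x y
    unfolding frame_sum_def Field_chain_frame by (auto simp: chain_frame_def)
  have FS: "x \<in> Field ?S \<longleftrightarrow> (\<exists>i<d. x = 2 * i) \<or> (\<exists>i\<in>Field G. x = 2 * i + 1)" for x
    unfolding Field_frame_sum Field_chain_frame by auto
  show ?thesis
    unfolding top_and_coatoms_def
  proof (intro bexI[of _ "2 * t + 1"] conjI ballI allI impI)
    fix x assume "x \<in> Field ?S"
    then show "(x, 2 * t + 1) \<in> ?S"
      unfolding FS S using t by blast
  next
    fix u v u' assume u: "u \<in> Field ?S" and v: "v \<in> Field ?S" and uv: "(u, v) \<notin> ?S" "(v, u) \<notin> ?S"
      and u': "(u, u') \<in> ?S" "u \<noteq> u'"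
    have "\<exists>i\<in>Field G. u = 2 * i + 1" "\<exists>i\<in>Field G. v = 2 * i + 1"
      using u v uv unfolding FS S by (metis linorder_le_cases)+
    then obtain i j where ij: "i \<in> Field G" "j \<in> Field G" "u = 2 * i + 1" "v = 2 * j + 1"
      by metis
    obtain k where k: "u' = 2 * k + 1" "(i, k) \<in> G"
      using u'(1) unfolding S ij by (elim disjE exE conjE) (presburger, simp, presburger)
    have "k = t"
      by (rule co[of i j]) (use ij uv u' k in auto)
    then show "u' = 2 * t + 1" using k by simp
  qed (use t FS in auto)
qed

lemma top_and_coatoms_H_un: "F \<in> H_un \<Longrightarrow> top_and_coatoms F"
  unfolding H_un_def using top_and_coatoms_sum top_and_coatoms_rfork by auto

text \<open>A refutation consists of a point u with variable 2 but not 3 and a point v' with 3 but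
  not 2, hence incomparable, and of a point above u with variable 1 but not 0. Variable 1 fails at
  u, so the latter lies strictly above u; the double negation puts variable 0 at the top, so it is
  not the top.\<close>

definition coatom_form :: form where
  "coatom_form = (\<^bold>\<not> \<^bold>\<not> Var 0 \<^bold>\<longrightarrow>
     ((Var 2 \<^bold>\<longrightarrow> (Var 3 \<^bold>\<or> (Var 1 \<^bold>\<or> (Var 1 \<^bold>\<longrightarrow> Var 0)))) \<^bold>\<or> (Var 3 \<^bold>\<longrightarrow> Var 2)))"

lemma H_un_valid:
  assumes F: "F \<in> H_un"
  shows "valid F (\<^bold>\<not> Var 0 \<^bold>\<or> \<^bold>\<not> \<^bold>\<not> Var 0)" "valid F coatom_form"
proof -
  note frame = is_frameD[OF is_frame_H_un[OF F]]
  obtain t where t: "t \<in> Field F" "\<And>x. x \<in> Field F \<Longrightarrow> (x, t) \<in> F"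
    and co: "\<And>u v u'. u \<in> Field F \<Longrightarrow> v \<in> Field F \<Longrightarrow> (u, v) \<notin> F \<Longrightarrow> (v, u) \<notin> F \<Longrightarrow>
        (u, u') \<in> F \<Longrightarrow> u \<noteq> u' \<Longrightarrow> u' = t"
    using top_and_coatoms_H_un[OF F] unfolding top_and_coatoms_def by metis
  have to_t: "(x, t) \<in> F" if "(y, x) \<in> F" for x y
    using t(2)[of x] that by (auto simp: Field_def)
  have at_t: "x = t" if "(t, x) \<in> F" for x
    using that to_t[OF that] frame(3) by (auto dest: antisymD)
  show "valid F (\<^bold>\<not> Var 0 \<^bold>\<or> \<^bold>\<not> \<^bold>\<not> Var 0)"
    unfolding valid_def
  proof (intro allI impI ballI)
    fix V w assume V: "persistent F V" and w: "w \<in> Field F"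
    show "forces F V w (\<^bold>\<not> Var 0 \<^bold>\<or> \<^bold>\<not> \<^bold>\<not> Var 0)"
    proof (cases "V t 0")
      case True
      then show ?thesis using to_t by auto
    next
      case False
      then show ?thesis using V to_t unfolding persistent_def by (simp, meson)
    qed
  qed
  show "valid F coatom_form"
    unfolding valid_def
  proof (intro allI impI ballI, rule ccontr)
    fix V w assume V: "persistent F V" and w: "w \<in> Field F" and "\<not> forces F V w coatom_form"
    then obtain v u u' v' where v: "(w, v) \<in> F" "forces F V v (\<^bold>\<not> \<^bold>\<not> Var 0)"
      and u: "(v, u) \<in> F" "V u 2" "\<not> V u 3" "\<not> V u 1" and u': "(u, u') \<in> F" "V u' 1" "\<not> V u' 0"
      and v': "(v, v') \<in> F" "V v' 3" "\<not> V v' 2"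
      unfolding coatom_form_def by auto
    have "(u, v') \<notin> F" "(v', u) \<notin> F" "u \<noteq> u'"
      using V u v' u' unfolding persistent_def by metis+
    then have "u' = t"
      using co[of u v' u'] u v' u' by (auto simp: Field_def)
    moreover have "V t 0"
      using v(2) to_t[OF v(1)] at_t by auto
    ultimately show False using u' by simp
  qed
qed

lemma not_valid_F2: "\<not> valid (fork_frame 2) (\<^bold>\<not> Var 0 \<^bold>\<or> \<^bold>\<not> \<^bold>\<not> Var 0)"
proof -
  let ?V = "\<lambda>n x. n = (1::nat)"
  have "persistent (fork_frame 2) ?V"
    unfolding fork2 persistent_def by auto
  moreover have "\<not> forces (fork_frame 2) ?V 0 (\<^bold>\<not> Var 0 \<^bold>\<or> \<^bold>\<not> \<^bold>\<not> Var 0)"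
    unfolding fork2 by auto
  ultimately show ?thesis
    unfolding valid_def Field_fork2 by blast
qed

text \<open>\<open>P\<close> says that a lies below c, which is the only difference between
  \<open>R_2+\<close> and \<open>G_3+\<close>. In both, b is incomparable with a although c lies
  strictly between b and the top.\<close>

lemma five_point_frame:
  fixes r a b c t :: nat
  assumes F: "\<And>x y. (x, y) \<in> F \<longleftrightarrow> (x = r \<and> y \<in> {r, a, b, c, t}) \<or> (x = a \<and> (y \<in> {a, t} \<or> (P \<and> y = c))) \<or>
      (x = b \<and> y \<in> {b, c, t}) \<or> (x = c \<and> y \<in> {c, t}) \<or> (x = t \<and> y = t)"
    and dist: "distinct [r, a, b, c, t]"
  shows "\<not> valid F coatom_form"
proof -
  define V where "V n x = (n = t \<or> (n = c \<and> x \<noteq> 0 \<and> (P \<or> x \<noteq> 3)) \<or> (n = b \<and> x = 2) \<or> (n = a \<and> x = 3))"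
    for n x :: nat
  have V0: "V n 0 \<longleftrightarrow> n = t" and V1: "V n 1 \<longleftrightarrow> n = t \<or> n = c" and V2: "V n 2 \<longleftrightarrow> n = t \<or> n = c \<or> n = b"
    and V3: "V n 3 \<longleftrightarrow> n = t \<or> (n = c \<and> P) \<or> n = a" for n
    by (auto simp: V_def)
  have "persistent F V"
    unfolding persistent_def F V_def using dist by auto
  moreover have "r \<in> Field F"
    using F[of r r] by (auto simp: Field_def)
  moreover have "\<not> forces F V r coatom_form"
  proof -
    have not_imp: "\<not> forces F V w (A \<^bold>\<longrightarrow> B)"
      if "(w, v) \<in> F" "forces F V v A" "\<not> forces F V v B" for w v A B
      using that by auto
    have f: "forces F V r (\<^bold>\<not> \<^bold>\<not> Var 0)"
    proof -
      have "(v, t) \<in> F" if "(r, v) \<in> F" for v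
        using that unfolding F by auto
      then show ?thesis by (auto simp: V0)
    qed
    have nb: "\<not> forces F V b (Var 3 \<^bold>\<or> (Var 1 \<^bold>\<or> (Var 1 \<^bold>\<longrightarrow> Var 0)))"
    proof -
      have "(b, c) \<in> F" "V c 1" "\<not> V c 0" "\<not> V b 3" "\<not> V b 1"
        unfolding F V0 V1 V3 using dist by auto
      then show ?thesis unfolding forces.simps by iprover
    qed
    have rel: "(r, b) \<in> F" "(r, a) \<in> F" "(r, r) \<in> F" "V b 2" "V a 3" "\<not> V a 2"
      unfolding F V2 V3 using dist by auto
    have "\<not> forces F V r (Var 2 \<^bold>\<longrightarrow> (Var 3 \<^bold>\<or> (Var 1 \<^bold>\<or> (Var 1 \<^bold>\<longrightarrow> Var 0))))"
      by (rule not_imp[OF rel(1) _ nb]) (simp add: rel)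
    moreover have "\<not> forces F V r (Var 3 \<^bold>\<longrightarrow> Var 2)"
      by (rule not_imp[OF rel(2)]) (simp_all add: rel)
    ultimately have "\<not> forces F V r ((Var 2 \<^bold>\<longrightarrow> (Var 3 \<^bold>\<or> (Var 1 \<^bold>\<or> (Var 1 \<^bold>\<longrightarrow> Var 0)))) \<^bold>\<or> (Var 3 \<^bold>\<longrightarrow> Var 2))"
      unfolding forces.simps(4) by iprover
    then show ?thesis
      unfolding coatom_form_def by (rule not_imp[OF rel(3) f])
  qed
  ultimately show ?thesis
    by (auto simp: valid_def)
qed

lemma R2p_iff: "(x, y) \<in> add_top (rfork_frame 2) \<longleftrightarrow> (x = 0 \<and> y \<in> {0, 4, 8, 2, 1}) \<or>
    (x = 4 \<and> (y \<in> {4, 1} \<or> (True \<and> y = 2))) \<or> (x = 8 \<and> y \<in> {8, 2, 1}) \<or> (x = 2 \<and> y \<in> {2, 1}) \<or> (x = 1 \<and> y = 1)"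
  unfolding R2p by (simp del: One_nat_def) argo

lemma G3p_iff: "(x, y) \<in> add_top G3_frame \<longleftrightarrow> (x = 0 \<and> y \<in> {0, 2, 4, 6, 1}) \<or>
    (x = 2 \<and> (y \<in> {2, 1} \<or> (False \<and> y = 6))) \<or> (x = 4 \<and> y \<in> {4, 6, 1}) \<or> (x = 6 \<and> y \<in> {6, 1}) \<or> (x = 1 \<and> y = 1)"
  unfolding G3p by (simp del: One_nat_def) argo

text \<open>Each frame refutes one of two formulas that are valid on \<open>H_un\<close>.\<close>

theorem H_un_omits:
  assumes "logic_of H_un \<subseteq> L"
  shows "omits L (add_top (rfork_frame 2))" "omits L (add_top G3_frame)" "omits L (fork_frame 2)"
proof -
  have "coatom_form \<in> L" "(\<^bold>\<not> Var 0 \<^bold>\<or> \<^bold>\<not> \<^bold>\<not> Var 0) \<in> L"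
    using assms H_un_valid by (auto simp: logic_of_def)
  moreover have "\<not> valid (add_top (rfork_frame 2)) coatom_form"
    by (rule five_point_frame[OF R2p_iff]) simp
  moreover have "\<not> valid (add_top G3_frame) coatom_form"
    by (rule five_point_frame[OF G3p_iff]) simp
  ultimately show "omits L (add_top (rfork_frame 2))" "omits L (add_top G3_frame)" "omits L (fork_frame 2)"
    using not_valid_F2 unfolding omits_def logic_of_def by blast+
qed

section \<open>Logics without unitary unification\<close>

lemma IPC_valid:
  assumes "A \<in> IPC" and F: "is_frame F"
  shows "valid F A"
  using assms(1)
proof induction
  case (IPC_K A B)
  then show ?case using forces_mono[OF is_frameD(2)[OF F]] by (auto simp: valid_def)
next
  case (IPC_S A B C)
  then show ?case
    using is_frameD(4)[OF F] transD[OF is_frameD(2)[OF F]]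
    by (simp add: valid_def) (metis FieldI2)
next
  case (IPC_conjI A B)
  then show ?case using forces_mono[OF is_frameD(2)[OF F]] by (auto simp: valid_def)
next
  case (IPC_disjE A C B)
  then show ?case
    using transD[OF is_frameD(2)[OF F]] by (simp add: valid_def)
next
  case (IPC_MP A B)
  then show ?case
    using is_frameD(4)[OF F] by (auto simp: valid_def)
qed (auto simp: valid_def)

lemma intermediate_logic_of:
  assumes F: "is_frame F"
  shows "intermediate_logic (logic_of {F})"
  unfolding intermediate_logic_def
proof (intro conjI allI impI)
  show "IPC \<subseteq> logic_of {F}"
    using IPC_valid[OF _ F] by (auto simp: logic_of_def)
  fix A B assume "(A \<^bold>\<longrightarrow> B) \<in> logic_of {F}" "A \<in> logic_of {F}"
  then show "B \<in> logic_of {F}"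
    using is_frameD(4)[OF F] by (auto simp: logic_of_def valid_def)
next
  fix \<sigma> A assume A: "A \<in> logic_of {F}"
  have "forces F V w (subst \<sigma> A)" if V: "persistent F V" and w: "w \<in> Field F" for V w
  proof -
    have "persistent F (\<lambda>w x. forces F V w (\<sigma> x))"
      unfolding persistent_def using forces_mono[OF is_frameD(2)[OF F] V] by blast
    then show ?thesis
      using A w by (simp add: forces_subst logic_of_def valid_def)
  qed
  then show "subst \<sigma> A \<in> logic_of {F}"
    by (auto simp: logic_of_def valid_def)
qed

text \<open>If V copies the truth values of the formulas \<alpha> x from another model, then C
  behaves under V like its instance there. Gluing such copies is how two instances of one unifier
  are brought under a common root.\<close>

lemma forces_bisim_subst:
  assumes "\<And>a b x. Z a b \<Longrightarrow> x \<in> vars C \<Longrightarrow> V a x \<longleftrightarrow> forces G W b (\<alpha> x)"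
    and "\<And>a b a'. Z a b \<Longrightarrow> (a, a') \<in> F \<Longrightarrow> \<exists>b'. (b, b') \<in> G \<and> Z a' b'"
    and "\<And>a b b'. Z a b \<Longrightarrow> (b, b') \<in> G \<Longrightarrow> \<exists>a'. (a, a') \<in> F \<and> Z a' b'"
    and "Z a b"
  shows "forces F V a C \<longleftrightarrow> forces G W b (subst \<alpha> C)"
  unfolding forces_subst
  unfolding forces_eq_sat[of F V] forces_eq_sat[of G "\<lambda>w x. forces G W w (\<alpha> x)"]
  by (rule sat_bisim[where Z = Z]) (use assms in auto)

lemma forces_iff_logic_of:
  assumes "(A \<^bold>\<longleftrightarrow> B) \<in> logic_of {F}" "is_frame F" "persistent F V" "w \<in> Field F"
  shows "forces F V w A \<longleftrightarrow> forces F V w B"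
  using assms is_frameD(4)[OF assms(2)] by (auto simp: logic_of_def valid_def)

text \<open>The unifiers \<open>\<top>\<close> and \<open>\<bottom>\<close> of \<open>x \<or> \<not> x\<close> have no common generalisation, as two models over
  \<open>L_1\<close> can be glued to one over \<open>F_2\<close>.\<close>

lemma not_unitary_F2: "\<not> unitary_unification (logic_of {fork_frame 2})"
proof
  let ?F = "fork_frame 2"
  let ?A = "Var 0 \<^bold>\<or> \<^bold>\<not> Var 0"
  have F: "is_frame ?F" by (rule is_frame_fork)
  assume un: "unitary_unification (logic_of {?F})"
  have u1: "unifier (logic_of {?F}) (\<lambda>_. \<^bold>\<top>) ?A" and u2: "unifier (logic_of {?F}) (\<lambda>_. \<^bold>\<bottom>) ?A"
    by (auto simp: unifier_def logic_of_def valid_def)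
  then obtain \<epsilon> where \<epsilon>: "unifier (logic_of {?F}) \<epsilon> ?A"
    and gen: "\<And>\<mu>. unifier (logic_of {?F}) \<mu> ?A \<Longrightarrow> \<exists>\<alpha>. subst_eq (logic_of {?F}) (\<alpha> \<circ>\<^sub>s \<epsilon>) \<mu>"
    using un unfolding unitary_unification_def by metis
  obtain \<alpha> \<beta> where \<alpha>: "\<And>x. (subst \<alpha> (\<epsilon> x) \<^bold>\<longleftrightarrow> \<^bold>\<top>) \<in> logic_of {?F}"
    and \<beta>: "\<And>x. (subst \<beta> (\<epsilon> x) \<^bold>\<longleftrightarrow> \<^bold>\<bottom>) \<in> logic_of {?F}"
    using gen[OF u1] gen[OF u2] unfolding subst_eq_def subst_comp_def by metis
  let ?W = "\<lambda>_ _. False"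
  have W: "persistent ?F ?W" by (simp add: persistent_def)
  define V where "V n x \<longleftrightarrow> (n = 1 \<and> forces ?F ?W 1 (\<alpha> x)) \<or> (n = 2 \<and> forces ?F ?W 2 (\<beta> x))" for n :: nat and x
  have V: "persistent ?F V"
    unfolding persistent_def fork2 V_def by auto
  have "forces ?F V 1 (\<epsilon> 0) \<longleftrightarrow> forces ?F ?W 1 (subst \<alpha> (\<epsilon> 0))"
    by (rule forces_bisim_subst[where Z = "\<lambda>a b. a = 1 \<and> b = 1"]) (auto simp: V_def fork2)
  then have 1: "forces ?F V 1 (\<epsilon> 0)"
    using forces_iff_logic_of[OF \<alpha> F W, of 1 0] by (simp add: Field_fork2)
  have "forces ?F V 2 (\<epsilon> 0) \<longleftrightarrow> forces ?F ?W 2 (subst \<beta> (\<epsilon> 0))"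
    by (rule forces_bisim_subst[where Z = "\<lambda>a b. a = 2 \<and> b = 2"]) (auto simp: V_def fork2)
  then have 2: "\<not> forces ?F V 2 (\<epsilon> 0)"
    using forces_iff_logic_of[OF \<beta> F W, of 2 0] by (simp add: Field_fork2)
  have "forces ?F V 0 (\<epsilon> 0) \<or> (\<forall>v. (0, v) \<in> ?F \<longrightarrow> \<not> forces ?F V v (\<epsilon> 0))"
    using \<epsilon> V by (simp add: unifier_def logic_of_def valid_def Field_fork2)
  moreover have "(0, 1) \<in> ?F" "(0, 2) \<in> ?F" by (simp_all add: fork2)
  ultimately show False
    using 1 2 forces_mono[OF is_frameD(2)[OF F] V, of 0 2 "\<epsilon> 0"] by auto
qed

text \<open>A most general unifier of \<open>x \<or> y\<close> would have finitely many variables, so it could not tell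
  apart some two of the valuations \<open>C_i\<close>, at which all variables but \<open>Suc i\<close> hold.\<close>

lemma not_unitary_five_point:
  fixes r a b c t :: nat
  assumes rel: "\<And>x y. (x, y) \<in> F \<longleftrightarrow> (x = r \<and> y \<in> {r, a, b, c, t}) \<or> (x = a \<and> (y \<in> {a, t} \<or> (P \<and> y = c))) \<or>
      (x = b \<and> y \<in> {b, c, t}) \<or> (x = c \<and> y \<in> {c, t}) \<or> (x = t \<and> y = t)"
    and dist: "distinct [r, a, b, c, t]" and F: "is_frame F"
  shows "\<not> unitary_unification (logic_of {F})"
proof
  let ?L = "logic_of {F}"
  let ?A = "Var 0 \<^bold>\<or> Var 1"
  assume un: "unitary_unification ?L"
  have "unifier ?L (\<lambda>_. \<^bold>\<top>) ?A"
    by (auto simp: unifier_def logic_of_def valid_def)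
  then obtain \<epsilon> where \<epsilon>: "unifier ?L \<epsilon> ?A"
    and gen: "\<And>\<mu>. unifier ?L \<mu> ?A \<Longrightarrow> \<exists>\<alpha>. subst_eq ?L (\<alpha> \<circ>\<^sub>s \<epsilon>) \<mu>"
    using un unfolding unitary_unification_def by metis
  define U where "U = vars (\<epsilon> 0) \<union> vars (\<epsilon> 1)"
  \<comment> \<open>One index more than \<open>U\<close> has subsets, for the pigeonhole argument on
    \<open>h\<close>.\<close>
  define N :: nat where "N = Suc (2 ^ card U)"
  define Zs where "Zs K = conjs ((\<lambda>k. Var (Suc k)) ` ({..<N} - K))" for K :: "nat set"
  \<comment> \<open>This fails at exactly the points that see C_i, restricted to the variables up to
    N.\<close>
  define sep where "sep i = (Var 0 \<^bold>\<and> Zs {i} \<^bold>\<longrightarrow> Var (Suc i))" for i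
  define mx where "mx = conjs ((\<lambda>(i, j). sep i \<^bold>\<or> sep j) ` {(i, j). i < N \<and> j < N \<and> i \<noteq> j})"
  \<comment> \<open>A failure needs a point without variable 0 at which the Suc k with k < N hold.
    If a lies below c, one of them may be missing, so that the point can have C_i above it.\<close>
  define my where "my = conjs ((\<lambda>i. Zs (if P then {i} else {}) \<^bold>\<longrightarrow> Var 0) ` {..<N})"
  define \<mu> where "\<mu> x = (if x = (0::nat) then mx else my)" for x
  have fZ: "forces F V n (Zs K) \<longleftrightarrow> (\<forall>k<N. k \<notin> K \<longrightarrow> V n (Suc k))" for V n K
    by (auto simp: Zs_def)
  have fin: "finite {(i, j). i < N \<and> j < N \<and> i \<noteq> j}"
    by (rule finite_subset[of _ "{..<N} \<times> {..<N}"]) auto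
  have fmx: "forces F V n mx \<longleftrightarrow> (\<forall>i<N. \<forall>j<N. i \<noteq> j \<longrightarrow> forces F V n (sep i) \<or> forces F V n (sep j))" for V n
    unfolding mx_def using fin by auto
  have fmy: "forces F V n my \<longleftrightarrow> (\<forall>i<N. \<forall>m. (n, m) \<in> F \<longrightarrow>
      (\<forall>k<N. \<not> (P \<and> k = i) \<longrightarrow> V m (Suc k)) \<longrightarrow> V m 0)" for V n
    unfolding my_def by (auto simp: fZ)
  have field: "Field F = {r, a, b, c, t}"
    using rel by (fastforce simp: Field_def Domain_iff Range_iff)
  \<comment> \<open>A failure of \<open>mx\<close> needs incomparable points u and v, which must be
    a and one of b, c. A failure of \<open>my\<close> needs a further point above neither of them
    nor below both, and below neither unless \<open>P\<close>. Five points leave no place for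
    it.\<close>
  have "forces F V w mx \<or> forces F V w my" if V: "persistent F V" and w: "w \<in> Field F" for V w
  proof (rule ccontr)
    assume *: "\<not> (forces F V w mx \<or> forces F V w my)"
    have per: "V y x" if "(z, y) \<in> F" "V z x" for x y z
      using V that unfolding persistent_def by blast
    obtain i j where ij: "i < N" "j < N" "i \<noteq> j" "\<not> forces F V w (sep i)" "\<not> forces F V w (sep j)"
      using * unfolding fmx de_Morgan_disj by metis
    obtain u where u: "(w, u) \<in> F" "V u 0" "\<not> V u (Suc i)" "\<And>k. k < N \<Longrightarrow> k \<noteq> i \<Longrightarrow> V u (Suc k)"
      using ij(4) unfolding sep_def by (auto simp: fZ)
    obtain v where v: "(w, v) \<in> F" "V v 0" "\<not> V v (Suc j)" "\<And>k. k < N \<Longrightarrow> k \<noteq> j \<Longrightarrow> V v (Suc k)"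
      using ij(5) unfolding sep_def by (auto simp: fZ)
    have uv: "(u, v) \<notin> F" "(v, u) \<notin> F"
      using per[of u v "Suc j"] per[of v u "Suc i"] u v ij by auto
    obtain l m where lm: "l < N" "(w, m) \<in> F" "\<And>k. k < N \<Longrightarrow> \<not> (P \<and> k = l) \<Longrightarrow> V m (Suc k)" "\<not> V m 0"
      using * unfolding fmy de_Morgan_disj by metis
    have mu: "(u, m) \<notin> F" "(v, m) \<notin> F"
      using per[of u m 0] per[of v m 0] u v lm by auto
    have m1: "(m, u) \<notin> F \<or> (m, v) \<notin> F"
      using per[of m u "Suc i"] per[of m v "Suc j"] lm(3)[of i] lm(3)[of j] u(3) v(3) ij by auto
    have m2: "(m, u) \<notin> F \<and> (m, v) \<notin> F" if "\<not> P"
      using per[of m u "Suc i"] per[of m v "Suc j"] lm(3)[of i] lm(3)[of j] u(3) v(3) ij that by auto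
    have pts: "u \<in> Field F" "v \<in> Field F" "m \<in> Field F"
      using u(1) v(1) lm(2) by (auto simp: Field_def)
    have up: "(r, x) \<in> F" if "x \<in> Field F" for x
      using that unfolding field rel by auto
    have "m \<noteq> r" "u \<noteq> r" "v \<noteq> r"
      using m1 uv up pts by auto
    moreover have "u = a \<and> (v = b \<or> v = c \<and> \<not> P) \<or> v = a \<and> (u = b \<or> u = c \<and> \<not> P)"
      using pts(1,2) uv \<open>u \<noteq> r\<close> \<open>v \<noteq> r\<close> unfolding field
      by (simp only: rel insert_iff empty_iff simp_thms) argo
    ultimately show False
      using pts(3) mu m2 unfolding field by (simp only: rel insert_iff empty_iff simp_thms) argo
  qed
  then have "unifier ?L \<mu> ?A"
    by (auto simp: unifier_def \<mu>_def logic_of_def valid_def)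
  from gen[OF this] obtain \<alpha> where "\<And>x. (subst \<alpha> (\<epsilon> x) \<^bold>\<longleftrightarrow> \<mu> x) \<in> ?L"
    unfolding subst_eq_def subst_comp_def by metis
  note \<alpha> = forces_iff_logic_of[OF this F]
  \<comment> \<open>\<open>W1 i\<close> refutes \<open>my\<close> at a and has C_i at c;
    \<open>W2 i j\<close> refutes \<open>mx\<close> at the root and has C_i at a and C_j at
    b.\<close>
  define W1 where "W1 i n x \<longleftrightarrow> n = t \<or> (n = c \<and> x \<noteq> Suc i) \<or> (n = a \<and> x \<noteq> 0 \<and> (P \<longrightarrow> x \<noteq> Suc i))"
    for i n x :: nat
  define W2 where "W2 i j n x \<longleftrightarrow> n = t \<or> n = c \<or> (n = a \<and> x \<noteq> Suc i) \<or> (n = b \<and> x \<noteq> Suc j) \<or>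
      (n = r \<and> x \<noteq> Suc i \<and> x \<noteq> Suc j \<and> x \<noteq> 0)" for i j n x :: nat
  have W1: "persistent F (W1 i)" for i
    unfolding persistent_def rel W1_def using dist by auto
  have W2: "persistent F (W2 i j)" for i j
    unfolding persistent_def rel W2_def using dist by auto
  \<comment> \<open>All that \<epsilon> 0 and \<epsilon> 1 can learn about i at the point c.\<close>
  define h where "h i = {x \<in> U. forces F (W1 i) c (\<alpha> x)}" for i
  have "\<not> inj_on h {..<N}"
  proof
    assume "inj_on h {..<N}"
    then have "N \<le> card (Pow U)"
      using card_inj_on_le[of h "{..<N}" "Pow U"] by (auto simp: h_def U_def)
    then show False
      by (simp add: N_def card_Pow U_def)
  qed
  then obtain i j where ij: "i < N" "j < N" "i \<noteq> j" "h i = h j"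
    by (auto simp: inj_on_def)
  have my: "\<not> forces F (W1 i) a my"
  proof
    assume "forces F (W1 i) a my"
    then have "(\<forall>k<N. \<not> (P \<and> k = i) \<longrightarrow> W1 i a (Suc k)) \<longrightarrow> W1 i a 0"
      unfolding fmy using ij(1) rel[of a a] by simp
    then show False
      using dist by (auto simp: W1_def)
  qed
  have mx: "\<not> forces F (W2 i j) r mx"
  proof -
    have "\<not> forces F (W2 i j) r (sep i)"
      unfolding sep_def using dist rel[of r a] by (auto simp: fZ W2_def intro!: exI[of _ a])
    moreover have "\<not> forces F (W2 i j) r (sep j)"
      unfolding sep_def using dist rel[of r b] by (auto simp: fZ W2_def intro!: exI[of _ b])
    ultimately show ?thesis using ij unfolding fmx by blast
  qed
  \<comment> \<open>Where all proper successors satisfy every variable, the valuation at the point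
    determines its theory; so C_i at a in \<open>W2 i j\<close> is as good as C_i at c in
    \<open>W1 i\<close>, and likewise for j and b.\<close>
  have same: "forces F (W2 i j) n B \<longleftrightarrow> forces F (W1 k) m B"
    if "(n = a \<and> m = c \<and> k = i) \<or> (n = b \<and> m = c \<and> k = j) \<or> ((n = c \<or> n = t) \<and> m = t)" for n m k B
    unfolding forces_eq_sat
    by (rule sat_bisim[where Z = "\<lambda>n m. (n = a \<and> m = c \<and> k = i) \<or> (n = b \<and> m = c \<and> k = j) \<or> ((n = c \<or> n = t) \<and> m = t)"])
      (use dist that in \<open>auto simp: rel W1_def W2_def\<close>)
  \<comment> \<open>The root of \<open>W2 i j\<close> goes to b, while a, c and t carry
    \<open>W1 i\<close>. The point c then has to serve as C_i and as C_j at once, which the choice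
    of i and j permits.\<close>
  define V where "V n x \<longleftrightarrow> (if n = b then forces F (W2 i j) r (\<alpha> x)
      else n \<noteq> r \<and> forces F (W1 i) n (\<alpha> x))" for n x
  have V: "persistent F V"
    unfolding persistent_def
  proof (intro allI impI)
    fix n m x assume *: "(n, m) \<in> F" "V n x"
    note mono1 = forces_mono[OF is_frameD(2)[OF F] W1[of i] *(1), of "\<alpha> x"]
    note mono2 = forces_mono[OF is_frameD(2)[OF F] W2[of i j], of r _ "\<alpha> x"]
    have "n = r \<or> n = b \<or> (n \<noteq> r \<and> n \<noteq> b \<and> m \<noteq> r \<and> m \<noteq> b)" "n = b \<longrightarrow> m = b \<or> m = c \<or> m = t"
      using *(1) dist unfolding rel by auto
    moreover have "forces F (W2 i j) r (\<alpha> x) \<Longrightarrow> forces F (W1 i) c (\<alpha> x) \<and> forces F (W1 i) t (\<alpha> x)"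
      using mono2[of a] mono2[of t] same[of a c i "\<alpha> x"] same[of t t i "\<alpha> x"] rel by auto
    ultimately show "V m x"
      using *(2) mono1 dist unfolding V_def by (auto split: if_splits)
  qed
  have "forces F V a (\<epsilon> 1) \<longleftrightarrow> forces F (W1 i) a (subst \<alpha> (\<epsilon> 1))"
    by (rule forces_bisim_subst[where Z = "\<lambda>n m. n = m \<and> (n = a \<or> n = c \<or> n = t)"])
      (use dist in \<open>auto simp: rel V_def\<close>)
  then have 1: "\<not> forces F V a (\<epsilon> 1)"
    using \<alpha>[OF W1, of a i 1] my by (simp add: \<mu>_def field)
  have cc: "forces F (W1 i) c (\<alpha> x) \<longleftrightarrow> forces F (W1 j) c (\<alpha> x)" if "x \<in> U" for x
    using ij(4) that by (auto simp: h_def)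
  have "forces F V b (\<epsilon> 0) \<longleftrightarrow> forces F (W2 i j) r (subst \<alpha> (\<epsilon> 0))"
  proof (rule forces_bisim_subst[where Z = "\<lambda>n m. (n = b \<and> m = r) \<or> (n = c \<and> (m = a \<or> m = b)) \<or> (n = t \<and> (m = c \<or> m = t))"],
      goal_cases)
    case (1 n m x)
    then have "x \<in> U" by (simp add: U_def)
    from 1(1) show ?case
      using dist same[of a c i "\<alpha> x"] same[of b c j "\<alpha> x"] same[of m t i "\<alpha> x"] cc[OF \<open>x \<in> U\<close>]
      by (auto simp: V_def)
  qed (use dist in \<open>auto simp: rel\<close>)
  then have 0: "\<not> forces F V b (\<epsilon> 0)"
    using \<alpha>[OF W2, of r i j 0] mx by (simp add: \<mu>_def field)
  have "forces F V r (\<epsilon> 0) \<or> forces F V r (\<epsilon> 1)"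
    using \<epsilon> V by (simp add: unifier_def logic_of_def valid_def field)
  moreover have "(r, a) \<in> F" "(r, b) \<in> F" using rel by auto
  ultimately show False
    using 0 1 forces_mono[OF is_frameD(2)[OF F] V, of r] by blast
qed

text \<open>If L did not omit a frame F, then L(F) would be an extension of L without unitary
  unification.\<close>

theorem hereditary_omits:
  assumes "hereditary_unitary_unification L"
  shows "omits L (add_top (rfork_frame 2))" "omits L (add_top G3_frame)" "omits L (fork_frame 2)"
proof -
  have *: "omits L F" if "is_frame F" "\<not> unitary_unification (logic_of {F})" for F
    using assms intermediate_logic_of[OF that(1)] that(2)
    unfolding hereditary_unitary_unification_def omits_def by blast
  show "omits L (add_top (rfork_frame 2))"
    by (intro * is_frame_add_top is_frame_rfork not_unitary_five_point[OF R2p_iff]) simp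
  show "omits L (add_top G3_frame)"
    by (intro * is_frame_add_top is_frame_G3 not_unitary_five_point[OF G3p_iff]) simp
  show "omits L (fork_frame 2)"
    by (intro * is_frame_fork not_unitary_F2)
qed

section \<open>Projective formulas\<close>

definition const_subst :: "nat set \<Rightarrow> substitution" where
  "const_subst t x = (if x \<in> t then \<^bold>\<top> else \<^bold>\<bottom>)"

text \<open>Here y takes the place of falsum: at a maximal point without y, the implications say
  that the variables in X outside g fail.\<close>

definition val_form :: "nat set \<Rightarrow> nat \<Rightarrow> nat set \<Rightarrow> form" where
  "val_form X y g = conjs (Var ` g \<union> (\<lambda>x. Var x \<^bold>\<longrightarrow> Var y) ` (X - g))"

text \<open>On the points where \<open>y\<close> holds the valuation is \<open>t\<close>, and at the maximal points where
  \<open>y\<close> fails it belongs to \<open>S\<close>.\<close>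

definition proj_form :: "form \<Rightarrow> nat set \<Rightarrow> nat \<Rightarrow> nat set \<Rightarrow> nat set set \<Rightarrow> form" where
  "proj_form A X y t S = (A \<^bold>\<and> (\<^bold>\<not> \<^bold>\<not> Var y \<^bold>\<and>
     ((Var y \<^bold>\<longrightarrow> conjs (Var ` t \<union> (\<lambda>x. \<^bold>\<not> Var x) ` (X - t))) \<^bold>\<and>
      ((disjs (val_form X y ` S) \<^bold>\<longrightarrow> Var y) \<^bold>\<longrightarrow> Var y))))"

definition val :: "nat set \<Rightarrow> substitution \<Rightarrow> form set \<Rightarrow> nat set" where
  "val X \<sigma> v = {x \<in> X. \<sigma> x \<in> v}"

lemma val_mono: "u \<subseteq> v \<Longrightarrow> val X \<sigma> u \<subseteq> val X \<sigma> v"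
  by (auto simp: val_def)

lemma finite_Pow_Pow: "finite X \<Longrightarrow> S \<subseteq> Pow X \<Longrightarrow> finite S"
  by (rule finite_subset[of S "Pow X"]) auto

lemma vars_proj_form:
  assumes "finite X" "vars A \<subseteq> X" "t \<subseteq> X" "S \<subseteq> Pow X"
  shows "vars (proj_form A X y t S) \<subseteq> insert y X"
proof -
  have fin: "finite (Var ` t \<union> (\<lambda>x. \<^bold>\<not> Var x) ` (X - t))" "finite (val_form X y ` S)"
    using assms finite_subset[OF assms(3)] finite_Pow_Pow[OF assms(1,4)] by auto
  have "vars (val_form X y g) \<subseteq> insert y X" if "g \<in> S" for g
  proof -
    have "g \<subseteq> X" using that assms(4) by auto
    then have "finite (Var ` g \<union> (\<lambda>x. Var x \<^bold>\<longrightarrow> Var y) ` (X - g))"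
      using finite_subset assms(1) by auto
    then show ?thesis using \<open>g \<subseteq> X\<close> unfolding val_form_def by (auto simp: vars_conjs)
  qed
  then show ?thesis
    using assms fin by (auto simp: proj_form_def vars_conjs vars_disjs)
qed

section \<open>Extending a substitution downwards, one point at a time\<close>

definition step :: "form \<Rightarrow> nat set \<Rightarrow> substitution \<Rightarrow> nat set \<Rightarrow> substitution" where
  "step B Z \<sigma> a = (\<lambda>z. if z \<in> Z then (if z \<in> a then subst \<sigma> B \<^bold>\<longrightarrow> \<sigma> z else subst \<sigma> B \<^bold>\<and> \<sigma> z) else \<sigma> z)"

text \<open>\<open>step\<close> composes \<sigma> with one of Ghilardi's substitutions, which send z
  to B \<longrightarrow> z for z in a and to B \<and> z for the other z in Z. All subsets a are
  used, as the one needed varies from point to point.\<close>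

definition steps :: "form \<Rightarrow> nat set \<Rightarrow> substitution \<Rightarrow> substitution" where
  "steps B Z \<sigma> = foldl (step B Z) \<sigma> (SOME as. set as = Pow Z)"

context logic
begin

lemma step_keep:
  assumes v: "point L v" and B: "subst \<sigma> B \<in> v"
  shows "step B Z \<sigma> a z \<in> v \<longleftrightarrow> \<sigma> z \<in> v"
proof -
  have "(subst \<sigma> B \<^bold>\<longrightarrow> \<sigma> z) \<in> v \<longleftrightarrow> \<sigma> z \<in> v"
    using mem_mp[OF v, of "subst \<sigma> B" "\<sigma> z"] B theory_K[OF point_theory[OF v]] by metis
  then show ?thesis
    using v B by (simp add: step_def)
qed

lemma step_keep_subst:
  assumes v: "point L v" and B: "subst \<sigma> B \<in> v"
  shows "subst (step B Z \<sigma> a) C \<in> v \<longleftrightarrow> subst \<sigma> C \<in> v"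
proof (rule mem_subst_cong[OF v])
  fix u x assume "point L u" "v \<subseteq> u"
  then show "step B Z \<sigma> a x \<in> u \<longleftrightarrow> \<sigma> x \<in> u"
    using step_keep[of u \<sigma> B] B by auto
qed

text \<open>Suppose that \<sigma> does not unify B at v yet. If \<tau> makes z true at v, then z
  holds at all proper successors, hence the implication holds at v; if not, the conjunction fails at
  v along with B. Above v nothing changes.\<close>

lemma step_ext:
  assumes v: "point L v" and B: "\<And>u. point L u \<Longrightarrow> v \<subset> u \<Longrightarrow> subst \<sigma> B \<in> u" and Z: "vars B \<subseteq> Z"
    and agree: "\<And>u z. point L u \<Longrightarrow> v \<subset> u \<Longrightarrow> z \<in> Z \<Longrightarrow> \<tau> z \<in> u \<longleftrightarrow> \<sigma> z \<in> u"
    and \<tau>: "subst \<tau> B \<in> v"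
  shows "subst (step B Z \<sigma> {z \<in> Z. \<tau> z \<in> v}) B \<in> v"
proof (cases "subst \<sigma> B \<in> v")
  case True
  then show ?thesis using step_keep_subst[OF v True] by simp
next
  case False
  have "step B Z \<sigma> {z \<in> Z. \<tau> z \<in> v} z \<in> u \<longleftrightarrow> \<tau> z \<in> u" if u: "point L u" "v \<subseteq> u" and z: "z \<in> Z" for u z
  proof (cases "u = v")
    case True
    have "(subst \<sigma> B \<^bold>\<longrightarrow> \<sigma> z) \<in> v" if "\<tau> z \<in> v"
      unfolding mem_Imp[OF v]
    proof (intro allI impI)
      fix u' assume u': "point L u'" "v \<subseteq> u'" "subst \<sigma> B \<in> u'"
      then have "v \<subset> u'" using False by auto
      then show "\<sigma> z \<in> u'" using agree[OF u'(1) _ z] that u'(2) by auto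
    qed
    then show ?thesis using True z v False by (simp add: step_def)
  next
    case False
    then have "v \<subset> u" using u(2) by auto
    then show ?thesis
      using step_keep[OF u(1) B[OF u(1)]] agree[OF u(1) _ z] by auto
  qed
  then have "subst (step B Z \<sigma> {z \<in> Z. \<tau> z \<in> v}) B \<in> v \<longleftrightarrow> subst \<tau> B \<in> v"
    by (intro mem_subst_cong[OF v]) (use Z in auto)
  with \<tau> show ?thesis by simp
qed

lemma foldl_keep:
  assumes v: "point L v" and B: "subst \<sigma> B \<in> v"
  shows "subst (foldl (step B Z) \<sigma> as) B \<in> v \<and> (\<forall>z. foldl (step B Z) \<sigma> as z \<in> v \<longleftrightarrow> \<sigma> z \<in> v)"
  using B
proof (induction as arbitrary: \<sigma>)
  case (Cons a as)
  then show ?case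
    using step_keep[OF v Cons.prems] step_keep_subst[OF v Cons.prems] by simp
qed simp

lemma steps_keep:
  assumes "point L v" "subst \<sigma> B \<in> v"
  shows "subst (steps B Z \<sigma>) B \<in> v" "steps B Z \<sigma> z \<in> v \<longleftrightarrow> \<sigma> z \<in> v"
  using foldl_keep[OF assms] by (auto simp: steps_def)

text \<open>The right set is among those tried. By \<open>foldl_keep\<close> the steps before it
  keep the values above v, and those after it keep B at v.\<close>

lemma steps_ext:
  assumes v: "point L v" and B: "\<And>u. point L u \<Longrightarrow> v \<subset> u \<Longrightarrow> subst \<sigma> B \<in> u"
    and Z: "vars B \<subseteq> Z" "finite Z"
    and agree: "\<And>u z. point L u \<Longrightarrow> v \<subset> u \<Longrightarrow> z \<in> Z \<Longrightarrow> \<tau> z \<in> u \<longleftrightarrow> \<sigma> z \<in> u"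
    and \<tau>: "subst \<tau> B \<in> v"
  shows "subst (steps B Z \<sigma>) B \<in> v"
proof -
  let ?as = "SOME as. set as = Pow Z" and ?a = "{z \<in> Z. \<tau> z \<in> v}"
  have "set ?as = Pow Z"
    by (rule someI_ex) (use Z(2) in \<open>auto intro: finite_list\<close>)
  then have "?a \<in> set ?as" by auto
  then obtain xs ys where as: "?as = xs @ ?a # ys"
    by (meson split_list)
  let ?\<sigma> = "foldl (step B Z) \<sigma> xs"
  have "subst (step B Z ?\<sigma> ?a) B \<in> v"
  proof (rule step_ext[OF v _ Z(1) _ \<tau>])
    fix u assume u: "point L u" "v \<subset> u"
    then show "subst ?\<sigma> B \<in> u" using foldl_keep[OF u(1) B[OF u]] by simp
    fix z assume "z \<in> Z"
    then show "\<tau> z \<in> u \<longleftrightarrow> ?\<sigma> z \<in> u" using foldl_keep[OF u(1) B[OF u], of Z xs] agree[OF u, of z] by simp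
  qed
  from foldl_keep[OF v this, of Z ys] show ?thesis
    by (simp add: steps_def as)
qed

lemma Iff_L: "(\<And>w. point L w \<Longrightarrow> A \<in> w \<longleftrightarrow> B \<in> w) \<Longrightarrow> (A \<^bold>\<longleftrightarrow> B) \<in> L"
  unfolding L_iff_points by (simp add: mem_Imp)

lemma mem_Iff: "point L w \<Longrightarrow> (A \<^bold>\<longleftrightarrow> B) \<in> w \<Longrightarrow> A \<in> w \<longleftrightarrow> B \<in> w"
  using mem_mp[of w A B] mem_mp[of w B A] mem_Conj[of w "A \<^bold>\<longrightarrow> B" "B \<^bold>\<longrightarrow> A"] by iprover

end

section \<open>Prescriptions, and the extension property at points below an antichain\<close>

context un_logic
begin

text \<open>The last conjunct of the formula is the subtle one: every point without y lies below a
  maximal such point, and there a disjunct \<open>val_form X y g\<close> holds only if g is the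
  actual valuation. So it constrains the maximal points without y and no others.\<close>

lemma mem_proj_form:
  assumes X: "finite X" "t \<subseteq> X" "S \<subseteq> Pow X" and v: "point L v"
  shows "subst \<sigma> (proj_form A X y t S) \<in> v \<longleftrightarrow> subst \<sigma> A \<in> v \<and> \<sigma> y \<in> tp v \<and>
    (\<forall>u. point L u \<longrightarrow> v \<subseteq> u \<longrightarrow> \<sigma> y \<in> u \<longrightarrow> val X \<sigma> u = t) \<and>
    (\<forall>u. point L u \<longrightarrow> v \<subseteq> u \<longrightarrow> \<sigma> y \<notin> u \<longrightarrow> (\<forall>u'. point L u' \<longrightarrow> u \<subset> u' \<longrightarrow> \<sigma> y \<in> u') \<longrightarrow> val X \<sigma> u \<in> S)"
proof -
  have fin: "finite (Var ` t \<union> (\<lambda>x. \<^bold>\<not> Var x) ` (X - t))" "finite S"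
    using X finite_subset[OF X(2)] finite_Pow_Pow[OF X(1,3)] by auto
  let ?D = "subst \<sigma> (conjs (Var ` t \<union> (\<lambda>x. \<^bold>\<not> Var x) ` (X - t)))"
  let ?s = "subst \<sigma> (disjs (val_form X y ` S))"
  have D: "?D \<in> u \<longleftrightarrow> (\<forall>x\<in>t. \<sigma> x \<in> u) \<and> (\<forall>x\<in>X - t. (\<^bold>\<not> \<sigma> x) \<in> u)" if "point L u" for u
    using that fin(1) by (auto simp: ball_Un)
  have y: "(\<sigma> y \<^bold>\<longrightarrow> ?D) \<in> v \<longleftrightarrow> (\<forall>u. point L u \<longrightarrow> v \<subseteq> u \<longrightarrow> \<sigma> y \<in> u \<longrightarrow> val X \<sigma> u = t)"
  proof
    assume *: "(\<sigma> y \<^bold>\<longrightarrow> ?D) \<in> v"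
    show "\<forall>u. point L u \<longrightarrow> v \<subseteq> u \<longrightarrow> \<sigma> y \<in> u \<longrightarrow> val X \<sigma> u = t"
    proof (intro allI impI)
      fix u assume u: "point L u" "v \<subseteq> u" "\<sigma> y \<in> u"
      then have "?D \<in> u" using * mem_mp[OF u(1), of "\<sigma> y" ?D] by auto
      then have "\<forall>x\<in>t. \<sigma> x \<in> u" "\<forall>x\<in>X - t. \<sigma> x \<notin> u"
        unfolding D[OF u(1)] mem_Neg[OF u(1)] using u(1) by auto
      then show "val X \<sigma> u = t" using X(2) by (auto simp: val_def)
    qed
  next
    assume *: "\<forall>u. point L u \<longrightarrow> v \<subseteq> u \<longrightarrow> \<sigma> y \<in> u \<longrightarrow> val X \<sigma> u = t"
    show "(\<sigma> y \<^bold>\<longrightarrow> ?D) \<in> v"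
      unfolding mem_Imp[OF v]
    proof (intro allI impI)
      fix u assume u: "point L u" "v \<subseteq> u" "\<sigma> y \<in> u"
      then have "val X \<sigma> u' = t" if "point L u'" "u \<subseteq> u'" for u'
        using * that by auto
      then have "x \<in> t \<longleftrightarrow> \<sigma> x \<in> u'" if "point L u'" "u \<subseteq> u'" "x \<in> X" for u' x
        using that by (auto simp: val_def)
      then show "?D \<in> u"
        unfolding D[OF u(1)] mem_Neg[OF u(1)] using u(1) X(2) by auto
    qed
  qed
  have g: "subst \<sigma> (val_form X y g) \<in> u \<longleftrightarrow> (\<forall>x\<in>g. \<sigma> x \<in> u) \<and> (\<forall>x\<in>X - g. (\<sigma> x \<^bold>\<longrightarrow> \<sigma> y) \<in> u)"
    if "point L u" "g \<in> S" for u g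
  proof -
    have "finite g" by (rule finite_subset[OF _ X(1)]) (use that(2) X(3) in auto)
    then show ?thesis
      using that(1) X(1) unfolding val_form_def by (auto simp: ball_Un)
  qed
  have s: "?s \<in> u \<longleftrightarrow> (\<exists>g\<in>S. subst \<sigma> (val_form X y g) \<in> u)" if "point L u" for u
    using that fin(2) by simp
  have "((?s \<^bold>\<longrightarrow> \<sigma> y) \<^bold>\<longrightarrow> \<sigma> y) \<in> v \<longleftrightarrow> (\<forall>u. point L u \<longrightarrow> v \<subseteq> u \<longrightarrow> \<sigma> y \<notin> u \<longrightarrow>
      (\<forall>u'. point L u' \<longrightarrow> u \<subset> u' \<longrightarrow> \<sigma> y \<in> u') \<longrightarrow> val X \<sigma> u \<in> S)"
  proof
    assume *: "((?s \<^bold>\<longrightarrow> \<sigma> y) \<^bold>\<longrightarrow> \<sigma> y) \<in> v"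
    show "\<forall>u. point L u \<longrightarrow> v \<subseteq> u \<longrightarrow> \<sigma> y \<notin> u \<longrightarrow>
      (\<forall>u'. point L u' \<longrightarrow> u \<subset> u' \<longrightarrow> \<sigma> y \<in> u') \<longrightarrow> val X \<sigma> u \<in> S"
    proof (intro allI impI)
      fix u assume u: "point L u" "v \<subseteq> u" "\<sigma> y \<notin> u" "\<forall>u'. point L u' \<longrightarrow> u \<subset> u' \<longrightarrow> \<sigma> y \<in> u'"
      then have "(?s \<^bold>\<longrightarrow> \<sigma> y) \<notin> u"
        using * mem_mp[OF u(1), of "?s \<^bold>\<longrightarrow> \<sigma> y" "\<sigma> y"] by auto
      then obtain u' where u': "point L u'" "u \<subseteq> u'" "?s \<in> u'" "\<sigma> y \<notin> u'"
        using Imp_notin[OF u(1)] by metis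
      then have "u' = u" using u(4) by auto
      then obtain g where g': "g \<in> S" "subst \<sigma> (val_form X y g) \<in> u" using u'(3) s[OF u(1)] by auto
      have "\<sigma> x \<notin> u" if "x \<in> X - g" for x
        using g'(2) that mem_mp[OF u(1), of "\<sigma> x" "\<sigma> y"] u(3) unfolding g[OF u(1) g'(1)] by auto
      then have "val X \<sigma> u = g"
        using g' X(3) unfolding g[OF u(1) g'(1)] by (auto simp: val_def)
      with g' show "val X \<sigma> u \<in> S" by simp
    qed
  next
    assume *: "\<forall>u. point L u \<longrightarrow> v \<subseteq> u \<longrightarrow> \<sigma> y \<notin> u \<longrightarrow>
      (\<forall>u'. point L u' \<longrightarrow> u \<subset> u' \<longrightarrow> \<sigma> y \<in> u') \<longrightarrow> val X \<sigma> u \<in> S"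
    show "((?s \<^bold>\<longrightarrow> \<sigma> y) \<^bold>\<longrightarrow> \<sigma> y) \<in> v"
      unfolding mem_Imp[OF v, of "?s \<^bold>\<longrightarrow> \<sigma> y" "\<sigma> y"]
    proof (intro allI impI, rule ccontr)
      fix u assume u: "point L u" "v \<subseteq> u" "(?s \<^bold>\<longrightarrow> \<sigma> y) \<in> u" "\<sigma> y \<notin> u"
      obtain u' where u': "point L u'" "u \<subseteq> u'" "\<sigma> y \<notin> u'" "\<And>u''. point L u'' \<Longrightarrow> u' \<subset> u'' \<Longrightarrow> \<sigma> y \<in> u''"
        using point_maximal[OF u(1,4)] by metis
      then have S: "val X \<sigma> u' \<in> S" using * u(2) by auto
      have "(\<sigma> x \<^bold>\<longrightarrow> \<sigma> y) \<in> u'" if "x \<in> X - val X \<sigma> u'" for x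
        unfolding mem_Imp[OF u'(1)]
      proof (intro allI impI)
        fix u'' assume "point L u''" "u' \<subseteq> u''" "\<sigma> x \<in> u''"
        moreover from this have "u' \<subset> u''" using that by (auto simp: val_def)
        ultimately show "\<sigma> y \<in> u''" using u'(4) by simp
      qed
      then have "subst \<sigma> (val_form X y (val X \<sigma> u')) \<in> u'"
        unfolding g[OF u'(1) S] by (auto simp: val_def)
      then have "?s \<in> u'" using s[OF u'(1)] S by auto
      then have "\<sigma> y \<in> u'" using mem_mp[OF u'(1), of ?s "\<sigma> y"] u(3) u'(2) by auto
      with u'(3) show False ..
    qed
  qed
  with y show ?thesis
    using v unfolding proj_form_def by (simp add: tp_def)
qed

text \<open>All proper successors are coatoms or the top. Only such a point can have incomparable
  points immediately above it.\<close>

definition hub :: "form set \<Rightarrow> bool" where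
  "hub w \<longleftrightarrow> point L w \<and> (\<forall>u u'. point L u \<longrightarrow> w \<subset> u \<longrightarrow> point L u' \<longrightarrow> u \<subset> u' \<longrightarrow> u' = tp w)"

text \<open>The extension property at hubs: whatever values from S occur above a hub whose top has
  value t, some value at the hub itself makes A true. The constant unifier is for hubs above which y
  holds throughout.\<close>

definition good :: "form \<Rightarrow> nat set \<Rightarrow> nat set \<Rightarrow> nat set set \<Rightarrow> bool" where
  "good A X t S \<longleftrightarrow> t \<subseteq> X \<and> S \<subseteq> Pow X \<and> subst (const_subst t) A \<in> L \<and>
     (\<forall>w \<sigma>. hub w \<longrightarrow> val X \<sigma> (tp w) = t \<longrightarrow>
        (\<forall>u. point L u \<longrightarrow> w \<subset> u \<longrightarrow> val X \<sigma> u \<in> insert t S) \<longrightarrow>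
        (\<exists>\<tau>. (\<forall>u. point L u \<longrightarrow> w \<subset> u \<longrightarrow> (\<forall>x\<in>X. \<tau> x \<in> u \<longleftrightarrow> \<sigma> x \<in> u)) \<and> subst \<tau> A \<in> w))"

lemma hub_extension:
  assumes X: "finite X" "vars A \<subseteq> X" "y \<notin> X" and good: "good A X t S" and w: "hub w"
    and B: "\<And>u. point L u \<Longrightarrow> w \<subset> u \<Longrightarrow> subst \<sigma> (proj_form A X y t S) \<in> u"
  shows "\<exists>\<tau>. (\<forall>u z. point L u \<longrightarrow> w \<subset> u \<longrightarrow> z \<in> insert y X \<longrightarrow> (\<tau> z \<in> u \<longleftrightarrow> \<sigma> z \<in> u)) \<and>
    subst \<tau> (proj_form A X y t S) \<in> w"
proof -
  have tS: "t \<subseteq> X" "S \<subseteq> Pow X" "subst (const_subst t) A \<in> L"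
    using good by (auto simp: good_def)
  have pw: "point L w" using w by (simp add: hub_def)
  note mem = mem_proj_form[OF X(1) tS(1,2)]
  have Bu: "\<sigma> y \<in> tp u" "\<sigma> y \<in> u \<Longrightarrow> val X \<sigma> u = t"
    "\<sigma> y \<notin> u \<Longrightarrow> (\<forall>u'. point L u' \<longrightarrow> u \<subset> u' \<longrightarrow> \<sigma> y \<in> u') \<Longrightarrow> val X \<sigma> u \<in> S"
    if u: "point L u" "w \<subset> u" for u
    using B[OF u] u(1) unfolding mem[OF u(1)] by simp_all
  show ?thesis
  proof (cases "\<forall>u. point L u \<longrightarrow> w \<subset> u \<longrightarrow> \<sigma> y \<in> u")
    case True
    \<comment> \<open>All proper successors have the value t and satisfy y, so the hub can be given
      the same.\<close>
    let ?\<tau> = "const_subst (insert y t)"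
    have c: "?\<tau> x \<in> u \<longleftrightarrow> x \<in> insert y t" if "point L u" for x u
      using that by (simp add: const_subst_def)
    have vc: "val X ?\<tau> u = t" if "point L u" for u
      using c[OF that] tS(1) X(3) by (auto simp: val_def)
    have "subst ?\<tau> A = subst (const_subst t) A"
      by (rule subst_cong_vars) (use X in \<open>auto simp: const_subst_def\<close>)
    then have "subst ?\<tau> A \<in> w"
      using L_point[OF tS(3) pw] by simp
    then have "subst ?\<tau> (proj_form A X y t S) \<in> w"
      unfolding mem[OF pw] using c vc point_tp[OF pw] by auto
    moreover have "?\<tau> z \<in> u \<longleftrightarrow> \<sigma> z \<in> u" if u: "point L u" "w \<subset> u" and z: "z \<in> insert y X" for u z
    proof -
      have "\<sigma> y \<in> u" using True u by simp
      moreover have "x \<in> t \<longleftrightarrow> \<sigma> x \<in> u" if "x \<in> X" for x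
        using Bu(2)[OF u \<open>\<sigma> y \<in> u\<close>] that by (auto simp: val_def)
      ultimately show ?thesis using c[OF u(1)] z X(3) by auto
    qed
    ultimately show ?thesis by blast
  next
    case False
    then obtain u0 where u0: "point L u0" "w \<subset> u0" "\<sigma> y \<notin> u0" by auto
    have tpu: "tp u = tp w" if "point L u" "w \<subset> u" for u
      using tp_mono[OF that(1) pw] that(2) by auto
    have ytp: "\<sigma> y \<in> tp w"
      using Bu(1)[OF u0(1,2)] tpu[OF u0(1,2)] by simp
    have "w \<subset> tp w"
      using subset_tp[OF u0(1) _ pw] u0(2) by auto
    then have vtp: "val X \<sigma> (tp w) = t"
      using Bu(2)[OF point_tp[OF pw]] ytp by simp
    have vS: "val X \<sigma> u \<in> S" if u: "point L u" "w \<subset> u" "\<sigma> y \<notin> u" for u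
    proof (rule Bu(3)[OF u], intro allI impI)
      fix u' assume "point L u'" "u \<subset> u'"
      then have "u' = tp w" using w u by (auto simp: hub_def)
      then show "\<sigma> y \<in> u'" using ytp by simp
    qed
    have "val X \<sigma> u \<in> insert t S" if "point L u" "w \<subset> u" for u
      using vS[OF that] Bu(2)[OF that] by auto
    then obtain \<tau> where \<tau>: "\<And>u x. point L u \<Longrightarrow> w \<subset> u \<Longrightarrow> x \<in> X \<Longrightarrow> \<tau> x \<in> u \<longleftrightarrow> \<sigma> x \<in> u" "subst \<tau> A \<in> w"
      using good w vtp unfolding good_def by metis
    \<comment> \<open>y stays as it is. It fails at w because it fails at u0, and for the same
      reason w is no maximal point without y, so that the prescription demands nothing of its
      valuation.\<close>
    let ?\<tau> = "\<tau>(y := \<sigma> y)"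
    have "subst ?\<tau> A = subst \<tau> A"
      by (rule subst_cong_vars) (use X in auto)
    have vv: "val X ?\<tau> u = val X \<sigma> u" if "point L u" "w \<subset> u" for u
      using \<tau>(1)[OF that] X(3) by (auto simp: val_def)
    have "subst ?\<tau> (proj_form A X y t S) \<in> w"
      unfolding mem[OF pw]
    proof (intro conjI allI impI)
      show "subst ?\<tau> A \<in> w" using \<open>subst ?\<tau> A = subst \<tau> A\<close> \<tau>(2) by simp
      show "?\<tau> y \<in> tp w" using ytp by simp
    next
      fix u assume u: "point L u" "w \<subseteq> u" "?\<tau> y \<in> u"
      then have "w \<subset> u" using u0 by auto
      then show "val X ?\<tau> u = t" using vv[OF u(1)] Bu(2)[OF u(1)] u(3) by simp
    next
      fix u assume u: "point L u" "w \<subseteq> u" "?\<tau> y \<notin> u" "\<forall>u'. point L u' \<longrightarrow> u \<subset> u' \<longrightarrow> ?\<tau> y \<in> u'"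
      then have "w \<subset> u" using u0 by auto
      then show "val X ?\<tau> u \<in> S" using vv[OF u(1)] vS[OF u(1)] u(3) by simp
    qed
    moreover have "?\<tau> z \<in> u \<longleftrightarrow> \<sigma> z \<in> u" if "point L u" "w \<subset> u" "z \<in> insert y X" for u z
      using \<tau>(1)[OF that(1,2)] that(3) by auto
    ultimately show ?thesis by blast
  qed
qed

text \<open>The points at which \<open>\<sigma>\<close> does not yet unify \<open>B\<close> lie below all the others, so they may
  copy a point of least value among the others.\<close>

lemma collapse:
  assumes Z: "finite Z" "vars B \<subseteq> Z" and w: "point L w"
    and hubs: "\<And>v. hub v \<Longrightarrow> subst \<sigma> B \<in> v"
  shows "subst (step B Z \<sigma> Z) B \<in> w"
proof (cases "subst \<sigma> B \<in> w")
  case True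
  then show ?thesis using step_keep_subst[OF w] by simp
next
  case False
  let ?P = "{v. point L v \<and> w \<subseteq> v \<and> subst \<sigma> B \<in> v}"
  let ?\<tau> = "step B Z \<sigma> Z"
  \<comment> \<open>By \<open>comparable\<close> these points form a chain, and by
    \<open>below_coatom\<close> they lie below all coatoms of the cone.\<close>
  define trunk where "trunk v \<longleftrightarrow> point L v \<and> w \<subseteq> v \<and> \<not> coatom v \<and> v \<noteq> tp w" for v
  have hub_top: "hub (tp w)"
    using tp_subset[OF _ w] point_tp[OF w] by (auto simp: hub_def)
  have hub_coatom: "hub v" if "coatom v" for v
    unfolding hub_def
  proof (intro conjI allI impI)
    show "point L v" using that by (simp add: coatom_def)
    fix u u' assume u: "point L u" "v \<subset> u" "point L u'" "u \<subset> u'"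
    then show "u' = tp v" using that unfolding coatom_def by (meson less_trans)
  qed
  have not_P: "trunk v" if "point L v" "w \<subseteq> v" "v \<notin> ?P" for v
    using that hubs[OF hub_top] hubs[OF hub_coatom, of v] by (auto simp: trunk_def)
  have trunk_cmp: "u \<subseteq> v \<or> v \<subseteq> u" if "trunk v" "point L u" "w \<subseteq> u" for u v
    using comparable[OF w, of v u] that by (auto simp: trunk_def)
  have below: "v \<subseteq> p" if "point L v" "w \<subseteq> v" "v \<notin> ?P" "p \<in> ?P" for v p
    using trunk_cmp[OF not_P[OF that(1-3)], of p] that by auto
  define cmp where "cmp p \<longleftrightarrow> (\<forall>v. point L v \<longrightarrow> w \<subseteq> v \<longrightarrow> v \<subseteq> p \<or> p \<subseteq> v)" for p
  \<comment> \<open>A point incomparable with another one is a coatom. Then the union of the trunk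
    is itself a last trunk point, whose existence is not obvious for an infinite chain; it is a hub,
    so \<sigma> unifies B there.\<close>
  have lower: "\<exists>p'\<in>?P. p' \<subseteq> p \<and> cmp p'" if p: "p \<in> ?P" for p
  proof (cases "cmp p")
    case True
    then show ?thesis using p by auto
  next
    case False
    then obtain u where u: "point L u" "w \<subseteq> u" "\<not> u \<subseteq> p" "\<not> p \<subseteq> u" by (auto simp: cmp_def)
    have co: "coatom p" "coatom u"
      using comparable[OF w, of p u] comparable[OF w, of u p] u p by auto
    have wt: "trunk w"
      using not_P[OF w] \<open>subst \<sigma> B \<notin> w\<close> by auto
    let ?r = "\<Union>(Collect trunk)"
    have r: "point L ?r"
    proof (rule point_Union)
      show "Collect trunk \<noteq> {}" using wt by auto
      show "point L v" if "v \<in> Collect trunk" for v using that by (simp add: trunk_def)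
      show "u \<subseteq> v \<or> v \<subseteq> u" if "u \<in> Collect trunk" "v \<in> Collect trunk" for u v
        using trunk_cmp[of v u] that by (auto simp: trunk_def)
    qed
    have wr: "w \<subseteq> ?r" using wt by auto
    have rp: "?r \<subseteq> p" "?r \<subseteq> u"
    proof -
      have "v \<subseteq> p" "v \<subseteq> u" if "trunk v" for v
        using below_coatom[OF w _ _ _ _ co(1), of v] below_coatom[OF w _ _ _ _ co(2), of v] p u(2) that
        by (simp_all add: trunk_def)
      then show "?r \<subseteq> p" "?r \<subseteq> u" by auto
    qed
    have tps: "tp p = tp w" "tp ?r = tp w"
      using tp_mono[OF _ w] p r wr by auto
    have "?r \<noteq> tp w"
      using tp_subset[OF _ w, of p] rp(1) p co(1) tps(1) by (auto simp: coatom_def)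
    moreover have "\<not> coatom ?r"
    proof
      assume "coatom ?r"
      moreover have "?r \<subset> p" using rp u(4) by auto
      ultimately have "p = tp w" using p tps(2) by (auto simp: coatom_def)
      then show False using co(1) tps(1) by (simp add: coatom_def)
    qed
    ultimately have tr: "trunk ?r" using r wr by (simp add: trunk_def)
    have "hub ?r"
      unfolding hub_def
    proof (intro conjI allI impI)
      fix v v' assume v: "point L v" "?r \<subset> v" "point L v'" "v \<subset> v'"
      have "\<not> trunk v" using v(2) by auto
      then have "coatom v \<or> v = tp w" using v wr by (auto simp: trunk_def)
      moreover have "tp v = tp w" using tp_mono[OF v(1) w] v(2) wr by auto
      ultimately have "v' = tp w"
        using v tp_subset[OF v(3) w] by (auto simp: coatom_def)
      then show "v' = tp ?r" using tps(2) by simp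
    qed (rule r)
    then have "?r \<in> ?P" by (intro CollectI conjI r wr hubs)
    moreover have "cmp ?r" using trunk_cmp[OF tr] by (auto simp: cmp_def)
    ultimately show ?thesis using rp(1) by blast
  qed
  have "tp w \<in> ?P" using hubs[OF hub_top] point_tp[OF w] subset_tp_self[OF w] by simp
  then obtain q where "q \<in> ?P \<and> cmp q" using lower by blast
  \<comment> \<open>Values are finite sets, so one of least size exists although \<open>?P\<close>
    may have no least point.\<close>
  then obtain p0 where p0: "p0 \<in> ?P \<and> cmp p0"
    and min: "\<And>p. p \<in> ?P \<and> cmp p \<Longrightarrow> card (val Z \<sigma> p0) \<le> card (val Z \<sigma> p)"
    using exists_least_iff[of "\<lambda>n. \<exists>p. (p \<in> ?P \<and> cmp p) \<and> n = card (val Z \<sigma> p)"]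
    by (metis (no_types, lifting) not_less)
  have fin: "finite (val Z \<sigma> p)" for p using Z(1) by (auto simp: val_def)
  have least: "val Z \<sigma> p0 \<subseteq> val Z \<sigma> p" if p: "p \<in> ?P" for p
  proof -
    obtain p' where p': "p' \<in> ?P" "p' \<subseteq> p" "cmp p'" using lower[OF p] by auto
    have "val Z \<sigma> p0 \<subseteq> val Z \<sigma> p'"
    proof (cases "p0 \<subseteq> p'")
      case True
      then show ?thesis by (rule val_mono)
    next
      case False
      then have "p' \<subseteq> p0" using p0 p' by (auto simp: cmp_def)
      then have "val Z \<sigma> p' = val Z \<sigma> p0"
        using card_seteq[OF fin val_mono] min[of p'] p' by auto
      then show ?thesis by simp
    qed
    then show ?thesis using val_mono[OF p'(2), of Z \<sigma>] by auto
  qed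
  \<comment> \<open>With all of Z in the set of the step, a point at which \<sigma> does not unify B
    receives the variables common to all points of \<open>?P\<close> above it, that is, the value of
    p0. It can therefore be identified with p0.\<close>
  have "subst ?\<tau> B \<in> w \<longleftrightarrow> subst \<sigma> B \<in> p0"
  proof (rule mem_bisim[where Z = "\<lambda>a b. (b = p0 \<and> point L a \<and> w \<subseteq> a \<and> (a \<notin> ?P \<or> a \<subseteq> p0)) \<or> (a = b \<and> a \<in> ?P)"],
      goal_cases)
    case (1 a b)
    then show ?case using p0 by auto
  next
    case (2 a b x)
    then have x: "x \<in> Z" using Z by auto
    show ?case
    proof (cases "a \<in> ?P")
      case True
      then have ax: "?\<tau> x \<in> a \<longleftrightarrow> \<sigma> x \<in> a" using step_keep[of a] by simp
      show ?thesis
      proof (cases "a = b")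
        case False
        then have "b = p0" "a \<subseteq> p0" using 2(1) True by auto
        then show ?thesis using ax least[OF True] x by (auto simp: val_def)
      qed (use ax in simp)
    next
      case False
      then have b: "b = p0" and a: "point L a" "w \<subseteq> a" using 2(1) by auto
      have "(subst \<sigma> B \<^bold>\<longrightarrow> \<sigma> x) \<in> a \<longleftrightarrow> \<sigma> x \<in> p0"
      proof
        assume *: "(subst \<sigma> B \<^bold>\<longrightarrow> \<sigma> x) \<in> a"
        have "a \<subseteq> p0" using below[OF a False] p0 by simp
        then show "\<sigma> x \<in> p0"
          using * mem_mp[of p0 "subst \<sigma> B" "\<sigma> x"] p0 by auto
      next
        assume *: "\<sigma> x \<in> p0"
        show "(subst \<sigma> B \<^bold>\<longrightarrow> \<sigma> x) \<in> a"
          unfolding mem_Imp[OF a(1)]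
        proof (intro allI impI)
          fix p assume "point L p" "a \<subseteq> p" "subst \<sigma> B \<in> p"
          then have "p \<in> ?P" using a by auto
          from least[OF this] show "\<sigma> x \<in> p" using * x by (auto simp: val_def)
        qed
      qed
      then show ?thesis using x b by (simp add: step_def)
    qed
  next
    case (3 a b a')
    show ?case
    proof (cases "a = b \<and> a \<in> ?P")
      case True
      then show ?thesis using 3 by auto
    next
      case False
      then have b: "b = p0" "w \<subseteq> a'" using 3 by auto
      show ?thesis
      proof (cases "a' \<notin> ?P \<or> a' \<subseteq> p0")
        case True
        then show ?thesis using b 3(2) by auto
      next
        case False
        then have "p0 \<subseteq> a'" using p0 3(2) b(2) by (auto simp: cmp_def)
        then show ?thesis using False b by auto
      qed
    qed
  next
    case (4 a b b')
    show ?case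
    proof (cases "a = b \<and> a \<in> ?P")
      case True
      then show ?thesis using 4 by auto
    next
      case False
      then have b: "b = p0" and a: "point L a" "w \<subseteq> a" "a \<notin> ?P \<or> a \<subseteq> p0" using 4 by auto
      have "a \<subseteq> p0" using a below[OF a(1,2)] p0 by auto
      moreover have "b' \<in> ?P" using p0 4(2,3) b by auto
      ultimately show ?thesis using 4(3) b by auto
    qed
  next
    case 5
    then show ?case using w \<open>subst \<sigma> B \<notin> w\<close> by auto
  qed
  then show ?thesis using p0 by simp
qed

text \<open>A round of \<open>steps\<close> needs B at all proper successors, so three rounds settle
  the top, the coatoms and the hubs in turn; the last step reaches the remaining points by
  \<open>collapse\<close>. Points at which B holds are never altered, whence the unifier is the
  identity modulo B.\<close>

theorem good_projective:
  assumes X: "finite X" "vars A \<subseteq> X" "y \<notin> X" and good: "good A X t S"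
  defines "B \<equiv> proj_form A X y t S"
  shows "\<exists>\<sigma>. subst \<sigma> B \<in> L \<and> (\<forall>z. (B \<^bold>\<longrightarrow> (\<sigma> z \<^bold>\<longleftrightarrow> Var z)) \<in> L)"
proof -
  let ?Z = "insert y X"
  define \<sigma>1 where "\<sigma>1 = steps B ?Z Var"
  define \<sigma>2 where "\<sigma>2 = steps B ?Z \<sigma>1"
  define \<sigma>3 where "\<sigma>3 = steps B ?Z \<sigma>2"
  define \<sigma>4 where "\<sigma>4 = step B ?Z \<sigma>3 ?Z"
  have Z: "finite ?Z" "vars B \<subseteq> ?Z"
    using X vars_proj_form[OF X(1,2)] good by (auto simp: B_def good_def)
  have step: "subst (steps B ?Z \<sigma>) B \<in> w"
    if w: "hub w" and above: "\<And>u. point L u \<Longrightarrow> w \<subset> u \<Longrightarrow> subst \<sigma> B \<in> u" for \<sigma> w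
  proof -
    obtain \<tau> where \<tau>: "\<forall>u z. point L u \<longrightarrow> w \<subset> u \<longrightarrow> z \<in> ?Z \<longrightarrow> (\<tau> z \<in> u \<longleftrightarrow> \<sigma> z \<in> u)" "subst \<tau> B \<in> w"
      using hub_extension[OF X good w, of \<sigma>] above unfolding B_def by metis
    show ?thesis
      by (rule steps_ext[OF _ above Z(2,1) _ \<tau>(2)]) (use w \<tau>(1) in \<open>auto simp: hub_def\<close>)
  qed
  have hub_tp: "hub (tp w)" if "point L w" for w
    using tp_subset[OF _ that] point_tp[OF that] by (auto simp: hub_def)
  have 1: "subst \<sigma>1 B \<in> tp w" if "point L w" for w
    unfolding \<sigma>1_def
  proof (rule step[OF hub_tp[OF that]])
    fix u assume "point L u" "tp w \<subset> u"
    then show "subst Var B \<in> u" using tp_subset[OF _ that, of u] by auto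
  qed
  have 2: "subst \<sigma>2 B \<in> u" if u: "point L u" "\<And>u'. point L u' \<Longrightarrow> u \<subset> u' \<Longrightarrow> u' = tp u" for u
    unfolding \<sigma>2_def
  proof (rule step)
    show "hub u"
      unfolding hub_def using u by (meson less_trans)
    fix u' assume "point L u'" "u \<subset> u'"
    then show "subst \<sigma>1 B \<in> u'" using u(2) 1[OF u(1)] by simp
  qed
  have 3: "subst \<sigma>3 B \<in> w" if w: "hub w" for w
    unfolding \<sigma>3_def
  proof (rule step[OF w])
    fix u assume u: "point L u" "w \<subset> u"
    have "tp u = tp w" using tp_mono[OF u(1)] w u(2) by (auto simp: hub_def)
    then show "subst \<sigma>2 B \<in> u"
      by (intro 2) (use u w in \<open>auto simp: hub_def\<close>)
  qed
  have "subst \<sigma>4 B \<in> w" if "point L w" for w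
    unfolding \<sigma>4_def by (rule collapse[OF Z that 3])
  then have "subst \<sigma>4 B \<in> L"
    by (simp add: L_iff_points)
  moreover have "(B \<^bold>\<longrightarrow> (\<sigma>4 z \<^bold>\<longleftrightarrow> Var z)) \<in> L" for z
  proof -
    have iff: "\<sigma>4 z \<in> v \<longleftrightarrow> Var z \<in> v" if v: "point L v" "B \<in> v" for v
    proof -
      have 0: "subst Var B \<in> v" using v by simp
      note k1 = steps_keep[OF v(1) 0, of ?Z, folded \<sigma>1_def]
      note k2 = steps_keep[OF v(1) k1(1), of ?Z, folded \<sigma>2_def]
      note k3 = steps_keep[OF v(1) k2(1), of ?Z, folded \<sigma>3_def]
      show ?thesis
        using step_keep[OF v(1) k3(1), of ?Z ?Z z, folded \<sigma>4_def] k1(2)[of z] k2(2)[of z] k3(2)[of z] by iprover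
    qed
    have "(\<sigma>4 z \<^bold>\<longleftrightarrow> Var z) \<in> v" if v: "point L v" "B \<in> v" for v
    proof -
      have "(\<sigma>4 z \<^bold>\<longrightarrow> Var z) \<in> v" "(Var z \<^bold>\<longrightarrow> \<sigma>4 z) \<in> v"
        unfolding mem_Imp[OF v(1)] using iff v(2) by auto
      then show ?thesis using v(1) by simp
    qed
    then show ?thesis
      unfolding L_iff_points[of "B \<^bold>\<longrightarrow> _"] using mem_Imp[of _ B "\<sigma>4 z \<^bold>\<longleftrightarrow> Var z"] by metis
  qed
  ultimately show ?thesis by blast
qed

section \<open>Every unifier is covered by good prescriptions\<close>

definition trace :: "nat set \<Rightarrow> form set \<Rightarrow> nat set" where
  "trace U w = {v \<in> U. Var v \<in> tp w}"

lemma trace_mono: "point L v \<Longrightarrow> point L w \<Longrightarrow> w \<subseteq> v \<Longrightarrow> trace U v = trace U w"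
  using tp_mono[of v w] by (simp add: trace_def)

text \<open>The formula to be substituted for y: where it holds, the variables in U have reached
  their values at the top.\<close>

definition decided :: "nat set \<Rightarrow> form" where
  "decided U = conjs ((\<lambda>v. Var v \<^bold>\<or> \<^bold>\<not> Var v) ` U)"

lemma neg_tp:
  assumes w: "point L w"
  shows "(\<^bold>\<not> A) \<in> w \<longleftrightarrow> A \<notin> tp w"
proof
  assume A: "(\<^bold>\<not> A) \<in> w"
  show "A \<notin> tp w"
  proof
    assume "A \<in> tp w"
    then have "(\<^bold>\<not> \<^bold>\<not> A) \<in> w" by (simp add: tp_def)
    from mem_mp[OF w this A] show False using w by simp
  qed
next
  assume "A \<notin> tp w"
  then show "(\<^bold>\<not> A) \<in> w"
    using weak_excluded_middle[OF w, of A] by (simp add: tp_def)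
qed

lemma mem_decided:
  assumes "finite U" "point L w"
  shows "decided U \<in> w \<longleftrightarrow> (\<forall>v\<in>U. Var v \<in> tp w \<longrightarrow> Var v \<in> w)"
proof -
  have "decided U \<in> w \<longleftrightarrow> (\<forall>v\<in>U. Var v \<in> w \<or> Var v \<notin> tp w)"
    using assms unfolding decided_def by (simp add: neg_tp)
  then show ?thesis by auto
qed

text \<open>Above such points the variables in U are constant, so equal traces make the two cones
  bisimilar.\<close>

lemma decided_agree:
  assumes "finite U" "point L c" "point L c'" "decided U \<in> c" "decided U \<in> c'" "trace U c = trace U c'"
    and "vars E \<subseteq> U"
  shows "E \<in> c \<longleftrightarrow> E \<in> c'"
proof -
  have "subst Var E \<in> c \<longleftrightarrow> subst Var E \<in> c'"
  proof (rule mem_bisim[where Z = "\<lambda>a b. point L a \<and> point L b \<and> decided U \<in> a \<and> decided U \<in> b \<and> trace U a = trace U b"],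
      goal_cases)
    case (2 a b x)
    then have x: "x \<in> U" using assms(7) by auto
    have "Var x \<in> c \<longleftrightarrow> x \<in> trace U c" if "point L c" "decided U \<in> c" for c
      using that(2) x subset_tp_self[OF that(1)] unfolding mem_decided[OF assms(1) that(1)]
      by (auto simp: trace_def)
    then show ?case using 2(1) by simp
  next
    case (3 a b a')
    then show ?case using trace_mono[of a' a U] by (intro exI[of _ b]) auto
  next
    case (4 a b b')
    then show ?case using trace_mono[of b' b U] by (intro exI[of _ a]) auto
  qed (use assms in auto)
  then show ?thesis by simp
qed

text \<open>Take t to be the value of \<mu> at the top and S the set of its values at maximal
  undecided points, over one trace. To extend a given \<sigma> at a hub, a substitution s for the
  variables in U lets each point above the hub imitate a point at which \<mu> has the required
  value.\<close>

lemma unifier_covered: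
  assumes X: "finite X" "vars A \<subseteq> X" "y \<notin> X" and \<mu>: "subst \<mu> A \<in> L"
    and U: "U = (\<Union>x\<in>X. vars (\<mu> x))" and w0: "point L w0"
  shows "\<exists>t S. good A X t S \<and> (\<forall>w. point L w \<longrightarrow> trace U w = trace U w0 \<longrightarrow>
    subst (\<mu>(y := decided U)) (proj_form A X y t S) \<in> w)"
proof -
  have fU: "finite U" using X(1) U by simp
  have \<mu>U: "vars (\<mu> x) \<subseteq> U" if "x \<in> X" for x using U that by auto
  let ?\<tau> = "trace U w0" and ?\<delta> = "decided U"
  define D where "D c \<longleftrightarrow> point L c \<and> ?\<delta> \<in> c \<and> trace U c = ?\<tau>" for c
  define t where "t = val X \<mu> (tp w0)"
  define M where "M u \<longleftrightarrow> point L u \<and> ?\<delta> \<notin> u \<and> (\<forall>u'. point L u' \<longrightarrow> u \<subset> u' \<longrightarrow> ?\<delta> \<in> u') \<and> trace U u = ?\<tau>" for u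
  define S where "S = {val X \<mu> u | u. M u}"
  have D_tp: "D (tp w)" if "point L w" "trace U w = ?\<tau>" for w
    using that point_tp[OF that(1)] mem_decided[OF fU point_tp[OF that(1)]] by (simp add: D_def trace_def)
  have D_up: "D c'" if "D c" "point L c'" "c \<subseteq> c'" for c c'
    using that trace_mono[of c' c U] by (auto simp: D_def)
  have D_agree: "E \<in> c \<longleftrightarrow> E \<in> c'" if "D c" "D c'" "vars E \<subseteq> U" for c c' E
    using decided_agree[OF fU, of c c' E] that by (auto simp: D_def)
  have Dt: "\<mu> x \<in> c \<longleftrightarrow> x \<in> t" if "D c" "x \<in> X" for c x
    using D_agree[OF that(1) D_tp[OF w0] \<mu>U[OF that(2)]] that(2) by (auto simp: t_def val_def)
  have D_var: "Var v \<in> c \<longleftrightarrow> v \<in> ?\<tau>" if "D c" "v \<in> U" for c v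
    using D_agree[OF that(1) D_tp[OF w0], of "Var v"] that(2) by (auto simp: trace_def)
  have tX: "t \<subseteq> X" "S \<subseteq> Pow X" by (auto simp: t_def S_def val_def)
  have const: "subst (const_subst t) A \<in> L"
    unfolding L_iff_points
  proof (intro allI impI)
    fix w assume w: "point L w"
    have "subst (const_subst t) A \<in> w \<longleftrightarrow> subst \<mu> A \<in> tp w0"
    proof (rule mem_bisim[where Z = "\<lambda>a b. point L a \<and> b = tp w0"], goal_cases)
      case (2 a b x)
      then have "x \<in> X" using X by auto
      then show ?case
        using 2 Dt[OF D_tp[OF w0]] by (auto simp: const_subst_def)
    next
      case (4 a b b')
      then have "b' = tp w0" using tp_subset[OF _ w0] by auto
      then show ?case using 4(1) by (intro exI[of _ a]) simp
    qed (use w point_tp[OF w0] in auto)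
    then show "subst (const_subst t) A \<in> w"
      using L_point[OF \<mu> point_tp[OF w0]] by simp
  qed
  have "\<exists>\<tau>. (\<forall>u. point L u \<longrightarrow> w \<subset> u \<longrightarrow> (\<forall>x\<in>X. \<tau> x \<in> u \<longleftrightarrow> \<sigma> x \<in> u)) \<and> subst \<tau> A \<in> w"
    if hub: "hub w" and vt: "val X \<sigma> (tp w) = t"
      and vS: "\<And>u. point L u \<Longrightarrow> w \<subset> u \<Longrightarrow> val X \<sigma> u \<in> insert t S" for w \<sigma>
  proof -
    have w: "point L w" using hub by (simp add: hub_def)
    have "\<forall>g\<in>S. \<exists>u. M u \<and> val X \<mu> u = g"
      unfolding S_def by auto
    from bchoice[OF this] obtain C where C: "\<And>g. g \<in> S \<Longrightarrow> M (C g) \<and> val X \<mu> (C g) = g"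
      by auto
    define E where "E = conjs (\<sigma> ` t)"
    define G where "G g = conjs (\<sigma> ` g \<union> (\<lambda>x. \<sigma> x \<^bold>\<longrightarrow> E) ` (X - g))" for g
    \<comment> \<open>Above the hub, E holds where the value is t, and elsewhere \<open>G g\<close>
      holds iff the value is g. Hence v gets its final value at the former points, and the value it
      has at the representative \<open>C g\<close> at the latter.\<close>
    define s where "s v = (if v \<in> ?\<tau> then E \<^bold>\<or> disjs (G ` {g \<in> S. Var v \<in> C g}) else \<^bold>\<bottom>)" for v
    have fin: "finite t" "finite S"
      using finite_subset[OF tX(1) X(1)] finite_Pow_Pow[OF X(1) tX(2)] by simp_all
    have fg: "finite g" if "g \<in> S" for g
      using that tX(2) X(1) by (auto intro: finite_subset[of g X])
    have memE: "E \<in> u \<longleftrightarrow> (\<forall>x\<in>t. \<sigma> x \<in> u)" if "point L u" for u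
      using that fin by (simp add: E_def)
    have memG: "G g \<in> u \<longleftrightarrow> (\<forall>x\<in>g. \<sigma> x \<in> u) \<and> (\<forall>x\<in>X - g. (\<sigma> x \<^bold>\<longrightarrow> E) \<in> u)" if "point L u" "g \<in> S" for u g
      using that fg[OF that(2)] X(1) by (auto simp: G_def ball_Un)
    have strict: "u \<subseteq> tp w" "u' = u \<or> u' = tp w"
      if "point L u" "w \<subset> u" "point L u'" "u \<subseteq> u'" for u u'
    proof -
      show "u \<subseteq> tp w" using subset_tp[OF that(1) _ w] that(2) by auto
      show "u' = u \<or> u' = tp w" using hub that unfolding hub_def by (cases "u = u'") auto
    qed
    have E_iff: "E \<in> u \<longleftrightarrow> val X \<sigma> u = t" if "point L u" "w \<subset> u" for u
    proof -
      have "val X \<sigma> u \<subseteq> t"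
        using val_mono[OF strict(1)[OF that that(1) subset_refl], of X \<sigma>] vt by simp
      then show ?thesis
        unfolding memE[OF that(1)] using tX(1) by (auto simp: val_def)
    qed
    have E_tp: "E \<in> tp w" unfolding memE[OF point_tp[OF w]] using vt by (auto simp: val_def)
    have G_iff: "G g \<in> u \<longleftrightarrow> g = val X \<sigma> u" if u: "point L u" "w \<subset> u" and nt: "val X \<sigma> u \<noteq> t" and g: "g \<in> S" for u g
    proof
      assume Gu: "G g \<in> u"
      have "\<sigma> x \<notin> u" if "x \<in> X - g" for x
        using Gu that mem_mp[OF u(1), of "\<sigma> x" E] nt E_iff[OF u] unfolding memG[OF u(1) g] by auto
      then show "g = val X \<sigma> u"
        using Gu g tX(2) unfolding memG[OF u(1) g] by (auto simp: val_def)
    next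
      assume g': "g = val X \<sigma> u"
      have "(\<sigma> x \<^bold>\<longrightarrow> E) \<in> u" if x: "x \<in> X - g" for x
        unfolding mem_Imp[OF u(1)]
      proof (intro allI impI)
        fix u' assume u': "point L u'" "u \<subseteq> u'" "\<sigma> x \<in> u'"
        then have "u' \<noteq> u" using x g' by (auto simp: val_def)
        then have "u' = tp w" using strict(2)[OF u u'(1,2)] by simp
        then show "E \<in> u'" using E_tp by simp
      qed
      then show "G g \<in> u" unfolding memG[OF u(1) g] using g' by (auto simp: val_def)
    qed
    \<comment> \<open>Points of value t are matched with every decided point of the trace, the
      others with their representative, all of whose proper successors are decided. This is a
      bisimulation for the variables in U.\<close>
    define R where "R u c \<longleftrightarrow> point L u \<and> w \<subset> u \<and>
      (if val X \<sigma> u = t then D c else c = C (val X \<sigma> u))" for u c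
    have inS: "val X \<sigma> u \<in> S" if "point L u" "w \<subset> u" "val X \<sigma> u \<noteq> t" for u
      using vS[OF that(1,2)] that(3) by simp
    have Rc: "point L c" "trace U c = ?\<tau>" if "R u c" for u c
    proof -
      have "D c \<or> M c"
        using that C[OF inS, of u] unfolding R_def by (auto split: if_splits)
      then show "point L c" "trace U c = ?\<tau>" by (auto simp: D_def M_def)
    qed
    have s_iff: "s v \<in> u \<longleftrightarrow> Var v \<in> c" if R: "R u c" and v: "v \<in> U" for u c v
    proof -
      have u: "point L u" "w \<subset> u" using R by (auto simp: R_def)
      have s: "s v \<in> u \<longleftrightarrow> v \<in> ?\<tau> \<and> (E \<in> u \<or> (\<exists>g\<in>S. Var v \<in> C g \<and> G g \<in> u))"
        using u(1) fin by (auto simp: s_def)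
      show ?thesis
      proof (cases "val X \<sigma> u = t")
        case True
        then show ?thesis using s E_iff[OF u] D_var[OF _ v] R by (auto simp: R_def)
      next
        case False
        then have c: "c = C (val X \<sigma> u)" using R by (simp add: R_def)
        have "Var v \<in> c \<Longrightarrow> v \<in> ?\<tau>"
          using Rc[OF R] v subset_tp_self by (auto simp: trace_def)
        then show ?thesis
          using s E_iff[OF u] False G_iff[OF u False] inS[OF u False] c by auto
      qed
    qed
    have s_vars: "subst s E' \<in> u \<longleftrightarrow> E' \<in> c" if R: "R u c" and E': "vars E' \<subseteq> U" for u c E'
    proof -
      have "subst s E' \<in> u \<longleftrightarrow> subst Var E' \<in> c"
      proof (rule mem_bisim[where Z = R], goal_cases)
        case (1 a b)
        then show ?case using Rc(1)[OF 1] unfolding R_def by iprover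
      next
        case (2 a b x)
        have "x \<in> U" using 2(2) E' by auto
        from s_iff[OF 2(1) this] show ?case .
      next
        case (3 a b a')
        have a: "point L a" "w \<subset> a" using 3(1) unfolding R_def by iprover+
        from strict(2)[OF a 3(2,3)] show ?case
        proof
          assume "a' = a"
          then show ?thesis using 3(1) by auto
        next
          assume a': "a' = tp w"
          then have "w \<subset> a'" using a 3(3) by auto
          moreover have "D (tp b)"
            by (rule D_tp[OF Rc[OF 3(1)]])
          ultimately have "R a' (tp b)"
            unfolding R_def using 3(2) a' vt by simp
          then show ?thesis using subset_tp_self[OF Rc(1)[OF 3(1)]] by auto
        qed
      next
        case (4 a b b')
        have a: "point L a" "w \<subset> a" using 4(1) unfolding R_def by iprover+
        show ?case
        proof (cases "b' = b \<or> val X \<sigma> a = t")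
          case True
          have "R a b'"
          proof (cases "b' = b")
            case True
            then show ?thesis using 4(1) by simp
          next
            case False
            with True have "val X \<sigma> a = t" by simp
            moreover from this have "D b'"
              using D_up[OF _ 4(2,3)] 4(1) unfolding R_def by simp
            ultimately show ?thesis using a unfolding R_def by simp
          qed
          then show ?thesis by auto
        next
          case False
          then have "M b" using 4(1) C[OF inS[OF a]] unfolding R_def by simp
          moreover have "b \<subset> b'" using False 4(3) by auto
          ultimately have "D b'"
            using 4(2) trace_mono[OF 4(2) Rc(1)[OF 4(1)] 4(3)] unfolding M_def D_def by simp
          moreover have "w \<subset> tp w" using strict(1)[OF a a(1) subset_refl] a(2) by auto
          ultimately have "R (tp w) b'"
            using vt point_tp[OF w] by (simp add: R_def)
          moreover have "a \<subseteq> tp w" using strict(1)[OF a a(1) subset_refl] .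
          ultimately show ?thesis by auto
        qed
      qed (rule R)
      then show ?thesis by simp
    qed
    have "subst s (\<mu> x) \<in> u \<longleftrightarrow> \<sigma> x \<in> u" if u: "point L u" "w \<subset> u" and x: "x \<in> X" for u x
    proof (cases "val X \<sigma> u = t")
      case True
      then have "R u (tp w0)" using u D_tp[OF w0 refl] unfolding R_def by simp
      from s_vars[OF this \<mu>U[OF x]] have "subst s (\<mu> x) \<in> u \<longleftrightarrow> x \<in> t"
        using x by (simp add: t_def val_def)
      then show ?thesis using x unfolding True[symmetric] by (simp add: val_def)
    next
      case False
      then have "R u (C (val X \<sigma> u))" using u unfolding R_def by simp
      from s_vars[OF this \<mu>U[OF x]] have "subst s (\<mu> x) \<in> u \<longleftrightarrow> x \<in> val X \<mu> (C (val X \<sigma> u))"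
        using x by (simp add: val_def)
      also have "\<dots> \<longleftrightarrow> x \<in> val X \<sigma> u" using C[OF inS[OF u False]] by simp
      finally show ?thesis using x by (simp add: val_def)
    qed
    \<comment> \<open>Nothing has to be matched at the hub itself, as L is closed under
      substitution.\<close>
    moreover have "subst (\<lambda>x. subst s (\<mu> x)) A \<in> w"
      using L_point[OF subst_L[OF \<mu>, of s] w] unfolding subst_subst .
    ultimately show ?thesis by (intro exI[of _ "\<lambda>x. subst s (\<mu> x)"]) simp
  qed
  then have "good A X t S"
    unfolding good_def using tX const by simp
  moreover have "subst (\<mu>(y := ?\<delta>)) (proj_form A X y t S) \<in> w"
    if w: "point L w" "trace U w = ?\<tau>" for w
  proof -
    let ?\<alpha> = "\<mu>(y := ?\<delta>)"
    have v: "val X ?\<alpha> u = val X \<mu> u" for u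
      using X(3) by (auto simp: val_def)
    have "subst ?\<alpha> A = subst \<mu> A"
      by (rule subst_cong_vars) (use X in auto)
    moreover have tr: "trace U u = ?\<tau>" if "point L u" "w \<subseteq> u" for u
      using trace_mono[OF that(1) w(1) that(2)] w(2) by simp
    moreover have "val X \<mu> u = t" if "point L u" "w \<subseteq> u" "?\<delta> \<in> u" for u
    proof -
      have "D u" using that tr by (simp add: D_def)
      then show ?thesis using Dt tX(1) by (auto simp: val_def)
    qed
    moreover have "val X \<mu> u \<in> S" if "point L u" "w \<subseteq> u" "?\<delta> \<notin> u"
      "\<forall>u'. point L u' \<longrightarrow> u \<subset> u' \<longrightarrow> ?\<delta> \<in> u'" for u
      using that tr unfolding S_def M_def by blast
    moreover have "?\<delta> \<in> tp w" using D_tp[OF w] by (simp add: D_def)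
    ultimately show ?thesis
      unfolding mem_proj_form[OF X(1) tX w(1)] v using L_point[OF \<mu> w(1)] by simp
  qed
  ultimately show ?thesis by blast
qed

section \<open>Unitary unification\<close>

text \<open>Nested case distinctions on the variables 2k + 2, with d as the default. Double negation
  makes weak excluded middle decide each of them at every point, and in the same way along a
  cone.\<close>

primrec glue :: "substitution \<Rightarrow> substitution list \<Rightarrow> nat \<Rightarrow> substitution" where
  "glue d [] k = d"
| "glue d (\<sigma> # \<sigma>s) k = (\<lambda>x. (\<^bold>\<not> \<^bold>\<not> Var (2 * k + 2) \<^bold>\<and> \<sigma> x) \<^bold>\<or> (\<^bold>\<not> Var (2 * k + 2) \<^bold>\<and> glue d \<sigma>s (Suc k) x))"

lemma neg_neg_tp: "(\<^bold>\<not> \<^bold>\<not> A) \<in> w \<longleftrightarrow> A \<in> tp w"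
  by (simp add: tp_def)

lemma glue_Cons:
  assumes "point L w"
  shows "subst \<alpha> (glue d (\<sigma> # \<sigma>s) k x) \<in> w \<longleftrightarrow>
    (if \<alpha> (2 * k + 2) \<in> tp w then subst \<alpha> (\<sigma> x) \<in> w else subst \<alpha> (glue d \<sigma>s (Suc k) x) \<in> w)"
  using assms by (simp add: neg_tp neg_neg_tp del: add_2_eq_Suc')

lemma glue_nth:
  assumes "point L w" "j < length \<sigma>s" "\<And>i. i < length \<sigma>s \<Longrightarrow> \<alpha> (2 * (k + i) + 2) \<in> tp w \<longleftrightarrow> i = j"
  shows "subst \<alpha> (glue d \<sigma>s k x) \<in> w \<longleftrightarrow> subst \<alpha> ((\<sigma>s ! j) x) \<in> w"
  using assms
proof (induction \<sigma>s arbitrary: k j)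
  case (Cons \<sigma> \<sigma>s)
  show ?case
  proof (cases j)
    case 0
    then show ?thesis using Cons.prems(3)[of 0] glue_Cons[OF Cons.prems(1)] by simp
  next
    case (Suc j')
    have "subst \<alpha> (glue d \<sigma>s (Suc k) x) \<in> w \<longleftrightarrow> subst \<alpha> ((\<sigma>s ! j') x) \<in> w"
    proof (rule Cons.IH[OF Cons.prems(1)])
      show "j' < length \<sigma>s" using Cons.prems(2) Suc by simp
      fix i assume "i < length \<sigma>s"
      then show "\<alpha> (2 * (Suc k + i) + 2) \<in> tp w \<longleftrightarrow> i = j'"
        using Cons.prems(3)[of "Suc i"] Suc by simp
    qed
    moreover have "\<alpha> (2 * k + 2) \<notin> tp w" using Cons.prems(3)[of 0] Suc by simp
    ultimately show ?thesis using glue_Cons[OF Cons.prems(1)] Suc by simp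
  qed
qed simp

text \<open>On a single cone the same case applies throughout, so the glued substitution acts there
  like one of its members.\<close>

lemma glue_unifier:
  assumes "subst d A \<in> L" "\<And>\<sigma>. \<sigma> \<in> set \<sigma>s \<Longrightarrow> subst \<sigma> A \<in> L"
  shows "subst (glue d \<sigma>s k) A \<in> L"
  using assms(2)
proof (induction \<sigma>s arbitrary: k)
  case Nil
  then show ?case using assms(1) by simp
next
  case (Cons \<sigma> \<sigma>s)
  show ?case
    unfolding L_iff_points
  proof (intro allI impI)
    fix w assume w: "point L w"
    have tp: "tp v = tp w" if "point L v" "w \<subseteq> v" for v
      using tp_mono[OF that(1) w that(2)] .
    show "subst (glue d (\<sigma> # \<sigma>s) k) A \<in> w"
    proof (cases "Var (2 * k + 2) \<in> tp w")
      case True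
      then have "subst (glue d (\<sigma> # \<sigma>s) k) A \<in> w \<longleftrightarrow> subst \<sigma> A \<in> w"
        by (intro mem_subst_cong[OF w]) (use glue_Cons[of _ Var] tp in simp)
      then show ?thesis using L_point[OF Cons.prems w] by simp
    next
      case False
      then have "subst (glue d (\<sigma> # \<sigma>s) k) A \<in> w \<longleftrightarrow> subst (glue d \<sigma>s (Suc k)) A \<in> w"
        by (intro mem_subst_cong[OF w]) (use glue_Cons[of _ Var] tp in simp)
      then show ?thesis using L_point[OF Cons.IH w] Cons.prems by simp
    qed
  qed
qed

text \<open>The variables of \<open>A\<close> are renamed to odd numbers; \<open>0\<close> serves as the variable \<open>y\<close> of the
  projective formulas, and the other even numbers select one of them.\<close>

lemma unifiable_unitary:
  assumes unif: "subst \<sigma>0 A \<in> L"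
  shows "\<exists>\<epsilon>. subst \<epsilon> A \<in> L \<and> (\<forall>\<mu>. subst \<mu> A \<in> L \<longrightarrow> (\<exists>\<alpha>. subst_eq L (\<alpha> \<circ>\<^sub>s \<epsilon>) \<mu>))"
proof (cases "\<exists>w. point L w")
  \<comment> \<open>Without points L is inconsistent.\<close>
  case False
  then have "C \<in> L" for C by (simp add: L_iff_points)
  then show ?thesis by (simp add: subst_eq_def)
next
  case True
  then obtain w0 where w0: "point L w0" by blast
  define A' where "A' = subst (\<lambda>x. Var (2 * x + 1)) A"
  define X where "X = (\<lambda>x. 2 * x + 1) ` vars A"
  have "vars (subst (\<lambda>x. Var (2 * x + 1)) C) = (\<lambda>x. 2 * x + 1) ` vars C" for C
    by (induction C) auto
  then have X: "finite X" "vars A' \<subseteq> X" "0 \<notin> X"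
    by (auto simp: X_def A'_def)
  define I where "I = {(t, S). good A' X t S}"
  have "I \<subseteq> Pow X \<times> Pow (Pow X)"
    by (auto simp: I_def good_def)
  then have "finite I"
    using X(1) by (auto intro: finite_subset)
  then obtain js where I: "set js = I" using finite_list by blast
  define B where "B i = proj_form A' X 0 (fst i) (snd i)" for i
  have "\<forall>i\<in>I. \<exists>\<sigma>. subst \<sigma> (B i) \<in> L \<and> (\<forall>z. (B i \<^bold>\<longrightarrow> (\<sigma> z \<^bold>\<longleftrightarrow> Var z)) \<in> L)"
    using good_projective[OF X] by (auto simp: I_def B_def)
  then obtain \<sigma> where \<sigma>: "\<And>i. i \<in> I \<Longrightarrow> subst (\<sigma> i) (B i) \<in> L"
    "\<And>i z. i \<in> I \<Longrightarrow> (B i \<^bold>\<longrightarrow> (\<sigma> i z \<^bold>\<longleftrightarrow> Var z)) \<in> L"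
    by metis
  have \<sigma>A: "subst (\<sigma> i) A' \<in> L" if "i \<in> I" for i
    unfolding L_iff_points
  proof (intro allI impI)
    fix w assume "point L w"
    then show "subst (\<sigma> i) A' \<in> w"
      using L_point[OF \<sigma>(1)[OF that]] by (simp add: B_def proj_form_def)
  qed
  let ?\<nu> = "\<lambda>\<mu> :: substitution. \<lambda>z. \<mu> (z div 2)"
  have \<nu>: "subst (?\<nu> \<mu>) A' = subst \<mu> A" for \<mu>
    by (simp add: A'_def subst_subst)
  \<comment> \<open>The given unifier covers the points at which no selecting variable holds
    finally.\<close>
  define G where "G = glue (?\<nu> \<sigma>0) (map \<sigma> js) 0"
  have "subst G A' \<in> L"
    unfolding G_def by (rule glue_unifier) (use unif \<nu> \<sigma>A I in auto)
  \<comment> \<open>Outside A the renamed variables are left free, because an instance must agree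
    with \<mu> on all variables.\<close>
  define \<epsilon> where "\<epsilon> x = (if x \<in> vars A then G (2 * x + 1) else Var (2 * x + 1))" for x
  have "subst \<epsilon> A = subst G A'"
    unfolding A'_def subst_subst by (rule subst_cong_vars) (simp add: \<epsilon>_def)
  then have "subst \<epsilon> A \<in> L" using \<open>subst G A' \<in> L\<close> by simp
  moreover have "\<exists>\<alpha>. subst_eq L (\<alpha> \<circ>\<^sub>s \<epsilon>) \<mu>" if \<mu>: "subst \<mu> A \<in> L" for \<mu>
  proof -
    define U where "U = (\<Union>x\<in>X. vars (?\<nu> \<mu> x))"
    have fU: "finite U" using X(1) by (simp add: U_def)
    have "\<exists>j < length js. \<forall>v. point L v \<longrightarrow> trace U v = trace U w \<longrightarrow>
        subst ((?\<nu> \<mu>)(0 := decided U)) (B (js ! j)) \<in> v" if w: "point L w" for w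
    proof -
      obtain t S where "good A' X t S"
        "\<forall>v. point L v \<longrightarrow> trace U v = trace U w \<longrightarrow> subst ((?\<nu> \<mu>)(0 := decided U)) (proj_form A' X 0 t S) \<in> v"
        using unifier_covered[OF X _ U_def w] \<mu> unfolding \<nu> by metis
      moreover from this have "(t, S) \<in> set js" using I by (simp add: I_def)
      then obtain j where "j < length js" "js ! j = (t, S)" by (auto simp: in_set_conv_nth)
      ultimately show ?thesis by (auto simp: B_def)
    qed
    \<comment> \<open>The index depends on the trace alone, of which there are finitely many, so
      formulas can select it.\<close>
    then have "\<forall>\<tau>. \<exists>j. \<forall>w. point L w \<longrightarrow> trace U w = \<tau> \<longrightarrow> j < length js \<and>
        subst ((?\<nu> \<mu>)(0 := decided U)) (B (js ! j)) \<in> w"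
      by metis
    then obtain idx where idx: "\<And>w. point L w \<Longrightarrow> idx (trace U w) < length js \<and>
        subst ((?\<nu> \<mu>)(0 := decided U)) (B (js ! idx (trace U w))) \<in> w"
      by metis
    \<comment> \<open>Only its truth at the greatest point of a cone matters. There every variable
      is decided, so exactly the formula of the actual trace holds.\<close>
    define Q where "Q \<tau> = conjs (Var ` \<tau> \<union> (\<lambda>v. \<^bold>\<not> Var v) ` (U - \<tau>))" for \<tau>
    define sel where "sel i = disjs (Q ` {\<tau>. \<tau> \<subseteq> U \<and> idx \<tau> = i})" for i
    have Q: "Q \<tau> \<in> tp w \<longleftrightarrow> \<tau> = trace U w" if "point L w" "\<tau> \<subseteq> U" for w \<tau>
    proof -
      have "finite \<tau>" using that(2) fU finite_subset by blast
      then show ?thesis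
        using that fU point_tp[OF that(1)] neg_tp[OF point_tp[OF that(1)]]
        unfolding Q_def trace_def by (auto simp: ball_Un)
    qed
    have sel: "sel i \<in> tp w \<longleftrightarrow> i = idx (trace U w)" if "point L w" for w i
    proof -
      have "finite {\<tau>. \<tau> \<subseteq> U \<and> idx \<tau> = i}"
        by (rule finite_subset[of _ "Pow U"]) (use fU in auto)
      moreover have "trace U w \<subseteq> U" by (auto simp: trace_def)
      ultimately show ?thesis
        using Q[OF that] point_tp[OF that] unfolding sel_def by auto
    qed
    \<comment> \<open>\<open>z div 2 - 1\<close> inverts the numbering 2i + 2 of the selecting
      variables, and \<open>z div 2\<close> undoes the renaming of the others.\<close>
    define \<alpha> where "\<alpha> z = (if odd z then \<mu> (z div 2) else if z = 0 then decided U else sel (z div 2 - 1))" for z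
    have \<alpha>: "\<alpha> (2 * i + 2) = sel i" "\<alpha> (2 * x + 1) = \<mu> x" for i x
      by (auto simp: \<alpha>_def)
    have "(subst \<alpha> (\<epsilon> x) \<^bold>\<longleftrightarrow> \<mu> x) \<in> L" for x
    proof (rule Iff_L)
      fix w assume w: "point L w"
      show "subst \<alpha> (\<epsilon> x) \<in> w \<longleftrightarrow> \<mu> x \<in> w"
      proof (cases "x \<in> vars A")
        case False
        then show ?thesis using \<alpha>(2) by (simp add: \<epsilon>_def)
      next
        case True
        let ?j = "idx (trace U w)"
        have j: "?j < length js" using idx[OF w] by simp
        then have jI: "js ! ?j \<in> I" using I by auto
        have "subst \<alpha> (\<epsilon> x) \<in> w \<longleftrightarrow> subst \<alpha> ((map \<sigma> js ! ?j) (2 * x + 1)) \<in> w"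
          unfolding \<epsilon>_def G_def using True
          by (simp only: if_True) (rule glue_nth[OF w], use j sel[OF w] \<alpha>(1) in auto)
        also have "\<dots> \<longleftrightarrow> \<alpha> (2 * x + 1) \<in> w"
        proof -
          have tS: "fst (js ! ?j) \<subseteq> X" "snd (js ! ?j) \<subseteq> Pow X"
            using jI by (auto simp: I_def good_def)
          have "subst \<alpha> (B (js ! ?j)) = subst ((?\<nu> \<mu>)(0 := decided U)) (B (js ! ?j))"
          proof (rule subst_cong_vars)
            fix z assume "z \<in> vars (B (js ! ?j))"
            then have "z \<in> insert 0 X"
              using vars_proj_form[OF X(1,2) tS] unfolding B_def by auto
            then show "\<alpha> z = ((?\<nu> \<mu>)(0 := decided U)) z"
              by (auto simp: \<alpha>_def X_def)
          qed
          then have B: "subst \<alpha> (B (js ! ?j)) \<in> w" using idx[OF w] by simp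
          let ?z = "2 * x + 1"
          have "(subst \<alpha> (B (js ! ?j)) \<^bold>\<longrightarrow> (subst \<alpha> (\<sigma> (js ! ?j) ?z) \<^bold>\<longleftrightarrow> \<alpha> ?z)) \<in> w"
            using L_point[OF subst_L[OF \<sigma>(2)[OF jI]] w, of \<alpha> ?z] by simp
          from mem_Iff[OF w mem_mp[OF w this B]] show ?thesis using j by simp
        qed
        finally show ?thesis unfolding \<alpha>(2) .
      qed
    qed
    then show ?thesis
      by (auto simp: subst_eq_def subst_comp_def)
  qed
  ultimately show ?thesis by blast
qed

end

theorem theorem5p16:
  fixes L :: "form set"
  assumes "intermediate_logic L"
  shows
    "(hereditary_unitary_unification L \<longleftrightarrow> logic_of H_un \<subseteq> L) \<and>
     (logic_of H_un \<subseteq> L \<longleftrightarrow>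
        omits L (add_top (rfork_frame 2)) \<and> omits L (add_top G3_frame) \<and> omits L (fork_frame 2)) \<and>
     (omits L (add_top (rfork_frame 2)) \<and> omits L (add_top G3_frame) \<and> omits L (fork_frame 2) \<longleftrightarrow>
        jankov (add_top G3_frame) \<in> L \<and> jankov (add_top (rfork_frame 2)) \<in> L \<and> jankov (fork_frame 2) \<in> L)"
proof -
  let ?omits = "\<lambda>L. omits L (add_top (rfork_frame 2)) \<and> omits L (add_top G3_frame) \<and> omits L (fork_frame 2)"
  interpret logic L by standard (rule assms)
  have frames: "is_frame (add_top (rfork_frame 2))" "is_frame (add_top G3_frame)" "is_frame (fork_frame 2)"
    by (intro is_frame_add_top is_frame_rfork is_frame_G3 is_frame_fork)+
  have un: "un_logic L'" if "intermediate_logic L'" "?omits L'" for L'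
    using that by unfold_locales auto
  have jankov: "omits L F \<longleftrightarrow> jankov F \<in> L" if "is_frame F" for F
    using jankov_if_omits[OF that] omits_if_jankov[OF that] by blast
  have "?omits L" if "hereditary_unitary_unification L"
    using hereditary_omits[OF that] by simp
  moreover have "logic_of H_un \<subseteq> L" if "?omits L"
    by (rule un_logic.logic_H_un_subset[OF un[OF assms that]])
  moreover have "?omits L" if "logic_of H_un \<subseteq> L"
    using H_un_omits[OF that] by simp
  moreover have "hereditary_unitary_unification L" if "?omits L"
    unfolding hereditary_unitary_unification_def
  proof (intro allI impI)
    fix L' assume L': "intermediate_logic L'" "L \<subseteq> L'"
    \<comment> \<open>Omitting a frame is inherited by extensions, so the construction of a most
      general unifier applies to each of them.\<close>
    have "?omits L'" using that L'(2) unfolding omits_def by blast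
    from un_logic.unifiable_unitary[OF un[OF L'(1) this]] show "unitary_unification L'"
      unfolding unitary_unification_def unifier_def by blast
  qed
  ultimately show ?thesis
    using jankov[OF frames(1)] jankov[OF frames(2)] jankov[OF frames(3)] by blast
qed

end
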